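(* Let $\alpha>0$ and let $(\mathcal{M},g,\nabla,\nabla^* )$ be a statistical manifold of dimension $d\ge 2$ such that both $\nabla$ and $\nabla^*$ are projectively flat and have constant sectional curvature $-\alpha$ (case (i)) or $+\alpha$ (case (ii)) with respect to $g$. Near a point of $\mathcal{M}$, let $\xi,\eta$ be local coordinate systems and $\varphi(\xi),\psi(\eta)$ local functions having the properties (a)–(d) listed in the context. (i) If the curvature is $-\alpha<0$, define the local $L^{(\alpha)}$-divergence $$\mathbf{D}[q:p]=\frac1\alpha\log\left(1+\alpha\,\xi_q\cdot\eta_p\right)-\varphi(\xi_q)-\psi(\eta_p).$$ (ii) If the curvature is $\alpha>0$, define the local $L^{(-\alpha)}$-divergence $$\mathbf{D}[q:p]=\varphi(\xi_q)+\psi(\eta_p)-\frac1\alpha\log\left(1+\alpha\,\xi_q\cdot\eta_p\right).$$ Then these divergences are independent of the choices of $\xi$, $\eta$, $\varphi$ and $\psi$. Furthermore, the divergence $\mathbf{D}$ (called the canonical divergence) induces the given Riemannian metric $g$ and the given primal and dual connections $\nabla$ and $\nabla^*$.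
   Context: A statistical manifold $(\mathcal{M},g,\nabla,\nabla^* )$ is a smooth manifold with a Riemannian metric $g=\langle\cdot,\cdot\rangle$ and torsion-free affine connections $\nabla$ (primal) and $\nabla^*$ (dual) satisfying $Z\langle X,Y\rangle=\langle\nabla_ZX,Y\rangle+\langle X,\nabla^*_ZY\rangle$ for all vector fields $X,Y,Z$. A torsion-free connection $\nabla$ is projectively flat if there are a flat torsion-free connection $\widetilde\nabla$ (one whose curvature tensor vanishes) and a $1$-form $\tau$ with $\nabla_XY=\widetilde\nabla_XY+\tau(X)Y+\tau(Y)X$ for all smooth vector fields $X,Y$. It has constant sectional curvature $k$ with respect to $g$ if its curvature tensor $R(X,Y)Z=\nabla_X\nabla_YZ-\nabla_Y\nabla_XZ-\nabla_{[X,Y]}Z$ equals $k(\langle Y,Z\rangle X-\langle X,Z\rangle Y)$. A function $f$ is $\alpha$-exponentially concave (resp. convex) if $e^{\alpha f}$ is concave (resp. convex). A primal (dual) geodesic is a geodesic of $\nabla$ ($\nabla^*$). $\xi_q$ and $\eta_p$ denote the $\xi$-coordinates of $q$ and the $\eta$-coordinates of $p$, and $\cdot$ is the Euclidean dot product. Properties of $\xi,\eta,\varphi,\psi$ (under the stated hypotheses on $\mathcal{M}$, such objects exist near each point): (a) the primal geodesics are straight lines in the $\xi$ coordinates up to time reparameterizations, and the dual geodesics are straight lines in the $\eta$ coordinates up to time reparameterizations; (b) the coordinates satisfy $1+\alpha\sum_{\ell=1}^d\xi^\ell\eta^\ell>0$; (c) $\varphi(\xi)$ and $\psi(\eta)$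 are local functions, $\alpha$-exponentially concave in case (i) and $\alpha$-exponentially convex in case (ii), satisfying the generalized Fenchel identity $\varphi(\xi)+\psi(\eta)\equiv\frac1\alpha\log(1+\alpha\,\xi\cdot\eta)$ (where $\xi$ and $\eta$ are the coordinates of the same point); (d) under the coordinate systems $\xi$ and $\eta$ respectively, the metric is given in case (i) by $g_{ij}(\xi)=-\frac{\partial^2\varphi}{\partial\xi^i\partial\xi^j}(\xi)-\alpha\frac{\partial\varphi}{\partial\xi^i}(\xi)\frac{\partial\varphi}{\partial\xi^j}(\xi)$ and $g_{ij}(\eta)=-\frac{\partial^2\psi}{\partial\eta^i\partial\eta^j}(\eta)-\alpha\frac{\partial\psi}{\partial\eta^i}(\eta)\frac{\partial\psi}{\partial\eta^j}(\eta)$; in case (ii) the negative signs are replaced by positive signs. A divergence $\mathbf{D}$ induces $(g,\nabla,\nabla^* )$ if, in local coordinates $\xi$ (with $\mathbf{D}[\xi:\xi']$ denoting the divergence between the points with coordinates $\xi$ and $\xi'$, and $\partial_i=\partial/\partial\xi^i$), $g_{ij}=-\partial_{\xi^i}\partial_{\xi'^j}\mathbf{D}[\xi:\xi']|_{\xi'=\xi}$, $\langle\nabla_{\partial_i}\partial_j,\partial_k\rangle=-\partial_{\xi^i}\partial_{\xi^j}\partial_{\xi'^k}\mathbf{D}[\xi:\xi']|_{\xi'=\xi}$, and $\langle\nabla^*_{\partial_i}\partial_j,\partial_k\rangle=-\partial_{\xi'^i}\partial_{\xi'^j}\partial_{\xi^k}\mathbf{D}[\xi:\xi']|_{\xi'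=\xi}$.
   Formalization: Added hypothesis: D[q:p] ≥ 0 for q near p (the generalized Fenchel inequality). With (a)–(d) alone the claim fails: on the hyperbolic plane in Klein coordinates, η = −(ξ+sJξ), J the rotation by 90°, satisfies (a)–(d) for every s, but D depends on s and induces g only for s = 0. *)

theory Defs
  imports "HOL-Analysis.Analysis"
begin

section \<open>Smooth functions on open subsets of Euclidean spaces\<close>

text \<open>Only used for open \<open>S\<close>.\<close>

primrec Ck_on :: "nat \<Rightarrow> 'a::euclidean_space set \<Rightarrow> ('a \<Rightarrow> 'b::real_normed_vector) \<Rightarrow> bool" where
  "Ck_on 0 S f \<longleftrightarrow> continuous_on S f"
| "Ck_on (Suc k) S f \<longleftrightarrow>
     (\<forall>x\<in>S. f differentiable (at x)) \<and> (\<forall>v. Ck_on k S (\<lambda>x. frechet_derivative f (at x) v))"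

definition smooth_on :: "'a::euclidean_space set \<Rightarrow> ('a \<Rightarrow> 'b::real_normed_vector) \<Rightarrow> bool" where
  "smooth_on S f \<longleftrightarrow> (\<forall>k. Ck_on k S f)"

definition partial :: "'d \<Rightarrow> (real^'d \<Rightarrow> real) \<Rightarrow> real^'d \<Rightarrow> real" where
  "partial i f x = frechet_derivative f (at x) (axis i 1)"


section \<open>Smooth manifolds\<close>

text \<open>A chart is an open domain together with a coordinate map; the values of the map outside
  the domain are irrelevant.\<close>

type_synonym ('m, 'd) chart = "'m set \<times> ('m \<Rightarrow> real^'d)"

definition chart_inv :: "('m, 'd) chart \<Rightarrow> real^'d \<Rightarrow> 'm" where
  "chart_inv c = inv_into (fst c) (snd c)"

definition is_chart :: "('m::topological_space, 'd::finite) chart \<Rightarrow> bool" where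
  "is_chart c \<longleftrightarrow> open (fst c) \<and> open (snd c ` fst c) \<and>
     homeomorphism (fst c) (snd c ` fst c) (snd c) (chart_inv c)"

definition compatible :: "('m::topological_space, 'd::finite) chart \<Rightarrow> ('m, 'd) chart \<Rightarrow> bool" where
  "compatible c c' \<longleftrightarrow>
     smooth_on (snd c ` (fst c \<inter> fst c')) (snd c' \<circ> chart_inv c) \<and>
     smooth_on (snd c' ` (fst c \<inter> fst c')) (snd c \<circ> chart_inv c')"

definition mfd :: "('m, 'd) chart set \<Rightarrow> 'm set" where
  "mfd A = \<Union> (fst ` A)"

text \<open>\<open>A\<close> is a maximal smooth atlas on the manifold \<open>mfd A\<close>, so the local coordinate
  systems of the manifold are exactly the elements of \<open>A\<close>. The manifold carries the subspace
  topology of a second countable Hausdorff space in which it is open.\<close>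

definition smooth_structure ::
    "('m::{t2_space,second_countable_topology}, 'd::finite) chart set \<Rightarrow> bool" where
  "smooth_structure A \<longleftrightarrow>
     (\<forall>c\<in>A. is_chart c) \<and> (\<forall>c\<in>A. \<forall>c'\<in>A. compatible c c') \<and>
     (\<forall>c. is_chart c \<and> fst c \<subseteq> mfd A \<and> (\<forall>c'\<in>A. compatible c c') \<longrightarrow> c \<in> A)"

definition smooth_fun ::
    "('m::topological_space, 'd::finite) chart set \<Rightarrow> 'm set \<Rightarrow> ('m \<Rightarrow> real) \<Rightarrow> bool" where
  "smooth_fun A U f \<longleftrightarrow> open U \<and> U \<subseteq> mfd A \<and>
     (\<forall>c\<in>A. smooth_on (snd c ` (fst c \<inter> U)) (f \<circ> chart_inv c))"

definition smooth_near ::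
    "('m::topological_space, 'd::finite) chart set \<Rightarrow> 'm \<Rightarrow> ('m \<Rightarrow> real) \<Rightarrow> bool" where
  "smooth_near A p f \<longleftrightarrow> (\<exists>U. p \<in> U \<and> smooth_fun A U f)"


section \<open>Tangent vectors and vector fields\<close>

text \<open>Tangent vectors at \<open>p\<close> are the derivations \<open>\<Sum>\<^sub>i a\<^sup>i \<partial>\<^sub>i|\<^sub>p\<close> acting on the functions that are
  smooth near \<open>p\<close>; on other functions they are normalised to 0, so that equality of tangent
  vectors is equality of functionals.\<close>

type_synonym 'm tvec = "('m \<Rightarrow> real) \<Rightarrow> real"
type_synonym 'm vfield = "'m \<Rightarrow> 'm tvec"

definition tangent_vec ::
    "('m::topological_space, 'd::finite) chart set \<Rightarrow> ('m, 'd) chart \<Rightarrow> 'm \<Rightarrow> real^'d \<Rightarrow> 'm tvec" where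
  "tangent_vec A c p a =
     (\<lambda>f. if smooth_near A p f then frechet_derivative (f \<circ> chart_inv c) (at (snd c p)) a else 0)"

definition tangent_space :: "('m::topological_space, 'd::finite) chart set \<Rightarrow> 'm \<Rightarrow> 'm tvec set" where
  "tangent_space A p = {tangent_vec A c p a | c a. c \<in> A \<and> p \<in> fst c}"

definition coord_field ::
    "('m::topological_space, 'd::finite) chart set \<Rightarrow> ('m, 'd) chart \<Rightarrow> 'd \<Rightarrow> 'm vfield" where
  "coord_field A c i = (\<lambda>p. tangent_vec A c p (axis i 1))"

definition tv_add :: "'m tvec \<Rightarrow> 'm tvec \<Rightarrow> 'm tvec" where
  "tv_add v w = (\<lambda>f. v f + w f)"

definition tv_scale :: "real \<Rightarrow> 'm tvec \<Rightarrow> 'm tvec" where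
  "tv_scale r v = (\<lambda>f. r * v f)"

definition vf_add :: "'m vfield \<Rightarrow> 'm vfield \<Rightarrow> 'm vfield" where
  "vf_add X Y = (\<lambda>p. tv_add (X p) (Y p))"

definition vf_scale :: "('m \<Rightarrow> real) \<Rightarrow> 'm vfield \<Rightarrow> 'm vfield" where
  "vf_scale u X = (\<lambda>p. tv_scale (u p) (X p))"

text \<open>\<open>vf_app X f\<close> is the function \<open>X f\<close>.\<close>

definition vf_app :: "'m vfield \<Rightarrow> ('m \<Rightarrow> real) \<Rightarrow> 'm \<Rightarrow> real" where
  "vf_app X f = (\<lambda>p. X p f)"

definition vector_field ::
    "('m::topological_space, 'd::finite) chart set \<Rightarrow> 'm set \<Rightarrow> 'm vfield \<Rightarrow> bool" where
  "vector_field A U X \<longleftrightarrow> open U \<and> U \<subseteq> mfd A \<and> (\<forall>p\<in>U. X p \<in> tangent_space A p) \<and>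
     (\<forall>V f. V \<subseteq> U \<and> smooth_fun A V f \<longrightarrow> smooth_fun A V (vf_app X f))"

definition lie_bracket ::
    "('m::topological_space, 'd::finite) chart set \<Rightarrow> 'm vfield \<Rightarrow> 'm vfield \<Rightarrow> 'm vfield" where
  "lie_bracket A X Y =
     (\<lambda>p f. if smooth_near A p f then X p (vf_app Y f) - Y p (vf_app X f) else 0)"

definition one_form ::
    "('m::topological_space, 'd::finite) chart set \<Rightarrow> ('m \<Rightarrow> 'm tvec \<Rightarrow> real) \<Rightarrow> bool" where
  "one_form A \<tau> \<longleftrightarrow>
     (\<forall>p\<in>mfd A. \<forall>v\<in>tangent_space A p. \<forall>w\<in>tangent_space A p. \<forall>r.
        \<tau> p (tv_add v w) = \<tau> p v + \<tau> p w \<and> \<tau> p (tv_scale r v) = r * \<tau> p v) \<and>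
     (\<forall>U X. vector_field A U X \<longrightarrow> smooth_fun A U (\<lambda>p. \<tau> p (X p)))"


section \<open>Riemannian metrics and affine connections\<close>

type_synonym 'm metric = "'m \<Rightarrow> 'm tvec \<Rightarrow> 'm tvec \<Rightarrow> real"

definition riemannian_metric ::
    "('m::topological_space, 'd::finite) chart set \<Rightarrow> 'm metric \<Rightarrow> bool" where
  "riemannian_metric A g \<longleftrightarrow>
     (\<forall>p\<in>mfd A. \<forall>u\<in>tangent_space A p. \<forall>v\<in>tangent_space A p. \<forall>w\<in>tangent_space A p. \<forall>r.
        g p u v = g p v u \<and>
        g p (tv_add u v) w = g p u w + g p v w \<and>
        g p (tv_scale r u) v = r * g p u v \<and>
        (u \<noteq> (\<lambda>f. 0) \<longrightarrow> g p u u > 0)) \<and>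
     (\<forall>U X Y. vector_field A U X \<and> vector_field A U Y \<longrightarrow> smooth_fun A U (\<lambda>p. g p (X p) (Y p)))"

text \<open>A connection acts on the vector fields of every open subset \<open>U\<close> of the manifold,
  compatibly with restriction (the second conjunct). This is the usual operator on global
  vector fields together with its unique extension to local ones.\<close>

type_synonym 'm connection = "'m vfield \<Rightarrow> 'm vfield \<Rightarrow> 'm vfield"

definition affine_connection ::
    "('m::topological_space, 'd::finite) chart set \<Rightarrow> 'm connection \<Rightarrow> bool" where
  "affine_connection A nabla \<longleftrightarrow>
     (\<forall>U X Y. vector_field A U X \<and> vector_field A U Y \<longrightarrow> vector_field A U (nabla X Y)) \<and>
     (\<forall>U X X' Y Y'. vector_field A U X \<and> vector_field A U X' \<and>
        vector_field A U Y \<and> vector_field A U Y' \<and> (\<forall>p\<in>U. X p = X' p \<and> Y p = Y' p) \<longrightarrow>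
        (\<forall>p\<in>U. nabla X Y p = nabla X' Y' p)) \<and>
     (\<forall>U X Y Z f. vector_field A U X \<and> vector_field A U Y \<and> vector_field A U Z \<and>
        smooth_fun A U f \<longrightarrow>
        (\<forall>p\<in>U.
           nabla (vf_add X Y) Z p = tv_add (nabla X Z p) (nabla Y Z p) \<and>
           nabla (vf_scale f X) Z p = tv_scale (f p) (nabla X Z p) \<and>
           nabla X (vf_add Y Z) p = tv_add (nabla X Y p) (nabla X Z p) \<and>
           nabla X (vf_scale f Y) p = tv_add (tv_scale (X p f) (Y p)) (tv_scale (f p) (nabla X Y p))))"

definition torsion_free ::
    "('m::topological_space, 'd::finite) chart set \<Rightarrow> 'm connection \<Rightarrow> bool" where
  "torsion_free A nabla \<longleftrightarrow>
     (\<forall>U X Y. vector_field A U X \<and> vector_field A U Y \<longrightarrow>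
        (\<forall>p\<in>U. \<forall>f. nabla X Y p f - nabla Y X p f = lie_bracket A X Y p f))"

definition curvature ::
    "('m::topological_space, 'd::finite) chart set \<Rightarrow> 'm connection \<Rightarrow>
     'm vfield \<Rightarrow> 'm vfield \<Rightarrow> 'm vfield \<Rightarrow> 'm vfield" where
  "curvature A nabla X Y Z =
     (\<lambda>p f. nabla X (nabla Y Z) p f - nabla Y (nabla X Z) p f - nabla (lie_bracket A X Y) Z p f)"

definition flat ::
    "('m::topological_space, 'd::finite) chart set \<Rightarrow> 'm connection \<Rightarrow> bool" where
  "flat A nabla \<longleftrightarrow>
     (\<forall>U X Y Z. vector_field A U X \<and> vector_field A U Y \<and> vector_field A U Z \<longrightarrow>
        (\<forall>p\<in>U. curvature A nabla X Y Z p = (\<lambda>f. 0)))"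

definition constant_curvature ::
    "('m::topological_space, 'd::finite) chart set \<Rightarrow> 'm metric \<Rightarrow> 'm connection \<Rightarrow> real \<Rightarrow> bool" where
  "constant_curvature A g nabla k \<longleftrightarrow>
     (\<forall>U X Y Z. vector_field A U X \<and> vector_field A U Y \<and> vector_field A U Z \<longrightarrow>
        (\<forall>p\<in>U. \<forall>f. curvature A nabla X Y Z p f =
           k * (g p (Y p) (Z p) * X p f - g p (X p) (Z p) * Y p f)))"

definition projectively_flat ::
    "('m::topological_space, 'd::finite) chart set \<Rightarrow> 'm connection \<Rightarrow> bool" where
  "projectively_flat A nabla \<longleftrightarrow>
     (\<exists>nabla0 \<tau>. affine_connection A nabla0 \<and> torsion_free A nabla0 \<and> flat A nabla0 \<and>
        one_form A \<tau> \<and>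
        (\<forall>U X Y. vector_field A U X \<and> vector_field A U Y \<longrightarrow>
           (\<forall>p\<in>U. \<forall>f. nabla X Y p f =
              nabla0 X Y p f + \<tau> p (X p) * Y p f + \<tau> p (Y p) * X p f)))"

definition statistical_manifold ::
    "('m::{t2_space,second_countable_topology}, 'd::finite) chart set \<Rightarrow>
     'm metric \<Rightarrow> 'm connection \<Rightarrow> 'm connection \<Rightarrow> bool" where
  "statistical_manifold A g nabla nabla' \<longleftrightarrow>
     smooth_structure A \<and> riemannian_metric A g \<and>
     affine_connection A nabla \<and> torsion_free A nabla \<and>
     affine_connection A nabla' \<and> torsion_free A nabla' \<and>
     (\<forall>U X Y Z. vector_field A U X \<and> vector_field A U Y \<and> vector_field A U Z \<longrightarrow>
        (\<forall>p\<in>U. Z p (\<lambda>q. g q (X q) (Y q)) = g p (nabla Z X p) (Y p) + g p (X p) (nabla' Z Y p)))"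


section \<open>Geodesics\<close>

text \<open>\<open>christoffel A nabla c i j k p\<close> is \<open>\<Gamma>\<^sub>i\<^sub>j\<^sup>k(p)\<close> in the chart \<open>c\<close>, obtained by applying
  \<open>\<nabla>\<close> of \<open>\<partial>\<^sub>j\<close> along \<open>\<partial>\<^sub>i\<close> to the \<open>k\<close>-th coordinate function.\<close>

definition christoffel ::
    "('m::topological_space, 'd::finite) chart set \<Rightarrow> 'm connection \<Rightarrow> ('m, 'd) chart \<Rightarrow>
     'd \<Rightarrow> 'd \<Rightarrow> 'd \<Rightarrow> 'm \<Rightarrow> real" where
  "christoffel A nabla c i j k p = nabla (coord_field A c i) (coord_field A c j) p (\<lambda>q. snd c q $ k)"

definition geodesic ::
    "('m::topological_space, 'd::finite) chart set \<Rightarrow> 'm connection \<Rightarrow> real set \<Rightarrow> (real \<Rightarrow> 'm) \<Rightarrow> bool" where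
  "geodesic A nabla I \<gamma> \<longleftrightarrow>
     open I \<and> is_interval I \<and> continuous_on I \<gamma> \<and> \<gamma> ` I \<subseteq> mfd A \<and>
     (\<forall>c\<in>A. \<forall>t\<in>I. \<gamma> t \<in> fst c \<longrightarrow>
        (let x = (\<lambda>s. snd c (\<gamma> s)); v = (\<lambda>s. vector_derivative x (at s)) in
          x differentiable (at t) \<and>
          (v has_vector_derivative
            (\<chi> k. - (\<Sum>i\<in>UNIV. \<Sum>j\<in>UNIV. christoffel A nabla c i j k (\<gamma> t) * v t $ i * v t $ j)))
            (at t)))"

text \<open>The function \<open>\<sigma>\<close> is the time reparameterization. Its regularity and strict monotonicity
  need not be required: they hold automatically along a nonconstant geodesic, whose
  velocity never vanishes.\<close>

definition geodesics_straight ::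
    "('m::topological_space, 'd::finite) chart set \<Rightarrow> 'm connection \<Rightarrow> 'm set \<Rightarrow> ('m \<Rightarrow> real^'d) \<Rightarrow> bool" where
  "geodesics_straight A nabla U x \<longleftrightarrow>
     (\<forall>I \<gamma>. geodesic A nabla I \<gamma> \<and> \<gamma> ` I \<subseteq> U \<longrightarrow>
        (\<exists>a b \<sigma>. \<forall>t\<in>I. x (\<gamma> t) = a + \<sigma> t *\<^sub>R b))"


section \<open>Dual coordinate systems and potentials\<close>

text \<open>The domain of a local potential need not be convex, so concavity and convexity are
  required on every convex subset of it.\<close>

definition exp_concave_on :: "real \<Rightarrow> (real^'d::finite) set \<Rightarrow> (real^'d \<Rightarrow> real) \<Rightarrow> bool" where
  "exp_concave_on \<alpha> S f \<longleftrightarrow> (\<forall>C\<subseteq>S. convex C \<longrightarrow> concave_on C (\<lambda>x. exp (\<alpha> * f x)))"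

definition exp_convex_on :: "real \<Rightarrow> (real^'d::finite) set \<Rightarrow> (real^'d \<Rightarrow> real) \<Rightarrow> bool" where
  "exp_convex_on \<alpha> S f \<longleftrightarrow> (\<forall>C\<subseteq>S. convex C \<longrightarrow> convex_on C (\<lambda>x. exp (\<alpha> * f x)))"

definition adapted_coordinates ::
    "('m::topological_space, 'd::finite) chart set \<Rightarrow> 'm connection \<Rightarrow> 'm connection \<Rightarrow> real \<Rightarrow>
     'm set \<Rightarrow> ('m \<Rightarrow> real^'d) \<Rightarrow> ('m \<Rightarrow> real^'d) \<Rightarrow> (real^'d \<Rightarrow> real) \<Rightarrow> (real^'d \<Rightarrow> real) \<Rightarrow> bool" where
  "adapted_coordinates A nabla nabla' \<alpha> U \<xi> \<eta> \<phi> \<psi> \<longleftrightarrow>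
     (U, \<xi>) \<in> A \<and> (U, \<eta>) \<in> A \<and> smooth_on (\<xi> ` U) \<phi> \<and> smooth_on (\<eta> ` U) \<psi> \<and>
     geodesics_straight A nabla U \<xi> \<and> geodesics_straight A nabla' U \<eta> \<and>
     (\<forall>p\<in>U. 1 + \<alpha> * (\<xi> p \<bullet> \<eta> p) > 0) \<and>
     (\<forall>p\<in>U. \<phi> (\<xi> p) + \<psi> (\<eta> p) = 1 / \<alpha> * ln (1 + \<alpha> * (\<xi> p \<bullet> \<eta> p)))"

definition metric_from_potential_neg ::
    "('m::topological_space, 'd::finite) chart set \<Rightarrow> 'm metric \<Rightarrow> real \<Rightarrow>
     'm set \<Rightarrow> ('m \<Rightarrow> real^'d) \<Rightarrow> (real^'d \<Rightarrow> real) \<Rightarrow> bool" where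
  "metric_from_potential_neg A g \<alpha> U x f \<longleftrightarrow>
     (\<forall>p\<in>U. \<forall>i j. g p (coord_field A (U, x) i p) (coord_field A (U, x) j p) =
        - partial i (partial j f) (x p) - \<alpha> * partial i f (x p) * partial j f (x p))"

definition metric_from_potential_pos ::
    "('m::topological_space, 'd::finite) chart set \<Rightarrow> 'm metric \<Rightarrow> real \<Rightarrow>
     'm set \<Rightarrow> ('m \<Rightarrow> real^'d) \<Rightarrow> (real^'d \<Rightarrow> real) \<Rightarrow> bool" where
  "metric_from_potential_pos A g \<alpha> U x f \<longleftrightarrow>
     (\<forall>p\<in>U. \<forall>i j. g p (coord_field A (U, x) i p) (coord_field A (U, x) j p) =
        partial i (partial j f) (x p) + \<alpha> * partial i f (x p) * partial j f (x p))"

text \<open>The suffixes \<open>_neg\<close> and \<open>_pos\<close> refer to the sign of the sectional curvature.\<close>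

definition dual_system_neg ::
    "('m::topological_space, 'd::finite) chart set \<Rightarrow> 'm metric \<Rightarrow> 'm connection \<Rightarrow> 'm connection \<Rightarrow> real \<Rightarrow>
     'm set \<Rightarrow> ('m \<Rightarrow> real^'d) \<Rightarrow> ('m \<Rightarrow> real^'d) \<Rightarrow> (real^'d \<Rightarrow> real) \<Rightarrow> (real^'d \<Rightarrow> real) \<Rightarrow> bool" where
  "dual_system_neg A g nabla nabla' \<alpha> U \<xi> \<eta> \<phi> \<psi> \<longleftrightarrow>
     adapted_coordinates A nabla nabla' \<alpha> U \<xi> \<eta> \<phi> \<psi> \<and>
     exp_concave_on \<alpha> (\<xi> ` U) \<phi> \<and> exp_concave_on \<alpha> (\<eta> ` U) \<psi> \<and>
     metric_from_potential_neg A g \<alpha> U \<xi> \<phi> \<and> metric_from_potential_neg A g \<alpha> U \<eta> \<psi>"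

definition dual_system_pos ::
    "('m::topological_space, 'd::finite) chart set \<Rightarrow> 'm metric \<Rightarrow> 'm connection \<Rightarrow> 'm connection \<Rightarrow> real \<Rightarrow>
     'm set \<Rightarrow> ('m \<Rightarrow> real^'d) \<Rightarrow> ('m \<Rightarrow> real^'d) \<Rightarrow> (real^'d \<Rightarrow> real) \<Rightarrow> (real^'d \<Rightarrow> real) \<Rightarrow> bool" where
  "dual_system_pos A g nabla nabla' \<alpha> U \<xi> \<eta> \<phi> \<psi> \<longleftrightarrow>
     adapted_coordinates A nabla nabla' \<alpha> U \<xi> \<eta> \<phi> \<psi> \<and>
     exp_convex_on \<alpha> (\<xi> ` U) \<phi> \<and> exp_convex_on \<alpha> (\<eta> ` U) \<psi> \<and>
     metric_from_potential_pos A g \<alpha> U \<xi> \<phi> \<and> metric_from_potential_pos A g \<alpha> U \<eta> \<psi>"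


section \<open>Divergences\<close>

text \<open>\<open>D q p\<close> stands for \<open>D[q : p]\<close>. The two divergences below are meaningful only for
  \<open>1 + \<alpha> \<xi>\<^sub>q \<cdot> \<eta>\<^sub>p > 0\<close>, which holds for \<open>(q, p)\<close> near the diagonal.\<close>

definition L_div_plus ::
    "real \<Rightarrow> ('m \<Rightarrow> real^'d::finite) \<Rightarrow> ('m \<Rightarrow> real^'d) \<Rightarrow> (real^'d \<Rightarrow> real) \<Rightarrow> (real^'d \<Rightarrow> real) \<Rightarrow>
     'm \<Rightarrow> 'm \<Rightarrow> real" where
  "L_div_plus \<alpha> \<xi> \<eta> \<phi> \<psi> q p = 1 / \<alpha> * ln (1 + \<alpha> * (\<xi> q \<bullet> \<eta> p)) - \<phi> (\<xi> q) - \<psi> (\<eta> p)"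

definition L_div_minus ::
    "real \<Rightarrow> ('m \<Rightarrow> real^'d::finite) \<Rightarrow> ('m \<Rightarrow> real^'d) \<Rightarrow> (real^'d \<Rightarrow> real) \<Rightarrow> (real^'d \<Rightarrow> real) \<Rightarrow>
     'm \<Rightarrow> 'm \<Rightarrow> real" where
  "L_div_minus \<alpha> \<xi> \<eta> \<phi> \<psi> q p = \<phi> (\<xi> q) + \<psi> (\<eta> p) - 1 / \<alpha> * ln (1 + \<alpha> * (\<xi> q \<bullet> \<eta> p))"

text \<open>Nonnegativity near the diagonal, the defining inequality of a divergence. For the two
  functions above this is the generalized Fenchel inequality whose equality case is the
  Fenchel identity. It cannot be dropped: on the hyperbolic plane with \<open>\<alpha> = 1\<close>, Klein
  coordinates \<open>\<xi>\<close> in the unit disc and \<open>\<phi>(\<xi>) = ln (1 - |\<xi>|\<^sup>2) / 2\<close>, the choices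
  \<open>\<eta> = - (\<xi> + s J \<xi>)\<close> with \<open>J\<close> the rotation by a right angle and
  \<open>\<psi>(\<eta>) = ln (1 - |\<eta>|\<^sup>2 / (1 + s\<^sup>2)) / 2\<close> satisfy \<open>dual_system_neg\<close> for every real \<open>s\<close>,
  but the function \<open>L_div_plus\<close> depends on \<open>s\<close> and is a divergence only for \<open>s = 0\<close>.\<close>

definition nonneg_near_diagonal :: "'m::topological_space set \<Rightarrow> ('m \<Rightarrow> 'm \<Rightarrow> real) \<Rightarrow> bool" where
  "nonneg_near_diagonal U D \<longleftrightarrow> (\<forall>p\<in>U. \<forall>\<^sub>F q in nhds p. D q p \<ge> 0)"

text \<open>The smoothness clause ensures that the derivatives in the three identities exist.\<close>

definition induces ::
    "('m::topological_space, 'd::finite) chart set \<Rightarrow> 'm set \<Rightarrow> ('m \<Rightarrow> 'm \<Rightarrow> real) \<Rightarrow>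
     'm metric \<Rightarrow> 'm connection \<Rightarrow> 'm connection \<Rightarrow> bool" where
  "induces A U D g nabla nabla' \<longleftrightarrow>
     (\<forall>c\<in>A. \<forall>p\<in>U \<inter> fst c.
        (let E = (\<lambda>x x'. D (chart_inv c x) (chart_inv c x')); x0 = snd c p; e = coord_field A c in
          (\<exists>W. open W \<and> (x0, x0) \<in> W \<and> smooth_on W (\<lambda>(x, x'). E x x')) \<and>
          (\<forall>i j. g p (e i p) (e j p) =
             - partial i (\<lambda>x. partial j (\<lambda>x'. E x x') x0) x0) \<and>
          (\<forall>i j k. g p (nabla (e i) (e j) p) (e k p) =
             - partial i (\<lambda>x. partial j (\<lambda>x. partial k (\<lambda>x'. E x x') x0) x) x0) \<and>
          (\<forall>i j k. g p (nabla' (e i) (e j) p) (e k p) =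
             - partial i (\<lambda>x'. partial j (\<lambda>x'. partial k (\<lambda>x. E x x') x0) x') x0)))"

end

theory Submission
  imports Defs
begin

text \<open>Write \<open>L[q : p]\<close> for the function \<open>1/\<alpha> log (1 + \<alpha> \<xi>\<^sub>q \<sqdot> \<eta>\<^sub>p) - \<phi>(\<xi>\<^sub>q) - \<psi>(\<eta>\<^sub>p)\<close>, so that the divergence is \<open>L\<close> or
  \<open>- L\<close>. Nonnegativity and the Fenchel identity make \<open>L\<close> critical on the diagonal in both arguments.
  As the geodesics of \<open>\<nabla>\<close> are straight in \<open>\<xi>\<close>, its Christoffel symbols there are
  \<open>\<delta>\<^sub>i\<^sub>k \<tau>\<^sub>j + \<delta>\<^sub>j\<^sub>k \<tau>\<^sub>i\<close> for some \<open>\<tau>\<close>, and in dimension at least 2 the Codazzi equation of \<open>(g, \<nabla>)\<close> forces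
  \<open>\<tau> = - \<alpha> d\<phi>\<close>. With this value, the derivative of \<open>L[q : p]\<close> in \<open>p\<close> along any tangent vector is a function of \<open>q\<close>
  whose \<open>\<nabla>\<close>-Hessian vanishes at \<open>q = p\<close>, which says that \<open>L\<close> induces \<open>\<nabla>\<close>; exchanging the two coordinate systems gives \<open>\<nabla>*\<close>. Moreover \<open>f = exp (\<alpha> L[\<cdot> : p])\<close> solves
  \<open>Hess f = \<plusminus> \<alpha> f g\<close> with \<open>f(p) = 1\<close> and \<open>df(p) = 0\<close>. This initial value problem only involves \<open>g\<close> and \<open>\<nabla>\<close>
  and has at most one solution, so \<open>L\<close> does not depend on the choices.\<close>

section \<open>Calculus of smooth functions\<close>

text \<open>Both signs of the curvature are treated at once: \<open>\<epsilon>\<close> multiplies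
  both \<open>L\<close> and the expression of \<open>g\<close> in \<open>\<phi>\<close>, and only
  \<open>\<epsilon> * \<epsilon> = 1\<close> enters. Nonnegativity gives criticality in the first
  argument; the second follows by differentiating the Fenchel identity along the diagonal.
  Straightness speaks only about geodesics that exist, so every initial velocity must be realised by
  one. This calls for a Picard theorem and, as a geodesic has to satisfy its equation in every chart
  of the atlas, for the transformation law of Christoffel symbols, which comes from tensoriality of
  the Hessian of coordinate functions. Once \<open>\<tau>\<close> is known, multiplication by
  \<open>exp (\<alpha> \<phi>)\<close> turns the equation of the initial value problem into the
  vanishing of all second partials in \<open>\<xi>\<close>. Its solutions are locally affine
  functions of \<open>\<xi>\<close> times \<open>exp (- \<alpha> \<phi>)\<close>, which explains the
  affine expression inside the logarithm and reduces uniqueness to calculus on a ball. The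
  derivatives of \<open>L\<close> in \<open>p\<close> are quotients of affine functions over
  \<open>P = 1 + \<alpha> \<xi> \<bullet> \<eta>_p\<close>; their Hessian vanishes at
  \<open>p\<close> because \<open>d\<phi> = \<eta> / P\<close> there.\<close>

lemma frechet_derivative_worksI:
  "f differentiable (at x) \<Longrightarrow> (f has_derivative frechet_derivative f (at x)) (at x)"
  by (simp add: frechet_derivative_works)

lemma frechet_derivative_unique: "(f has_derivative D) (at x) \<Longrightarrow> frechet_derivative f (at x) = D"
  by (rule frechet_derivative_at[symmetric])

text \<open>\<open>frechet_derivative\<close> at a point of \<open>S\<close> sees a full
  neighbourhood, so agreement on \<open>S\<close> carries over to derivatives because
  \<open>S\<close> is open.\<close>

lemma Ck_on_cong:
  assumes "open S" "\<And>x. x \<in> S \<Longrightarrow> f x = g x" "Ck_on k S f"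
  shows "Ck_on k S g"
  using assms(2,3)
proof (induction k arbitrary: f g)
  case 0
  then show ?case by (simp cong: continuous_on_cong)
next
  case (Suc k)
  have D: "(g has_derivative frechet_derivative f (at x)) (at x)" if "x \<in> S" for x
    using Suc.prems that \<open>open S\<close>
    by (auto intro!: has_derivative_transform_within_open[of f _ _ UNIV S] frechet_derivative_worksI)
  have eq: "frechet_derivative f (at x) v = frechet_derivative g (at x) v" if "x \<in> S" for x v
    by (simp add: frechet_derivative_unique[OF D[OF that]])
  have "Ck_on k S (\<lambda>x. frechet_derivative g (at x) v)" for v
    using Suc.prems by (intro Suc.IH[OF eq]) auto
  then show ?case
    using differentiableI[OF D] by simp
qed

lemma Ck_on_subset: "Ck_on k S f \<Longrightarrow> T \<subseteq> S \<Longrightarrow> Ck_on k T f"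
  by (induction k arbitrary: f) (auto intro: continuous_on_subset)

lemma Ck_on_SucD: "Ck_on (Suc k) S f \<Longrightarrow> Ck_on k S f"
proof (induction k arbitrary: f)
  case 0
  then show ?case
    by (auto intro!: continuous_at_imp_continuous_on differentiable_imp_continuous_within)
qed auto

lemma Ck_on_const: "Ck_on k S (\<lambda>x. c)"
  by (induction k arbitrary: c) (auto simp: frechet_derivative_const)

lemma Ck_on_bounded_linear:
  assumes "bounded_linear L" shows "Ck_on k S L"
proof (cases k)
  case 0
  then show ?thesis using assms by (simp add: linear_continuous_on)
next
  case (Suc j)
  have "(L has_derivative L) (at x)" for x
    using assms by (rule bounded_linear_imp_has_derivative)
  then have "frechet_derivative L (at x) = L" "L differentiable (at x)" for x
    by (auto simp: differentiable_def frechet_derivative_unique)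
  then show ?thesis by (simp add: Suc Ck_on_const)
qed

lemma Ck_on_add:
  assumes "open S" "Ck_on k S f" "Ck_on k S g"
  shows "Ck_on k S (\<lambda>x. f x + g x)"
  using assms(2,3)
proof (induction k arbitrary: f g)
  case 0
  then show ?case by (simp add: continuous_on_add)
next
  case (Suc k)
  have eq: "frechet_derivative (\<lambda>x. f x + g x) (at x) v =
      frechet_derivative f (at x) v + frechet_derivative g (at x) v" if "x \<in> S" for x v
    using Suc.prems that
    by (subst frechet_derivative_unique[OF has_derivative_add]) (auto intro: frechet_derivative_worksI)
  have ck: "Ck_on k S (\<lambda>x. frechet_derivative f (at x) v + frechet_derivative g (at x) v)" for v
    using Suc.prems by (intro Suc.IH) auto
  have "Ck_on k S (\<lambda>x. frechet_derivative (\<lambda>x. f x + g x) (at x) v)" for v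
    using eq[of _ v] by (intro Ck_on_cong[OF \<open>open S\<close> _ ck[of v]]) simp
  then show ?case using Suc.prems by auto
qed

lemma Ck_on_sum:
  assumes "open S" "\<And>i. i \<in> I \<Longrightarrow> Ck_on k S (f i)"
  shows "Ck_on k S (\<lambda>x. \<Sum>i\<in>I. f i x)"
  using assms(2)
proof (induction I rule: infinite_finite_induct)
  case (insert i I)
  then show ?case using Ck_on_add[OF assms(1), of k "f i" "\<lambda>x. \<Sum>i\<in>I. f i x"] by simp
qed (simp_all add: Ck_on_const)

text \<open>The Leibniz rule keeps sums of bilinear products closed under directional derivatives.
  The locale covers multiplication, inner products and scaling together.\<close>

lemma (in bounded_bilinear) Ck_on:
  assumes "open S" "Ck_on k S f" "Ck_on k S g"
  shows "Ck_on k S (\<lambda>x. prod (f x) (g x))"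
  using assms(2,3)
proof (induction k arbitrary: f g)
  case 0
  then show ?case by (simp add: continuous_on)
next
  case (Suc k)
  have fg: "Ck_on k S f" "Ck_on k S g" using Suc.prems Ck_on_SucD by blast+
  have D: "((\<lambda>x. prod (f x) (g x)) has_derivative (\<lambda>v. prod (f x) (frechet_derivative g (at x) v)
      + prod (frechet_derivative f (at x) v) (g x))) (at x)" if "x \<in> S" for x
    using Suc.prems that by (intro FDERIV frechet_derivative_worksI) auto
  then have eq: "frechet_derivative (\<lambda>x. prod (f x) (g x)) (at x) v = prod (f x) (frechet_derivative g (at x) v)
      + prod (frechet_derivative f (at x) v) (g x)" if "x \<in> S" for x v
    by (simp add: frechet_derivative_unique[OF D[OF that]])
  have ck: "Ck_on k S (\<lambda>x. prod (f x) (frechet_derivative g (at x) v)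
      + prod (frechet_derivative f (at x) v) (g x))" for v
    by (rule Ck_on_add[OF \<open>open S\<close> Suc.IH Suc.IH]) (use Suc.prems fg in simp_all)
  have "Ck_on k S (\<lambda>x. frechet_derivative (\<lambda>x. prod (f x) (g x)) (at x) v)" for v
    using ck[of v] eq[of _ v] by (intro Ck_on_cong[OF \<open>open S\<close> _ ck[of v]]) simp
  then show ?case unfolding Ck_on.simps by (intro conjI ballI allI differentiableI[OF D])
qed

text \<open>\<open>Ck_on\<close> speaks of derivatives in fixed directions, whereas the chain rule
  differentiates \<open>h\<close> in the moving direction \<open>Df(x) v\<close>. Expanding that
  direction in \<open>Basis\<close> leaves a finite sum of products, to which the induction
  hypothesis applies.\<close>

lemma Ck_on_compose:
  fixes f :: "'a::euclidean_space \<Rightarrow> 'b::euclidean_space" and h :: "'b \<Rightarrow> 'c::real_normed_vector"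
  assumes "open S" "Ck_on k S f" "Ck_on k T h" "f ` S \<subseteq> T"
  shows "Ck_on k S (\<lambda>x. h (f x))"
  using assms(2,3)
proof (induction k arbitrary: h)
  case 0
  then show ?case using assms(4) by (auto intro: continuous_on_compose2)
next
  case (Suc k)
  have f: "Ck_on k S f" using Suc.prems Ck_on_SucD by blast
  have D: "((\<lambda>x. h (f x)) has_derivative (\<lambda>v. frechet_derivative h (at (f x)) (frechet_derivative f (at x) v)))
      (at x)" if "x \<in> S" for x
    using Suc.prems that assms(4)
    by (intro has_derivative_compose[OF frechet_derivative_worksI frechet_derivative_worksI]) auto
  have eq: "frechet_derivative (\<lambda>x. h (f x)) (at x) v =
      (\<Sum>b\<in>Basis. (frechet_derivative f (at x) v \<bullet> b) *\<^sub>R frechet_derivative h (at (f x)) b)"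
    if "x \<in> S" for x v
  proof -
    have lin: "linear (frechet_derivative h (at (f x)))"
      using Suc.prems that assms(4) by (intro linear_frechet_derivative) auto
    have "frechet_derivative h (at (f x)) (frechet_derivative f (at x) v) =
      frechet_derivative h (at (f x)) (\<Sum>b\<in>Basis. (frechet_derivative f (at x) v \<bullet> b) *\<^sub>R b)"
      by (simp add: euclidean_representation)
    also have "\<dots> = (\<Sum>b\<in>Basis. (frechet_derivative f (at x) v \<bullet> b) *\<^sub>R frechet_derivative h (at (f x)) b)"
      by (simp add: linear_sum[OF lin] linear_cmul[OF lin])
    finally show ?thesis by (simp add: frechet_derivative_unique[OF D[OF that]])
  qed
  have ck: "Ck_on k S (\<lambda>x. \<Sum>b\<in>Basis. (frechet_derivative f (at x) v \<bullet> b) *\<^sub>R frechet_derivative h (at (f x)) b)" for v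
  proof (rule Ck_on_sum[OF \<open>open S\<close>])
    fix b :: 'b
    have 1: "Ck_on k S (\<lambda>x. frechet_derivative f (at x) v \<bullet> b)"
      by (rule bounded_bilinear.Ck_on[OF bounded_bilinear_inner \<open>open S\<close> _ Ck_on_const])
        (use assms(2) Suc.prems in simp)
    have 2: "Ck_on k S (\<lambda>x. frechet_derivative h (at (f x)) b)"
      by (rule Suc.IH[of "\<lambda>y. frechet_derivative h (at y) b", OF f]) (use Suc.prems in simp)
    show "Ck_on k S (\<lambda>x. (frechet_derivative f (at x) v \<bullet> b) *\<^sub>R frechet_derivative h (at (f x)) b)"
      by (rule bounded_bilinear.Ck_on[OF bounded_bilinear_scaleR \<open>open S\<close> 1 2])
  qed
  have "Ck_on k S (\<lambda>x. frechet_derivative (\<lambda>x. h (f x)) (at x) v)" for v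
    using ck[of v] eq[of _ v] by (intro Ck_on_cong[OF \<open>open S\<close> _ ck[of v]]) simp
  then show ?case unfolding Ck_on.simps by (intro conjI ballI allI differentiableI[OF D])
qed

lemma frechet_derivative_real:
  "(f has_real_derivative d) (at x) \<Longrightarrow> frechet_derivative f (at x) v = v * d"
  by (simp add: has_field_derivative_def frechet_derivative_unique mult.commute)

lemma real_differentiableI: "(f has_real_derivative d) (at x) \<Longrightarrow> f differentiable (at x)"
  using has_field_derivative_def differentiableI by metis

lemma Ck_on_exp: "Ck_on k UNIV (exp :: real \<Rightarrow> real)"
proof (induction k)
  case (Suc k)
  then show ?case
    using bounded_bilinear.Ck_on[OF bounded_bilinear_mult open_UNIV Ck_on_const Suc]
    by (auto simp: frechet_derivative_real[OF DERIV_exp] intro: real_differentiableI DERIV_exp)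
qed (simp add: continuous_on_exp)

text \<open>The derivative is a polynomial in \<open>inverse\<close> itself, so the induction
  closes; \<open>ln\<close> then needs no induction of its own.\<close>

lemma Ck_on_inverse: "Ck_on k {0<..} (inverse :: real \<Rightarrow> real)"
proof (induction k)
  case (Suc k)
  have d: "(inverse has_real_derivative (- (inverse x * inverse x))) (at x)" if "x > 0" for x :: real
    using that by (auto intro!: derivative_eq_intros simp: power2_eq_square)
  have "Ck_on k {0<..} (\<lambda>x::real. (v * - 1) * (inverse x * inverse x))" for v
    by (intro bounded_bilinear.Ck_on[OF bounded_bilinear_mult] Ck_on_const Suc) auto
  then have "Ck_on k {0<..} (\<lambda>x::real. frechet_derivative inverse (at x) v)" for v
    by (rule Ck_on_cong[rotated 2]) (auto simp: frechet_derivative_real[OF d])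
  then show ?case using d by (auto intro: real_differentiableI)
qed (auto intro!: continuous_intros)

lemma Ck_on_ln: "Ck_on k {0<..} (ln :: real \<Rightarrow> real)"
proof (cases k)
  case (Suc j)
  have d: "(ln has_real_derivative inverse x) (at x)" if "x > 0" for x :: real
    using that by (auto intro!: derivative_eq_intros simp: divide_inverse)
  have "Ck_on j {0<..} (\<lambda>x::real. v * inverse x)" for v
    by (intro bounded_bilinear.Ck_on[OF bounded_bilinear_mult] Ck_on_const Ck_on_inverse) auto
  then have "Ck_on j {0<..} (\<lambda>x::real. frechet_derivative ln (at x) v)" for v
    by (rule Ck_on_cong[rotated 2]) (auto simp: frechet_derivative_real[OF d])
  then show ?thesis using d by (auto simp: Suc intro: real_differentiableI)
qed (auto intro!: continuous_intros)

section \<open>Smooth functions and their partial derivatives\<close>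

lemma smooth_on_cong:
  "open S \<Longrightarrow> (\<And>x. x \<in> S \<Longrightarrow> f x = g x) \<Longrightarrow> smooth_on S f \<Longrightarrow> smooth_on S g"
  by (auto simp: smooth_on_def intro: Ck_on_cong)

lemma smooth_on_subset: "smooth_on S f \<Longrightarrow> T \<subseteq> S \<Longrightarrow> smooth_on T f"
  by (auto simp: smooth_on_def intro: Ck_on_subset)

lemma smooth_on_const: "smooth_on S (\<lambda>x. c)"
  by (simp add: smooth_on_def Ck_on_const)

lemma smooth_on_bounded_linear: "bounded_linear L \<Longrightarrow> smooth_on S L"
  by (simp add: smooth_on_def Ck_on_bounded_linear)

lemma smooth_on_add:
  "open S \<Longrightarrow> smooth_on S f \<Longrightarrow> smooth_on S g \<Longrightarrow> smooth_on S (\<lambda>x. f x + g x)"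
  by (auto simp: smooth_on_def intro: Ck_on_add)

lemma smooth_on_sum:
  "open S \<Longrightarrow> (\<And>i. i \<in> I \<Longrightarrow> smooth_on S (f i)) \<Longrightarrow> smooth_on S (\<lambda>x. \<Sum>i\<in>I. f i x)"
  by (auto simp: smooth_on_def intro: Ck_on_sum)

lemma (in bounded_bilinear) smooth_on:
  "open S \<Longrightarrow> smooth_on S f \<Longrightarrow> smooth_on S g \<Longrightarrow> smooth_on S (\<lambda>x. prod (f x) (g x))"
  by (auto simp: smooth_on_def intro: Ck_on)

lemmas smooth_on_mult = bounded_bilinear.smooth_on[OF bounded_bilinear_mult]
lemmas smooth_on_inner = bounded_bilinear.smooth_on[OF bounded_bilinear_inner]

lemma smooth_on_compose:
  fixes f :: "'a::euclidean_space \<Rightarrow> 'b::euclidean_space" and h :: "'b \<Rightarrow> 'c::real_normed_vector"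
  shows "open S \<Longrightarrow> smooth_on S f \<Longrightarrow> smooth_on T h \<Longrightarrow> f ` S \<subseteq> T \<Longrightarrow> smooth_on S (\<lambda>x. h (f x))"
  unfolding smooth_on_def by (metis Ck_on_compose[of S _ f T h])

lemma smooth_on_diff:
  fixes f g :: "'a::euclidean_space \<Rightarrow> real"
  assumes "open S" "smooth_on S f" "smooth_on S g" shows "smooth_on S (\<lambda>x. f x - g x)"
  using smooth_on_add[OF assms(1,2) smooth_on_mult[OF assms(1) smooth_on_const[of S "-1"] assms(3)]]
  by simp

lemma smooth_on_component:
  fixes f :: "'a::euclidean_space \<Rightarrow> real^'d"
  shows "open S \<Longrightarrow> smooth_on S f \<Longrightarrow> smooth_on S (\<lambda>x. f x $ i)"
  using smooth_on_compose[of S f UNIV "\<lambda>y. y $ i"] smooth_on_bounded_linear[OF bounded_linear_vec_nth]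
  by auto

lemma smooth_on_exp:
  "open S \<Longrightarrow> smooth_on S f \<Longrightarrow> smooth_on S (\<lambda>x. exp (f x :: real))"
  using smooth_on_compose[of S f UNIV exp] by (auto simp: smooth_on_def Ck_on_exp)

lemma smooth_on_ln:
  "open S \<Longrightarrow> smooth_on S f \<Longrightarrow> (\<And>x. x \<in> S \<Longrightarrow> f x > 0) \<Longrightarrow> smooth_on S (\<lambda>x. ln (f x :: real))"
  using smooth_on_compose[of S f "{0<..}" ln] by (auto simp: smooth_on_def Ck_on_ln)

lemma smooth_on_divide:
  fixes f g :: "'a::euclidean_space \<Rightarrow> real"
  assumes "open S" "smooth_on S f" "smooth_on S g" "\<And>x. x \<in> S \<Longrightarrow> g x > 0"
  shows "smooth_on S (\<lambda>x. f x / g x)"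
proof -
  have "smooth_on S (\<lambda>x. inverse (g x))"
    using assms smooth_on_compose[of S g "{0<..}" inverse] by (auto simp: smooth_on_def Ck_on_inverse)
  then show ?thesis unfolding divide_inverse by (intro smooth_on_mult assms)
qed

lemma smooth_on_frechet: "smooth_on S f \<Longrightarrow> smooth_on S (\<lambda>x. frechet_derivative f (at x) v)"
  unfolding smooth_on_def by (metis Ck_on.simps(2))

lemma smooth_on_partial: "smooth_on S f \<Longrightarrow> smooth_on S (partial i f)"
  using smooth_on_frechet[of S f "axis i 1"] by (simp add: partial_def[abs_def])

lemma smooth_on_differentiable: "smooth_on S f \<Longrightarrow> x \<in> S \<Longrightarrow> f differentiable (at x)"
  unfolding smooth_on_def by (metis Ck_on.simps(2))

lemma smooth_on_has_derivative:
  "smooth_on S f \<Longrightarrow> x \<in> S \<Longrightarrow> (f has_derivative frechet_derivative f (at x)) (at x)"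
  by (simp add: frechet_derivative_worksI smooth_on_differentiable)

lemma smooth_on_continuous: "smooth_on S f \<Longrightarrow> continuous_on S f"
  unfolding smooth_on_def by (metis Ck_on.simps(1))

lemma partialI: "(f has_derivative D) (at x) \<Longrightarrow> partial i f x = D (axis i 1)"
  by (simp add: partial_def frechet_derivative_unique)

text \<open>Differentiability is not assumed: functions that agree near \<open>x\<close> have the
  same candidate derivatives, so the choice inside \<open>frechet_derivative\<close> returns the
  same value. Tangent vectors therefore depend on germs only.\<close>

lemma frechet_derivative_cong:
  assumes "open S" "x \<in> S" "\<And>y. y \<in> S \<Longrightarrow> f y = g y"
  shows "frechet_derivative f (at x) = frechet_derivative g (at x)"
proof -
  have "(f has_derivative D) (at x) \<longleftrightarrow> (g has_derivative D) (at x)" for D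
    using assms has_derivative_transform_within_open[of f D x UNIV S g]
      has_derivative_transform_within_open[of g D x UNIV S f] by auto
  then show ?thesis unfolding frechet_derivative_def by simp
qed

lemma partial_cong:
  "open S \<Longrightarrow> x \<in> S \<Longrightarrow> (\<And>y. y \<in> S \<Longrightarrow> f y = g y) \<Longrightarrow> partial i f x = partial i g x"
  unfolding partial_def by (metis frechet_derivative_cong)

lemma linear_axis_sum:
  fixes a :: "real^'d" and L :: "real^'d \<Rightarrow> 'b::real_vector"
  assumes "linear L" shows "L a = (\<Sum>i\<in>UNIV. a $ i *\<^sub>R L (axis i 1))"
proof -
  have "L a = L (\<Sum>i\<in>UNIV. a $ i *\<^sub>R axis i 1)"
    using basis_expansion[of a] by (simp add: scalar_mult_eq_scaleR)
  then show ?thesis by (simp add: linear_sum[OF assms] linear_cmul[OF assms])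
qed

lemma frechet_derivative_partial:
  fixes f :: "real^'d \<Rightarrow> real"
  assumes "f differentiable (at x)"
  shows "frechet_derivative f (at x) v = (\<Sum>i\<in>UNIV. v $ i * partial i f x)"
  using linear_axis_sum[OF linear_frechet_derivative[OF assms], of v] by (simp add: partial_def)

text \<open>Two applications of the mean value theorem: along \<open>u\<close> to \<open>h\<close>,
  the difference of \<open>f\<close> between two parallel edges, and then along \<open>v\<close>.
  The left side is symmetric in \<open>u\<close> and \<open>v\<close>, while the right side is a
  mixed derivative at some point of the parallelogram.\<close>

lemma second_difference_mvt:
  fixes f :: "'a::euclidean_space \<Rightarrow> real"
  assumes S: "smooth_on S f" and s: "s > 0"
    and sub: "\<And>a b. 0 \<le> a \<Longrightarrow> a \<le> s \<Longrightarrow> 0 \<le> b \<Longrightarrow> b \<le> s \<Longrightarrow> x + a *\<^sub>R u + b *\<^sub>R v \<in> S"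
  shows "\<exists>a b. 0 \<le> a \<and> a \<le> s \<and> 0 \<le> b \<and> b \<le> s \<and>
    f (x + s *\<^sub>R u + s *\<^sub>R v) - f (x + s *\<^sub>R u) - f (x + s *\<^sub>R v) + f x =
    s * s * frechet_derivative (\<lambda>y. frechet_derivative f (at y) u) (at (x + a *\<^sub>R u + b *\<^sub>R v)) v"
proof -
  let ?D = "\<lambda>y. frechet_derivative f (at y)"
  define h where "h a = f (x + a *\<^sub>R u + s *\<^sub>R v) - f (x + a *\<^sub>R u)" for a
  have lin: "linear (?D y)" if "y \<in> S" for y
    using S that by (intro linear_frechet_derivative smooth_on_differentiable)
  have mem: "x + a *\<^sub>R u \<in> S" if "0 \<le> a" "a \<le> s" for a
    using sub[OF that, of 0] s by simp
  have dh: "(h has_real_derivative (?D (x + a *\<^sub>R u + s *\<^sub>R v) u - ?D (x + a *\<^sub>R u) u)) (at a)"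
    if a: "0 \<le> a" "a \<le> s" for a
  proof -
    have 1: "((\<lambda>a. f (x + a *\<^sub>R u + s *\<^sub>R v)) has_derivative (\<lambda>t. ?D (x + a *\<^sub>R u + s *\<^sub>R v) (t *\<^sub>R u))) (at a)"
      using a s by (intro has_derivative_compose[OF _ smooth_on_has_derivative[OF S]] sub)
        (auto intro!: derivative_eq_intros)
    have 2: "((\<lambda>a. f (x + a *\<^sub>R u)) has_derivative (\<lambda>t. ?D (x + a *\<^sub>R u) (t *\<^sub>R u))) (at a)"
      using a s by (intro has_derivative_compose[OF _ smooth_on_has_derivative[OF S]] mem)
        (auto intro!: derivative_eq_intros)
    show ?thesis
      unfolding h_def[abs_def] has_field_derivative_def
      by (rule has_derivative_eq_rhs[OF has_derivative_diff[OF 1 2]])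
        (use linear_cmul[OF lin[OF sub[OF a _ order_refl]], of _ u] linear_cmul[OF lin[OF mem[OF a]], of _ u] s
          in \<open>auto simp: fun_eq_iff algebra_simps\<close>)
  qed
  obtain a where a: "0 < a" "a < s" "h s - h 0 = s * (?D (x + a *\<^sub>R u + s *\<^sub>R v) u - ?D (x + a *\<^sub>R u) u)"
    using MVT2[OF s dh] by auto
  have S': "smooth_on S (\<lambda>y. ?D y u)" by (rule smooth_on_frechet[OF S])
  let ?E = "\<lambda>y. frechet_derivative (\<lambda>y. ?D y u) (at y)"
  have dk: "((\<lambda>b. ?D (x + a *\<^sub>R u + b *\<^sub>R v) u) has_real_derivative (?E (x + a *\<^sub>R u + b *\<^sub>R v) v)) (at b)"
    if b: "0 \<le> b" "b \<le> s" for b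
  proof -
    have m: "x + a *\<^sub>R u + b *\<^sub>R v \<in> S" using a b by (intro sub) auto
    have "((\<lambda>b. ?D (x + a *\<^sub>R u + b *\<^sub>R v) u) has_derivative (\<lambda>t. ?E (x + a *\<^sub>R u + b *\<^sub>R v) (t *\<^sub>R v))) (at b)"
      by (rule has_derivative_compose[of "\<lambda>b. x + a *\<^sub>R u + b *\<^sub>R v" "\<lambda>t. t *\<^sub>R v" b UNIV
            "\<lambda>y. ?D y u", OF _ smooth_on_has_derivative[OF S' m]])
        (auto intro!: derivative_eq_intros)
    moreover have "linear (?E (x + a *\<^sub>R u + b *\<^sub>R v))"
      using S' m by (intro linear_frechet_derivative smooth_on_differentiable)
    ultimately show ?thesis
      unfolding has_field_derivative_def by (simp add: linear_cmul mult_commute_abs)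
  qed
  obtain b where b: "0 < b" "b < s"
    "?D (x + a *\<^sub>R u + s *\<^sub>R v) u - ?D (x + a *\<^sub>R u + 0 *\<^sub>R v) u = s * ?E (x + a *\<^sub>R u + b *\<^sub>R v) v"
    using MVT2[OF s dk] by auto
  show ?thesis
    using a b by (intro exI[of _ a] exI[of _ b]) (auto simp: h_def algebra_simps)
qed

text \<open>Expanding the same second difference in either order gives equal mixed derivatives at
  two points close to \<open>x\<close>. Continuity brings each within \<open>e\<close> of its value
  at \<open>x\<close>, which excludes a gap of \<open>2 * e\<close> between these values.\<close>

lemma frechet_derivative_symmetric:
  fixes f :: "'a::euclidean_space \<Rightarrow> real"
  assumes "open S" "smooth_on S f" "x \<in> S"
  shows "frechet_derivative (\<lambda>y. frechet_derivative f (at y) u) (at x) v =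
    frechet_derivative (\<lambda>y. frechet_derivative f (at y) v) (at x) u"
proof (rule ccontr)
  define P where "P u v y = frechet_derivative (\<lambda>y. frechet_derivative f (at y) u) (at y) v" for u v y
  assume "\<not> ?thesis"
  then have "P u v x \<noteq> P v u x" by (simp add: P_def)
  define e where "e = \<bar>P u v x - P v u x\<bar> / 2"
  have e: "e > 0" using \<open>P u v x \<noteq> P v u x\<close> by (simp add: e_def)
  have cont: "isCont (P u v) x" for u v
    using smooth_on_continuous[OF smooth_on_frechet[OF smooth_on_frechet[OF assms(2)]]] assms
    unfolding P_def[abs_def] by (simp add: continuous_on_eq_continuous_at)
  obtain d1 where d1: "d1 > 0" "\<And>y. dist y x < d1 \<Longrightarrow> dist (P u v y) (P u v x) < e"
    using cont[of u v] e unfolding continuous_at_eps_delta by blast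
  obtain d2 where d2: "d2 > 0" "\<And>y. dist y x < d2 \<Longrightarrow> dist (P v u y) (P v u x) < e"
    using cont[of v u] e unfolding continuous_at_eps_delta by blast
  obtain r where r: "r > 0" "ball x r \<subseteq> S" using assms open_contains_ball by blast
  define m where "m = min r (min d1 d2)"
  have m: "m > 0" "m \<le> r" "m \<le> d1" "m \<le> d2" using r d1 d2 by (auto simp: m_def)
  \<comment> \<open>This size puts the parallelogram with sides \<open>s u\<close> and
    \<open>s v\<close> into the ball of radius \<open>m\<close>, where \<open>f\<close> is smooth
    and both continuity estimates hold.\<close>
  define s where "s = m / (norm u + norm v + 1)"
  have s: "s > 0" using m by (auto simp: s_def intro!: divide_pos_pos add_nonneg_pos)
  have nn: "0 < norm u + norm v + 1" by (intro add_nonneg_pos) auto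
  have near: "dist (x + a *\<^sub>R u + b *\<^sub>R v) x < m" if "0 \<le> a" "a \<le> s" "0 \<le> b" "b \<le> s" for a b
  proof -
    have "dist (x + a *\<^sub>R u + b *\<^sub>R v) x = norm (a *\<^sub>R u + b *\<^sub>R v)" by (simp add: dist_norm add.assoc)
    also have "\<dots> \<le> a * norm u + b * norm v"
      using that by (intro norm_triangle_le) auto
    also have "\<dots> \<le> s * norm u + s * norm v"
      using that by (intro add_mono mult_right_mono) auto
    also have "\<dots> < s * (norm u + norm v + 1)" using s by (simp add: algebra_simps)
    also have "\<dots> = m" using nn by (simp add: s_def)
    finally show ?thesis .
  qed
  have near': "dist (x + a *\<^sub>R v + b *\<^sub>R u) x < m" if "0 \<le> a" "a \<le> s" "0 \<le> b" "b \<le> s" for a b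
    using near[OF that(3,4,1,2)] by (simp add: algebra_simps)
  obtain a b where 1: "0 \<le> a" "a \<le> s" "0 \<le> b" "b \<le> s"
    "f (x + s *\<^sub>R u + s *\<^sub>R v) - f (x + s *\<^sub>R u) - f (x + s *\<^sub>R v) + f x =
      s * s * P u v (x + a *\<^sub>R u + b *\<^sub>R v)"
    using second_difference_mvt[OF assms(2) s, of x u v] near m r unfolding P_def
    by (smt (verit, best) dist_commute mem_ball subsetD)
  obtain a' b' where 2: "0 \<le> a'" "a' \<le> s" "0 \<le> b'" "b' \<le> s"
    "f (x + s *\<^sub>R v + s *\<^sub>R u) - f (x + s *\<^sub>R v) - f (x + s *\<^sub>R u) + f x =
      s * s * P v u (x + a' *\<^sub>R v + b' *\<^sub>R u)"
    using second_difference_mvt[OF assms(2) s, of x v u] near' m r unfolding P_def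
    by (smt (verit, best) dist_commute mem_ball subsetD)
  have "s * s * P u v (x + a *\<^sub>R u + b *\<^sub>R v) = s * s * P v u (x + a' *\<^sub>R v + b' *\<^sub>R u)"
    using 1(5) 2(5) by (simp add: algebra_simps)
  then have "P u v (x + a *\<^sub>R u + b *\<^sub>R v) = P v u (x + a' *\<^sub>R v + b' *\<^sub>R u)"
    using s by simp
  moreover have "\<bar>P u v (x + a *\<^sub>R u + b *\<^sub>R v) - P u v x\<bar> < e"
    using d1(2) near[OF 1(1-4)] m by (simp add: dist_real_def)
  moreover have "\<bar>P v u (x + a' *\<^sub>R v + b' *\<^sub>R u) - P v u x\<bar> < e"
    using d2(2) near'[OF 2(1-4)] m by (simp add: dist_real_def)
  ultimately show False unfolding e_def by (smt (verit) field_sum_of_halves)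
qed

lemma partial_symmetric:
  assumes "open S" "smooth_on S f" "x \<in> S"
  shows "partial i (partial j f) x = partial j (partial i f) x"
  using frechet_derivative_symmetric[OF assms] by (simp add: partial_def[abs_def])

lemma smooth_on_vecI:
  fixes f :: "'a::euclidean_space \<Rightarrow> real^'d"
  assumes "open S" "\<And>k. smooth_on S (\<lambda>x. f x $ k)" shows "smooth_on S f"
proof -
  have "smooth_on S (\<lambda>x. \<Sum>k\<in>UNIV. f x $ k *\<^sub>R (axis k 1 :: real^'d))"
    by (intro smooth_on_sum bounded_bilinear.smooth_on[OF bounded_bilinear_scaleR] smooth_on_const assms)
  then show ?thesis by (simp add: scalar_mult_eq_scaleR[symmetric] basis_expansion)
qed

lemma frechet_derivative_component:
  "f differentiable (at x) \<Longrightarrow> frechet_derivative f (at x) v $ k = frechet_derivative (\<lambda>x. f x $ k) (at x) v"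
  by (simp add: frechet_derivative_unique[OF
      bounded_linear.has_derivative[OF bounded_linear_vec_nth frechet_derivative_worksI]])

lemma has_vector_derivative_compose_frechet:
  assumes "(x has_vector_derivative v) (at t)" "(T has_derivative D) (at (x t))"
  shows "((\<lambda>s. T (x s)) has_vector_derivative D v) (at t)"
  using has_derivative_compose[OF assms(1)[unfolded has_vector_derivative_def] assms(2)]
    linear_cmul[OF has_derivative_linear[OF assms(2)]]
  by (simp add: has_vector_derivative_def)

lemma zero_if_partials_zero:
  fixes w :: "real^'d \<Rightarrow> real"
  assumes B: "open B" "convex B" and w: "smooth_on B w" and z: "z \<in> B" "w z = 0"
    and "\<And>i x. x \<in> B \<Longrightarrow> partial i w x = 0" and x: "x \<in> B"
  shows "w x = 0"
proof -
  have "(w has_derivative (\<lambda>v. 0)) (at y within B)" if "y \<in> B" for y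
  proof -
    have "frechet_derivative w (at y) = (\<lambda>v. 0)"
      using assms that by (auto simp: frechet_derivative_partial[OF smooth_on_differentiable[OF w that]])
    then show ?thesis
      using smooth_on_has_derivative[OF w that] by (simp add: has_derivative_at_withinI)
  qed
  then show ?thesis
    using has_derivative_zero_unique[OF B(2), of w] assms by metis
qed

text \<open>The preceding principle is applied first to the partial derivatives of \<open>w\<close>
  and then to \<open>w\<close>. This is the uniqueness statement to which the Hessian equation will
  be reduced.\<close>

lemma zero_if_hessian_zero:
  fixes w :: "real^'d \<Rightarrow> real"
  assumes B: "open B" "convex B" and w: "smooth_on B w" and z: "z \<in> B" "w z = 0"
    "\<And>i. partial i w z = 0"
    and "\<And>i j x. x \<in> B \<Longrightarrow> partial i (partial j w) x = 0" and x: "x \<in> B"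
  shows "w x = 0"
proof -
  have "partial j w y = 0" if "y \<in> B" for j y
    using zero_if_partials_zero[OF B smooth_on_partial[OF w] z(1) z(3)] assms that by metis
  then show ?thesis using zero_if_partials_zero[OF B w z(1,2)] x by metis
qed

section \<open>Local solutions of ordinary differential equations\<close>

text \<open>The difference of the two integrals is the integral from 0 to \<open>t\<close> with the
  correct sign also for negative \<open>t\<close>, so one expression serves both directions of
  time.\<close>

lemma integral_from_zero_bound:
  fixes F :: "real \<Rightarrow> 'a::euclidean_space"
  assumes F: "continuous_on {-h..h} F" and B: "\<And>s. s \<in> {-h..h} \<Longrightarrow> norm (F s) \<le> B"
    and t: "-h \<le> t" "t \<le> h"
  shows "norm (integral {-h..t} F - integral {-h..0} F) \<le> B * h"
proof -
  have B0: "B \<ge> 0" using order_trans[OF norm_ge_zero B[of t]] t by simp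
  have int: "F integrable_on {-h..s}" if "s \<le> h" for s
    using that by (intro integrable_continuous_real continuous_on_subset[OF F]) auto
  show ?thesis
  proof (cases "t \<ge> 0")
    case True
    have "integral {-h..0} F + integral {0..t} F = integral {-h..t} F"
      using True t by (intro Henstock_Kurzweil_Integration.integral_combine int) auto
    then have "norm (integral {-h..t} F - integral {-h..0} F) = norm (integral {0..t} F)"
      by (metis add_diff_cancel_left')
    also have "\<dots> \<le> B * (t - 0)"
      using True t B by (intro integral_bound continuous_on_subset[OF F]) auto
    also have "\<dots> \<le> B * h" using t B0 by (intro mult_left_mono) auto
    finally show ?thesis .
  next
    case False
    have "integral {-h..t} F + integral {t..0} F = integral {-h..0} F"
      using False t by (intro Henstock_Kurzweil_Integration.integral_combine int) auto
    then have "norm (integral {-h..t} F - integral {-h..0} F) = norm (integral {t..0} F)"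
      by (metis add_diff_cancel_left' norm_minus_commute)
    also have "\<dots> \<le> B * (0 - t)"
      using False t B by (intro integral_bound continuous_on_subset[OF F]) auto
    also have "\<dots> \<le> B * h" using t B0 by (intro mult_left_mono) auto
    finally show ?thesis .
  qed
qed

text \<open>Banach's fixed point theorem for the integral operator, on the bounded continuous
  functions on the whole line with values in the ball.\<close>

lemma picard_existence:
  fixes f :: "'a::euclidean_space \<Rightarrow> 'a"
  assumes r: "r > 0" and L: "L \<ge> 0"
    and lip: "\<And>x y. x \<in> cball z r \<Longrightarrow> y \<in> cball z r \<Longrightarrow> norm (f x - f y) \<le> L * norm (x - y)"
  shows "\<exists>h>0. \<exists>u. u 0 = z \<and>
    (\<forall>t\<in>{-h<..<h}. u t \<in> cball z r \<and> (u has_vector_derivative f (u t)) (at t))"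
proof -
  define M where "M = norm (f z) + L * r"
  have M0: "M \<ge> 0" using r L by (simp add: M_def)
  have M: "norm (f x) \<le> M" if "x \<in> cball z r" for x
  proof -
    have "norm (f x) \<le> norm (f z) + norm (f x - f z)" by (metis add.commute diff_add_cancel norm_triangle_ineq)
    also have "norm (f x - f z) \<le> L * norm (x - z)" using that r by (intro lip) auto
    also have "\<dots> \<le> L * r" using that L by (intro mult_left_mono) (auto simp: dist_norm norm_minus_commute)
    finally show ?thesis by (simp add: M_def)
  qed
  \<comment> \<open>The first bound keeps iterates in the ball (\<open>M * h \<le> r\<close>), the
    second gives the contraction constant 1/2. Adding 1 avoids division by zero.\<close>
  define h where "h = min (r / (M + 1)) (1 / (2 * (L + 1)))"
  have h: "h > 0" using r L M0 by (auto simp: h_def intro!: divide_pos_pos)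
  have Mh: "M * h \<le> r"
  proof -
    have "M * h \<le> (M + 1) * (r / (M + 1))"
      using M0 r h by (intro mult_mono) (auto simp: h_def)
    then show ?thesis using M0 by simp
  qed
  have Lh: "L * h \<le> 1 / 2"
  proof -
    have "L * h \<le> (L + 1) * (1 / (2 * (L + 1)))"
      using L h by (intro mult_mono) (auto simp: h_def)
    also have "\<dots> = 1 / 2" using L by (simp add: field_simps)
    finally show ?thesis .
  qed
  \<comment> \<open>Clamping time to \<open>[-h, h]\<close> extends functions from the interval to
    the whole line, where the complete space of bounded continuous functions lives.\<close>
  define cl where "cl t = max (-h) (min h t)" for t :: real
  have cl: "cl t \<in> {-h..h}" for t using h by (auto simp: cl_def)
  have lip_cont: "continuous_on (cball z r) f"
    using lip L by (intro lipschitz_on_continuous_on[of L] lipschitz_onI) (auto simp: dist_norm)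
  define S where "S = PiC (UNIV :: real set) (\<lambda>_. cball z r)"
  have S: "u \<in> S \<longleftrightarrow> (\<forall>t. apply_bcontfun u t \<in> cball z r)" for u
    by (auto simp: S_def mem_PiC_iff)
  have "complete S" unfolding S_def by (simp add: closed_PiC complete_eq_closed)
  have "const_bcontfun z \<in> S" using r by (simp add: S)
  then have "S \<noteq> {}" by blast
  \<comment> \<open>The integrals start at \<open>-h\<close>; subtracting \<open>J u 0\<close> in
    \<open>P\<close> turns them into integrals from 0 and so builds in the initial value.\<close>
  define J where "J u t = integral {-h..t} (\<lambda>s. f (apply_bcontfun u s))" for u :: "real \<Rightarrow>\<^sub>C 'a" and t
  define P where "P u = Bcontfun (\<lambda>t. z + (J u (cl t) - J u 0))" for u :: "real \<Rightarrow>\<^sub>C 'a"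
  have fu: "continuous_on T (\<lambda>s. f (apply_bcontfun u s))" if "u \<in> S" for u T
    using that S by (intro continuous_on_compose2[OF lip_cont]) auto
  have Jb: "norm (J u (cl t) - J u 0) \<le> M * h" if "u \<in> S" for u t
    unfolding J_def using that S M cl[of t] by (intro integral_from_zero_bound fu) auto
  have Jc: "continuous_on UNIV (\<lambda>t. J u (cl t))" if "u \<in> S" for u
  proof (rule continuous_on_compose2[where g="J u" and t="{-h..h}"])
    show "continuous_on {- h..h} (J u)" unfolding J_def[abs_def]
      by (intro indefinite_integral_continuous_1 integrable_continuous_real fu that)
    show "continuous_on UNIV cl" unfolding cl_def[abs_def] by (intro continuous_intros)
  qed (use cl in auto)
  have Pap: "apply_bcontfun (P u) = (\<lambda>t. z + (J u (cl t) - J u 0))" if "u \<in> S" for u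
    unfolding P_def
  proof (rule Bcontfun_inverse, rule bcontfun_normI)
    show "continuous_on UNIV (\<lambda>t. z + (J u (cl t) - J u 0))"
      by (intro continuous_intros Jc that)
    show "norm (z + (J u (cl t) - J u 0)) \<le> norm z + M * h" for t
      using Jb[OF that, of t] norm_triangle_ineq[of z "J u (cl t) - J u 0"] by linarith
  qed
  have "P ` S \<subseteq> S"
  proof (clarsimp simp: S)
    fix u :: "real \<Rightarrow>\<^sub>C 'a" and t
    assume "\<forall>t. dist z (apply_bcontfun u t) \<le> r"
    then have "u \<in> S" by (simp add: S)
    then show "dist z (apply_bcontfun (P u) t) \<le> r"
      using Jb[of u t] Mh by (simp add: Pap dist_norm norm_minus_commute[of "J u 0"])
  qed
  moreover have "dist (P u) (P v) \<le> 1/2 * dist u v" if uv: "u \<in> S" "v \<in> S" for u v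
  proof (rule dist_bound)
    fix t
    have ii: "(\<lambda>s. f (apply_bcontfun w s)) integrable_on {-h..s}" if "w \<in> S" for w s
      by (intro integrable_continuous_real fu that)
    have "J u s - J v s = integral {-h..s} (\<lambda>s. f (apply_bcontfun u s) - f (apply_bcontfun v s))" for s
      unfolding J_def by (intro Henstock_Kurzweil_Integration.integral_diff[symmetric] ii uv)
    moreover have "norm (integral {-h..cl t} (\<lambda>s. f (apply_bcontfun u s) - f (apply_bcontfun v s))
        - integral {-h..0} (\<lambda>s. f (apply_bcontfun u s) - f (apply_bcontfun v s))) \<le> (L * dist u v) * h"
    proof (rule integral_from_zero_bound)
      show "continuous_on {- h..h} (\<lambda>s. f (apply_bcontfun u s) - f (apply_bcontfun v s))"
        by (intro continuous_intros fu uv)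
      show "norm (f (apply_bcontfun u s) - f (apply_bcontfun v s)) \<le> L * dist u v" for s
      proof -
        have "norm (f (apply_bcontfun u s) - f (apply_bcontfun v s)) \<le> L * norm (apply_bcontfun u s - apply_bcontfun v s)"
          using uv S by (intro lip) auto
        also have "\<dots> \<le> L * dist u v"
          using L dist_bounded[of u s v] by (intro mult_left_mono) (auto simp: dist_norm)
        finally show ?thesis .
      qed
    qed (use cl[of t] in auto)
    ultimately have "norm ((J u (cl t) - J u 0) - (J v (cl t) - J v 0)) \<le> (L * h) * dist u v"
      by (simp add: algebra_simps)
    also have "\<dots> \<le> 1/2 * dist u v" by (intro mult_right_mono Lh) auto
    finally show "dist (apply_bcontfun (P u) t) (apply_bcontfun (P v) t) \<le> 1/2 * dist u v"
      by (simp add: Pap uv dist_norm)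
  qed
  ultimately obtain u where u: "u \<in> S" "P u = u"
    using Banach_fix[OF \<open>complete S\<close> \<open>S \<noteq> {}\<close>, of "1/2" P] by auto
  let ?u = "apply_bcontfun u"
  have ueq: "?u t = z + (J u t - J u 0)" if "t \<in> {-h<..<h}" for t
  proof -
    have "cl t = t" using that by (auto simp: cl_def)
    then show ?thesis using Pap[OF u(1)] u(2) by metis
  qed
  have "(?u has_vector_derivative f (?u t)) (at t)" if t: "t \<in> {-h<..<h}" for t
  proof -
    have "(J u has_vector_derivative f (?u t)) (at t within {-h..h})"
      unfolding J_def[abs_def] using t by (intro integral_has_vector_derivative fu u) auto
    then have "(J u has_vector_derivative f (?u t)) (at t)"
      using t at_within_interior[of t "{-h..h}"] by simp
    then have "((\<lambda>t. z + (J u t - J u 0)) has_vector_derivative f (?u t)) (at t)"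
      by (auto intro!: derivative_eq_intros)
    then show ?thesis
      by (rule has_vector_derivative_transform_within_open[where S="{-h<..<h}"]) (use t ueq in auto)
  qed
  moreover have "?u 0 = z" using ueq[of 0] h by simp
  ultimately show ?thesis using h u(1) S by blast
qed

text \<open>Smoothness yields continuity of the derivative in each fixed direction. On the compact
  ball the operator norm is therefore bounded by the sum of the bounds for the basis directions, and
  the mean value inequality applies since the ball is convex.\<close>

lemma smooth_on_imp_lipschitz_cball:
  fixes f :: "'a::euclidean_space \<Rightarrow> 'b::euclidean_space"
  assumes "open Z" "smooth_on Z f" "z \<in> Z"
  shows "\<exists>r>0. \<exists>L\<ge>0. cball z r \<subseteq> Z \<and>
    (\<forall>x\<in>cball z r. \<forall>y\<in>cball z r. norm (f x - f y) \<le> L * norm (x - y))"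
proof -
  obtain r where r: "r > 0" "cball z r \<subseteq> Z" using assms open_contains_cball by blast
  have "\<exists>K. \<forall>x\<in>cball z r. norm (frechet_derivative f (at x) b) \<le> K" for b
  proof -
    have "compact ((\<lambda>x. frechet_derivative f (at x) b) ` cball z r)"
      by (intro compact_continuous_image continuous_on_subset[OF _ r(2)]
        smooth_on_continuous smooth_on_frechet assms) auto
    then show ?thesis by (meson bounded_iff compact_imp_bounded image_eqI)
  qed
  then obtain K where K: "\<And>b x. x \<in> cball z r \<Longrightarrow> norm (frechet_derivative f (at x) b) \<le> K b"
    by metis
  define L where "L = (\<Sum>b\<in>Basis. K b)"
  have K0: "K b \<ge> 0" for b using order_trans[OF norm_ge_zero K[of z b]] r by simp
  have on: "onorm (frechet_derivative f (at x)) \<le> L" if x: "x \<in> cball z r" for x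
  proof (rule onorm_le)
    fix v
    have lin: "linear (frechet_derivative f (at x))"
      using x r assms by (intro linear_frechet_derivative smooth_on_differentiable[OF assms(2)]) auto
    have "frechet_derivative f (at x) v = frechet_derivative f (at x) (\<Sum>b\<in>Basis. (v \<bullet> b) *\<^sub>R b)"
      by (simp add: euclidean_representation)
    also have "\<dots> = (\<Sum>b\<in>Basis. (v \<bullet> b) *\<^sub>R frechet_derivative f (at x) b)"
      by (simp add: linear_sum[OF lin] linear_cmul[OF lin])
    also have "norm \<dots> \<le> (\<Sum>b\<in>Basis. norm v * K b)"
      using K[OF x] K0 Basis_le_norm
      by (intro sum_norm_le) (auto intro!: mult_mono)
    finally show "norm (frechet_derivative f (at x) v) \<le> L * norm v"
      by (simp add: L_def sum_distrib_left mult.commute)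
  qed
  have "norm (f x - f y) \<le> L * norm (x - y)" if "x \<in> cball z r" "y \<in> cball z r" for x y
  proof (rule differentiable_bound[OF convex_cball _ on that])
    show "(f has_derivative frechet_derivative f (at w)) (at w within cball z r)" if "w \<in> cball z r" for w
      using that r smooth_on_has_derivative[OF assms(2)] by (blast intro: has_derivative_at_withinI)
  qed
  moreover have "L \<ge> 0" unfolding L_def by (intro sum_nonneg K0)
  ultimately show ?thesis using r by blast
qed

lemma second_order_ode_existence:
  fixes F :: "'a::euclidean_space \<Rightarrow> 'a \<Rightarrow> 'a"
  assumes Om: "open Om" and F: "smooth_on (Om \<times> UNIV) (\<lambda>z. F (fst z) (snd z))" and x0: "x0 \<in> Om"
  shows "\<exists>h>0. \<exists>x v. x 0 = x0 \<and> v 0 = v0 \<and> (\<forall>t\<in>{-h<..<h}. x t \<in> Om \<and>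
    (x has_vector_derivative v t) (at t) \<and> (v has_vector_derivative F (x t) (v t)) (at t))"
proof -
  have op: "open (Om \<times> (UNIV::'a set))" using Om by (simp add: open_Times)
  define f where "f z = (snd z, F (fst z) (snd z))" for z
  have b1: "bounded_linear (\<lambda>x::'a. (x, 0::'a))" and b2: "bounded_linear (\<lambda>x::'a. (0::'a, x))"
    by (auto intro!: bounded_linear_intros)
  have "smooth_on (Om \<times> UNIV) (\<lambda>z::'a\<times>'a. (snd z, 0::'a))"
    by (intro smooth_on_bounded_linear bounded_linear_intros)
  moreover have "smooth_on (Om \<times> UNIV) (\<lambda>z. (0::'a, F (fst z) (snd z)))"
    using smooth_on_compose[OF op F smooth_on_bounded_linear[OF b2, of UNIV]] by simp
  ultimately have "smooth_on (Om \<times> UNIV) (\<lambda>z. (snd z, 0) + (0, F (fst z) (snd z)))"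
    using smooth_on_add[OF op] by blast
  then have "smooth_on (Om \<times> UNIV) f" by (simp add: f_def[abs_def])
  from smooth_on_imp_lipschitz_cball[OF op this, of "(x0, v0)"] x0
  obtain r L where r: "r > 0" "L \<ge> 0" "cball (x0, v0) r \<subseteq> Om \<times> UNIV" and
    lip: "\<forall>x\<in>cball (x0, v0) r. \<forall>y\<in>cball (x0, v0) r. norm (f x - f y) \<le> L * norm (x - y)" by auto
  obtain h u where h: "h > 0" "u 0 = (x0, v0)" and
    u: "\<And>t. t \<in> {-h<..<h} \<Longrightarrow> u t \<in> cball (x0, v0) r \<and> (u has_vector_derivative f (u t)) (at t)"
    using picard_existence[OF r(1,2), of "(x0, v0)" f] lip by blast
  have "((\<lambda>t. fst (u t)) has_vector_derivative fst (f (u t))) (at t)"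
    "((\<lambda>t. snd (u t)) has_vector_derivative snd (f (u t))) (at t)" if "t \<in> {-h<..<h}" for t
    using u[OF that] bounded_linear.has_vector_derivative bounded_linear_fst bounded_linear_snd by blast+
  then show ?thesis using h u r(3)
    by (intro exI[of _ h] conjI exI[of _ "\<lambda>t. fst (u t)"] exI[of _ "\<lambda>t. snd (u t)"] ballI)
      (auto simp: f_def dest!: subsetD[of _ "Om \<times> UNIV"] simp del: mem_cball)
qed

section \<open>Curves on straight lines and the Christoffel symbols they force\<close>

lemma in_span_if_orthogonal:
  fixes b d :: "'a::euclidean_space"
  assumes "\<And>w. w \<bullet> b = 0 \<Longrightarrow> d \<bullet> w = 0"
  shows "\<exists>c. d = c *\<^sub>R b"
proof -
  define w where "w = d - (d \<bullet> b / (b \<bullet> b)) *\<^sub>R b"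
  \<comment> \<open>For \<open>b = 0\<close> the division gives 0, hence \<open>w = d\<close>, and
    the hypothesis forces \<open>d = 0\<close>.\<close>
  have "w \<bullet> b = 0" by (cases "b = 0") (auto simp: w_def inner_diff_left)
  then have "d \<bullet> w = 0" "b \<bullet> w = 0" using assms by (simp_all add: inner_commute[of b])
  then have "w \<bullet> w = 0" by (subst (1) w_def) (simp add: inner_diff_left)
  then show ?thesis by (auto simp: w_def)
qed

text \<open>Nothing is known about the regularity of \<open>\<sigma>\<close>, so it is never
  differentiated. For \<open>e\<close> orthogonal to \<open>b\<close> the function
  \<open>x \<bullet> e\<close> is constant, whence \<open>v \<bullet> e = 0\<close> and then
  \<open>w \<bullet> e = 0\<close>. Thus \<open>v 0\<close> and \<open>w\<close> are both multiples
  of \<open>b\<close>, and \<open>v 0 \<noteq> 0\<close> allows division.\<close>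

lemma acceleration_parallel_if_straight:
  fixes x v :: "real \<Rightarrow> 'a::euclidean_space"
  assumes h: "h > 0" and line: "\<And>t. t \<in> {-h<..<h} \<Longrightarrow> x t = a + \<sigma> t *\<^sub>R b"
    and x: "\<And>t. t \<in> {-h<..<h} \<Longrightarrow> (x has_vector_derivative v t) (at t)"
    and v: "(v has_vector_derivative w) (at 0)" and v0: "v 0 \<noteq> 0"
  shows "\<exists>c. w = c *\<^sub>R v 0"
proof -
  have *: "d \<bullet> e = 0" if t: "t \<in> {-h<..<h}" and y: "(y has_vector_derivative d) (at t)"
    and c: "\<And>t. t \<in> {-h<..<h} \<Longrightarrow> y t \<bullet> e = c" for y d e t c
  proof -
    have "((\<lambda>t. y t \<bullet> e) has_vector_derivative d \<bullet> e) (at t)"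
      using bounded_linear.has_vector_derivative[OF bounded_linear_inner_left y] .
    then have "((\<lambda>t. c) has_vector_derivative d \<bullet> e) (at t)"
      by (rule has_vector_derivative_transform_within_open[where S="{-h<..<h}"]) (use c t in auto)
    moreover have "((\<lambda>t. c) has_vector_derivative 0) (at t)" by simp
    ultimately show ?thesis using vector_derivative_unique_at by blast
  qed
  have v': "v t \<bullet> e = 0" if "e \<bullet> b = 0" "t \<in> {-h<..<h}" for e t
    using *[OF that(2) x[OF that(2)], of e "a \<bullet> e"] line that
    by (simp add: inner_add_left inner_commute[of b])
  have "w \<bullet> e = 0" if "e \<bullet> b = 0" for e
    using *[of 0 v w e 0] v v' that h by auto
  then obtain c where c: "w = c *\<^sub>R b" using in_span_if_orthogonal by blast
  obtain c' where c': "v 0 = c' *\<^sub>R b" using in_span_if_orthogonal[of b "v 0"] v' h by auto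
  have "c' \<noteq> 0" using v0 c' by auto
  then have "w = (c / c') *\<^sub>R v 0" using c c' by simp
  then show ?thesis by blast
qed

lemma sum_mult_axis: "(\<Sum>b\<in>UNIV. f b * axis i (1::real) $ b) = f i"
  by (simp add: axis_def if_distrib[of "\<lambda>x. _ * x"] cong: if_cong)

text \<open>Polarisation of a quadratic map whose value at \<open>v\<close> is always parallel to
  \<open>v\<close>. The vectors \<open>e_i\<close> and \<open>e_i + s e_j\<close> with
  \<open>s = 1\<close> and \<open>s = -1\<close> suffice as tests, and the 1-form is read off from
  the diagonal as \<open>G i i i / 2\<close>.\<close>

lemma christoffel_form_if_parallel:
  fixes G :: "'d::finite \<Rightarrow> 'd \<Rightarrow> 'd \<Rightarrow> real"
  assumes sym: "\<And>i j k. G i j k = G j i k"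
    and par: "\<And>v::real^'d. v \<noteq> 0 \<Longrightarrow> \<exists>c. \<forall>k. (\<Sum>i\<in>UNIV. \<Sum>j\<in>UNIV. G i j k * v $ i * v $ j) = c * v $ k"
  shows "G i j k = (if i = k then G j j j / 2 else 0) + (if j = k then G i i i / 2 else 0)"
proof -
  have 1: "G i i k = 0" if "k \<noteq> i" for i k
  proof -
    obtain c where "\<forall>k. (\<Sum>a\<in>UNIV. \<Sum>b\<in>UNIV. G a b k * axis i 1 $ a * axis i 1 $ b) = c * axis i (1::real) $ k"
      using par[of "axis i 1"] by (auto simp: axis_eq_0_iff)
    then have "(\<Sum>a\<in>UNIV. \<Sum>b\<in>UNIV. G a b k * axis i 1 $ a * axis i 1 $ b) = c * axis i (1::real) $ k" by blast
    then show ?thesis using that by (simp add: sum_mult_axis) (simp add: axis_def)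
  qed
  have 2: "\<exists>c. \<forall>k. G i i k + 2 * s * G i j k + s * s * G j j k =
      c * ((if k = i then 1 else 0) + (if k = j then s else 0))" if "i \<noteq> j" for i j s
  proof -
    let ?v = "axis i 1 + s *\<^sub>R axis j 1 :: real^'d"
    have "?v $ i \<noteq> 0" using that by (simp add: axis_def)
    then obtain c where c: "\<And>k. (\<Sum>a\<in>UNIV. \<Sum>b\<in>UNIV. G a b k * ?v $ a * ?v $ b) = c * ?v $ k"
      using par[of ?v] by fastforce
    have "(\<Sum>a\<in>UNIV. \<Sum>b\<in>UNIV. G a b k * ?v $ a * ?v $ b) = G i i k + 2 * s * G i j k + s * s * G j j k" for k
    proof -
      have "(\<Sum>b\<in>UNIV. G a b k * ?v $ a * ?v $ b) = (G a i k + s * G a j k) * ?v $ a" for a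
        using sum_mult_axis[of "\<lambda>b. G a b k * ?v $ a" i] sum_mult_axis[of "\<lambda>b. s * G a b k * ?v $ a" j]
        by (simp add: algebra_simps sum.distrib)
      then have "(\<Sum>a\<in>UNIV. \<Sum>b\<in>UNIV. G a b k * ?v $ a * ?v $ b) = (\<Sum>a\<in>UNIV. (G a i k + s * G a j k) * ?v $ a)"
        by simp
      also have "\<dots> = (G i i k + s * G i j k) + s * (G j i k + s * G j j k)"
        using sum_mult_axis[of "\<lambda>a. G a i k + s * G a j k" i] sum_mult_axis[of "\<lambda>a. s * (G a i k + s * G a j k)" j]
        by (simp add: algebra_simps sum.distrib)
      finally show ?thesis using sym[of j i k] by (simp add: algebra_simps)
    qed
    then show ?thesis using c by (intro exI[of _ c]) (simp add: axis_def)
  qed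
  have 3: "G i j j = G i i i / 2" if ij: "i \<noteq> j" for i j
  proof -
    obtain c where c: "\<And>k. G i i k + 2 * 1 * G i j k + 1 * 1 * G j j k =
      c * ((if k = i then 1 else 0) + (if k = j then 1 else 0))" using 2[OF ij, of 1] by auto
    obtain c' where c': "\<And>k. G i i k + 2 * (-1) * G i j k + (-1) * (-1) * G j j k =
      c' * ((if k = i then 1 else 0) + (if k = j then (-1) else 0))" using 2[OF ij, of "-1"] by auto
    \<comment> \<open>The components \<open>i\<close> and \<open>j\<close> eliminate
      \<open>c\<close> and \<open>c'\<close>; the sum of the two resulting equations is
      \<open>2 * G i i i = 4 * G i j j\<close>.\<close>
    show ?thesis using c[of i] c[of j] c'[of i] c'[of j] 1[of i j] 1[of j i] ij by simp
  qed
  have 4: "G i j k = 0" if ij: "i \<noteq> j" "k \<noteq> i" "k \<noteq> j" for i j k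
  proof -
    obtain c where c: "\<And>k. G i i k + 2 * 1 * G i j k + 1 * 1 * G j j k =
      c * ((if k = i then 1 else 0) + (if k = j then 1 else 0))" using 2[OF ij(1), of 1] by auto
    show ?thesis using c[of k] 1 ij by simp
  qed
  show ?thesis
    using 1[of k i] 3[of i j] 3[of j i] 4[of i j k] sym[of i j] by (cases "i = j"; cases "k = i"; cases "k = j") auto
qed

section \<open>Charts, smooth functions and tangent vectors\<close>

locale manifold =
  fixes A :: "('m::{t2_space,second_countable_topology}, 'd::finite) chart set"
  assumes smooth_structure: "smooth_structure A"
begin

lemma chart:
  assumes "c \<in> A"
  shows chart_open: "open (fst c)" and chart_image_open: "open (snd c ` fst c)"
    and chart_homeomorphism: "homeomorphism (fst c) (snd c ` fst c) (snd c) (chart_inv c)"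
  using smooth_structure assms by (auto simp: smooth_structure_def is_chart_def)

lemma chart_inv_chart [simp]: "c \<in> A \<Longrightarrow> p \<in> fst c \<Longrightarrow> chart_inv c (snd c p) = p"
  using chart_homeomorphism by (auto simp: homeomorphism_def)

lemma chart_subset_mfd: "c \<in> A \<Longrightarrow> fst c \<subseteq> mfd A"
  by (auto simp: mfd_def)

lemma open_image_chart:
  assumes c: "c \<in> A" and W: "open W" shows "open (snd c ` (fst c \<inter> W))"
proof -
  have "snd c ` (fst c \<inter> W) = snd c ` fst c \<inter> chart_inv c -` W"
    using c by auto
  moreover have "continuous_on (snd c ` fst c) (chart_inv c)"
    using chart_homeomorphism[OF c] by (simp add: homeomorphism_def)
  ultimately show ?thesis
    using continuous_open_preimage[OF _ chart_image_open[OF c] W] by simp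
qed

lemma open_image_chart': "c \<in> A \<Longrightarrow> open W \<Longrightarrow> W \<subseteq> fst c \<Longrightarrow> open (snd c ` W)"
  using open_image_chart[of c W] by (simp add: Int_absorb1)

lemma smooth_on_transition:
  assumes "c \<in> A" "c' \<in> A"
  shows "smooth_on (snd c ` (fst c \<inter> fst c')) (\<lambda>x. snd c' (chart_inv c x))"
  using smooth_structure assms by (auto simp: smooth_structure_def compatible_def o_def)

lemma smooth_fun_open: "smooth_fun A W f \<Longrightarrow> open W"
  by (simp add: smooth_fun_def)

lemma smooth_fun_rep:
  "smooth_fun A W f \<Longrightarrow> c \<in> A \<Longrightarrow> smooth_on (snd c ` (fst c \<inter> W)) (\<lambda>x. f (chart_inv c x))"
  by (simp add: smooth_fun_def o_def)

lemma smooth_fun_rep': "smooth_fun A W f \<Longrightarrow> c \<in> A \<Longrightarrow> W \<subseteq> fst c \<Longrightarrow>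
    smooth_on (snd c ` W) (\<lambda>x. f (chart_inv c x))"
  using smooth_fun_rep[of W f c] by (simp add: Int_absorb1)

text \<open>The representative in another chart is the given one composed with a transition map, so
  a single chart containing \<open>W\<close> decides.\<close>

lemma smooth_fun_chartI:
  assumes c: "c \<in> A" and W: "open W" "W \<subseteq> fst c"
    and f: "smooth_on (snd c ` W) (\<lambda>x. f (chart_inv c x))"
  shows "smooth_fun A W f"
  unfolding smooth_fun_def
proof (intro conjI ballI)
  show "open W" by fact
  show "W \<subseteq> mfd A" using W chart_subset_mfd[OF c] by blast
  fix c' assume c': "c' \<in> A"
  let ?S = "snd c' ` (fst c' \<inter> W)"
  have S: "open ?S" using open_image_chart c' W by blast
  have "smooth_on ?S (\<lambda>x. snd c (chart_inv c' x))"
    by (rule smooth_on_subset[OF smooth_on_transition[OF c' c]]) (use W in auto)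
  moreover have "(\<lambda>x. snd c (chart_inv c' x)) ` ?S \<subseteq> snd c ` W" using c' by auto
  ultimately have "smooth_on ?S (\<lambda>x. f (chart_inv c (snd c (chart_inv c' x))))"
    using smooth_on_compose[OF S _ f] by blast
  then show "smooth_on ?S (f \<circ> chart_inv c')"
    by (rule smooth_on_cong[OF S, rotated]) (use c c' W in auto)
qed

lemma smooth_fun_subset: "smooth_fun A W f \<Longrightarrow> open V \<Longrightarrow> V \<subseteq> W \<Longrightarrow> smooth_fun A V f"
  unfolding smooth_fun_def
  by (metis (no_types, lifting) Int_mono image_mono order_refl smooth_on_subset subset_trans)

lemma smooth_fun_const: "open W \<Longrightarrow> W \<subseteq> mfd A \<Longrightarrow> smooth_fun A W (\<lambda>p. r)"
  by (simp add: smooth_fun_def o_def smooth_on_const)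

lemma smooth_fun_mult:
  "smooth_fun A W f \<Longrightarrow> smooth_fun A W h \<Longrightarrow> smooth_fun A W (\<lambda>p. f p * h p)"
  unfolding smooth_fun_def o_def by (auto intro!: smooth_on_mult open_image_chart)

lemma smooth_fun_add:
  "smooth_fun A W f \<Longrightarrow> smooth_fun A W h \<Longrightarrow> smooth_fun A W (\<lambda>p. f p + h p)"
  unfolding smooth_fun_def o_def by (auto intro!: smooth_on_add open_image_chart)

lemma smooth_fun_coordinate: "c \<in> A \<Longrightarrow> smooth_fun A (fst c) (\<lambda>q. snd c q $ i)"
proof (rule smooth_fun_chartI)
  assume c: "c \<in> A"
  have "smooth_on (snd c ` fst c) (\<lambda>x. snd c (chart_inv c x) $ i)"
    by (rule smooth_on_cong[OF chart_image_open[OF c] _ smooth_on_bounded_linear[OF bounded_linear_vec_nth]])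
      (use c in auto)
  then show "smooth_on (snd c ` fst c) (\<lambda>x. snd c (chart_inv c x) $ i)" .
qed (auto simp: chart_open)

lemma smooth_nearI: "smooth_fun A W f \<Longrightarrow> p \<in> W \<Longrightarrow> smooth_near A p f"
  by (auto simp: smooth_near_def)

lemma smooth_fun_cong:
  assumes "smooth_fun A W f" "\<And>q. q \<in> W \<Longrightarrow> f q = h q" shows "smooth_fun A W h"
proof -
  have "smooth_on (snd c ` (fst c \<inter> W)) (h \<circ> chart_inv c)" if "c \<in> A" for c
    by (rule smooth_on_cong[OF _ _ smooth_fun_rep[OF assms(1) that]])
      (use that assms open_image_chart smooth_fun_open in auto)
  then show ?thesis using assms(1) by (simp add: smooth_fun_def)
qed

lemma smooth_near_cong:
  assumes "open W" "p \<in> W" "\<And>q. q \<in> W \<Longrightarrow> f q = h q"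
  shows "smooth_near A p f \<longleftrightarrow> smooth_near A p h"
proof -
  have "smooth_near A p h"
    if "\<And>q. q \<in> W \<Longrightarrow> f q = h q" and nr: "smooth_near A p f" for f h
  proof -
    obtain V where V: "p \<in> V" "smooth_fun A V f" using nr by (auto simp: smooth_near_def)
    have "smooth_fun A (V \<inter> W) f"
      using V assms(1) smooth_fun_open by (intro smooth_fun_subset[OF V(2)]) auto
    then have "smooth_fun A (V \<inter> W) h" by (rule smooth_fun_cong) (use that in auto)
    then show ?thesis using V assms(2) by (auto simp: smooth_near_def)
  qed
  from this[of f h] this[of h f] show ?thesis using assms(3) by auto
qed

section \<open>Tangent vectors as derivations\<close>

lemma tangent_vec_apply:
  "smooth_near A p f \<Longrightarrow> tangent_vec A c p a f = frechet_derivative (\<lambda>x. f (chart_inv c x)) (at (snd c p)) a"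
  by (simp add: tangent_vec_def o_def)

lemma rep_has_derivative:
  assumes "smooth_near A p f" "c \<in> A" "p \<in> fst c"
  shows "((\<lambda>x. f (chart_inv c x)) has_derivative
    frechet_derivative (\<lambda>x. f (chart_inv c x)) (at (snd c p))) (at (snd c p))"
proof -
  obtain V where V: "p \<in> V" "smooth_fun A V f" using assms by (auto simp: smooth_near_def)
  show ?thesis
    by (rule smooth_on_has_derivative[OF smooth_fun_rep[OF V(2) assms(2)]]) (use V assms in auto)
qed

text \<open>The chain rule on smooth functions; on all others both sides take the default value 0.
  Hence the vectors of one chart already exhaust the tangent space.\<close>

lemma tangent_vec_change_chart:
  assumes c: "c \<in> A" "p \<in> fst c" and c': "c' \<in> A" "p \<in> fst c'"
  shows "tangent_vec A c' p a =
    tangent_vec A c p (frechet_derivative (\<lambda>x. snd c (chart_inv c' x)) (at (snd c' p)) a)"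
proof
  fix f
  show "tangent_vec A c' p a f =
    tangent_vec A c p (frechet_derivative (\<lambda>x. snd c (chart_inv c' x)) (at (snd c' p)) a) f"
  proof (cases "smooth_near A p f")
    case True
    let ?N = "snd c' ` (fst c' \<inter> fst c)" and ?T = "\<lambda>x. snd c (chart_inv c' x)"
    have N: "open ?N" "snd c' p \<in> ?N" using c c' by (auto intro!: open_image_chart chart_open)
    have T: "(?T has_derivative frechet_derivative ?T (at (snd c' p))) (at (snd c' p))"
      by (rule smooth_on_has_derivative[OF smooth_on_transition[OF c'(1) c(1)] N(2)])
    have "((\<lambda>x. f (chart_inv c (?T x))) has_derivative
      (\<lambda>a. frechet_derivative (\<lambda>x. f (chart_inv c x)) (at (snd c p)) (frechet_derivative ?T (at (snd c' p)) a)))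
      (at (snd c' p))"
      using rep_has_derivative[OF True c] c'
      by (intro has_derivative_compose[OF T, where g="\<lambda>y. f (chart_inv c y)"]) simp
    then have "((\<lambda>x. f (chart_inv c' x)) has_derivative
      (\<lambda>a. frechet_derivative (\<lambda>x. f (chart_inv c x)) (at (snd c p)) (frechet_derivative ?T (at (snd c' p)) a)))
      (at (snd c' p))"
      by (rule has_derivative_transform_within_open[OF _ N]) (use c c' in auto)
    then show ?thesis using True by (simp add: tangent_vec_apply frechet_derivative_unique)
  qed (simp add: tangent_vec_def)
qed

lemma tangent_space_chart:
  assumes "c \<in> A" "p \<in> fst c" shows "tangent_space A p = range (tangent_vec A c p)"
proof
  show "range (tangent_vec A c p) \<subseteq> tangent_space A p"
    using assms unfolding tangent_space_def by blast
  show "tangent_space A p \<subseteq> range (tangent_vec A c p)"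
    using tangent_vec_change_chart[OF assms] by (auto simp: tangent_space_def)
qed

lemma coord_field_tangent: "c \<in> A \<Longrightarrow> p \<in> fst c \<Longrightarrow> coord_field A c i p \<in> tangent_space A p"
  unfolding tangent_space_def coord_field_def by blast

lemma coord_field_apply:
  "smooth_near A p f \<Longrightarrow> coord_field A c i p f = partial i (\<lambda>x. f (chart_inv c x)) (snd c p)"
  by (simp add: coord_field_def tangent_vec_apply partial_def)

lemma tangent_vec_expand:
  assumes "c \<in> A" "p \<in> fst c"
  shows "tangent_vec A c p a f = (\<Sum>i\<in>UNIV. a $ i * coord_field A c i p f)"
proof (cases "smooth_near A p f")
  case True
  have "linear (frechet_derivative (\<lambda>x. f (chart_inv c x)) (at (snd c p)))"
    by (rule has_derivative_linear[OF rep_has_derivative[OF True assms]])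
  from linear_axis_sum[OF this, of a] True show ?thesis
    by (simp add: tangent_vec_apply coord_field_apply partial_def)
qed (simp add: tangent_vec_def coord_field_def)

lemma tangent_vec_coordinate:
  assumes c: "c \<in> A" "p \<in> fst c"
  shows "tangent_vec A c p a (\<lambda>q. snd c q $ i) = a $ i"
proof -
  have "((\<lambda>x::real^'d. x $ i) has_derivative (\<lambda>x. x $ i)) (at (snd c p))"
    by (intro bounded_linear_imp_has_derivative bounded_linear_vec_nth)
  then have "((\<lambda>x. snd c (chart_inv c x) $ i) has_derivative (\<lambda>x. x $ i)) (at (snd c p))"
    by (rule has_derivative_transform_within_open[OF _ chart_image_open[OF c(1)]]) (use c in auto)
  then show ?thesis
    using smooth_nearI[OF smooth_fun_coordinate[OF c(1)] c(2)]
    by (simp add: tangent_vec_apply frechet_derivative_unique)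
qed

text \<open>The coefficients are recovered by applying \<open>V\<close> to the coordinate functions,
  which gives components without choosing a representing vector.\<close>

lemma tangent_expand:
  assumes "V \<in> tangent_space A p" "c \<in> A" "p \<in> fst c"
  shows "V f = (\<Sum>i\<in>UNIV. V (\<lambda>q. snd c q $ i) * coord_field A c i p f)"
proof -
  obtain a where "V = tangent_vec A c p a" using assms by (auto simp: tangent_space_chart)
  then show ?thesis using assms by (simp add: tangent_vec_coordinate) (simp add: tangent_vec_expand)
qed

lemma coord_field_coordinate:
  "c \<in> A \<Longrightarrow> p \<in> fst c \<Longrightarrow> coord_field A c j p (\<lambda>q. snd c q $ i) = (if i = j then 1 else 0)"
  unfolding coord_field_def by (subst tangent_vec_coordinate) (auto simp: axis_def)

lemma tangent_ex_chart: "V \<in> tangent_space A p \<Longrightarrow> \<exists>c a. c \<in> A \<and> p \<in> fst c \<and> V = tangent_vec A c p a"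
  by (auto simp: tangent_space_def)

text \<open>Smoothness of \<open>f\<close> and \<open>h\<close> near \<open>p\<close> is equivalent,
  so they fall into the same branch of \<open>tangent_vec\<close>. An expression known on an open
  set only may thus be rewritten under a derivation.\<close>

lemma tangent_germ:
  assumes "V \<in> tangent_space A p" "open W" "p \<in> W" "\<And>q. q \<in> W \<Longrightarrow> f q = h q"
  shows "V f = V h"
proof -
  obtain c a where c: "c \<in> A" "p \<in> fst c" "V = tangent_vec A c p a"
    using tangent_ex_chart assms(1) by blast
  have "frechet_derivative (f \<circ> chart_inv c) (at (snd c p)) = frechet_derivative (h \<circ> chart_inv c) (at (snd c p))"
    by (rule frechet_derivative_cong[OF open_image_chart[OF c(1) assms(2)]]) (use c assms in auto)
  then show ?thesis
    using smooth_near_cong[OF assms(2-4)] c(3) by (simp add: tangent_vec_def)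
qed

lemma tangent_const: "V \<in> tangent_space A p \<Longrightarrow> V (\<lambda>q. r) = 0"
  using tangent_ex_chart[of V p] by (fastforce simp: tangent_vec_def o_def frechet_derivative_const)

lemma smooth_near_mult:
  assumes "smooth_near A p f" "smooth_near A p h" shows "smooth_near A p (\<lambda>q. f q * h q)"
proof -
  obtain V W where "p \<in> V" "smooth_fun A V f" "p \<in> W" "smooth_fun A W h"
    using assms by (auto simp: smooth_near_def)
  then have "smooth_fun A (V \<inter> W) f" "smooth_fun A (V \<inter> W) h" "p \<in> V \<inter> W"
    using smooth_fun_open by (auto intro: smooth_fun_subset)
  then show ?thesis using smooth_fun_mult smooth_nearI by blast
qed

lemma tangent_mult:
  assumes "V \<in> tangent_space A p" and f: "smooth_near A p f" and h: "smooth_near A p h"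
  shows "V (\<lambda>q. f q * h q) = V f * h p + f p * V h"
proof -
  obtain c a where c: "c \<in> A" "p \<in> fst c" "V = tangent_vec A c p a"
    using tangent_ex_chart assms(1) by blast
  have "frechet_derivative (\<lambda>x. f (chart_inv c x) * h (chart_inv c x)) (at (snd c p)) =
    (\<lambda>a. f p * frechet_derivative (\<lambda>x. h (chart_inv c x)) (at (snd c p)) a +
      frechet_derivative (\<lambda>x. f (chart_inv c x)) (at (snd c p)) a * h p)"
    by (rule frechet_derivative_unique[OF has_derivative_eq_rhs[OF
          has_derivative_mult[OF rep_has_derivative[OF f c(1,2)] rep_has_derivative[OF h c(1,2)]]]])
      (simp add: c)
  then show ?thesis using c f h smooth_near_mult by (simp add: tangent_vec_apply)
qed

lemma smooth_near_add:
  assumes "smooth_near A p f" "smooth_near A p h" shows "smooth_near A p (\<lambda>q. f q + h q)"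
proof -
  obtain V W where "p \<in> V" "smooth_fun A V f" "p \<in> W" "smooth_fun A W h"
    using assms by (auto simp: smooth_near_def)
  then have "smooth_fun A (V \<inter> W) f" "smooth_fun A (V \<inter> W) h" "p \<in> V \<inter> W"
    using smooth_fun_open by (auto intro: smooth_fun_subset)
  then show ?thesis using smooth_fun_add smooth_nearI by blast
qed

lemma tangent_add:
  assumes "V \<in> tangent_space A p" and f: "smooth_near A p f" and h: "smooth_near A p h"
  shows "V (\<lambda>q. f q + h q) = V f + V h"
proof -
  obtain c a where c: "c \<in> A" "p \<in> fst c" "V = tangent_vec A c p a"
    using tangent_ex_chart assms(1) by blast
  have "frechet_derivative (\<lambda>x. f (chart_inv c x) + h (chart_inv c x)) (at (snd c p)) =
    (\<lambda>a. frechet_derivative (\<lambda>x. f (chart_inv c x)) (at (snd c p)) a +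
      frechet_derivative (\<lambda>x. h (chart_inv c x)) (at (snd c p)) a)"
    by (rule frechet_derivative_unique[OF
          has_derivative_add[OF rep_has_derivative[OF f c(1,2)] rep_has_derivative[OF h c(1,2)]]])
  then show ?thesis using c f h smooth_near_add by (simp add: tangent_vec_apply)
qed

lemma tangent_space_add:
  assumes "V \<in> tangent_space A p" "W \<in> tangent_space A p"
  shows "tv_add V W \<in> tangent_space A p"
proof -
  obtain c a where c: "c \<in> A" "p \<in> fst c" "V = tangent_vec A c p a"
    using tangent_ex_chart assms(1) by blast
  obtain b where b: "W = tangent_vec A c p b" using assms(2) c by (auto simp: tangent_space_chart)
  have "tv_add V W = tangent_vec A c p (a + b)"
    by (auto simp: tv_add_def tangent_vec_expand[OF c(1,2)] b c(3) algebra_simps sum.distrib)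
  then show ?thesis using c by (auto simp: tangent_space_chart)
qed

lemma tangent_space_scale:
  assumes "V \<in> tangent_space A p"
  shows "tv_scale r V \<in> tangent_space A p"
proof -
  obtain c a where c: "c \<in> A" "p \<in> fst c" "V = tangent_vec A c p a"
    using tangent_ex_chart assms(1) by blast
  have "tv_scale r V = tangent_vec A c p (r *\<^sub>R a)"
    by (auto simp: tv_scale_def tangent_vec_expand[OF c(1,2)] c(3) sum_distrib_left mult.assoc)
  then show ?thesis using c by (auto simp: tangent_space_chart)
qed

section \<open>Smooth vector fields\<close>

lemma vector_field_tangent: "vector_field A U X \<Longrightarrow> p \<in> U \<Longrightarrow> X p \<in> tangent_space A p"
  by (simp add: vector_field_def)

lemma vector_field_smooth:
  "vector_field A U X \<Longrightarrow> smooth_fun A V f \<Longrightarrow> V \<subseteq> U \<Longrightarrow> smooth_fun A V (vf_app X f)"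
  by (simp add: vector_field_def)

lemma vector_field_subset: "vector_field A U X \<Longrightarrow> open V \<Longrightarrow> V \<subseteq> U \<Longrightarrow> vector_field A V X"
  unfolding vector_field_def by (auto dest: subset_trans)

lemma coord_field_vector_field: assumes c: "c \<in> A" shows "vector_field A (fst c) (coord_field A c i)"
  unfolding vector_field_def
proof (intro conjI allI impI ballI)
  show "open (fst c)" "fst c \<subseteq> mfd A" using c by (auto simp: chart_open mfd_def)
  show "coord_field A c i p \<in> tangent_space A p" if "p \<in> fst c" for p
    using c that coord_field_tangent by blast
  fix V f assume V: "V \<subseteq> fst c \<and> smooth_fun A V f"
  show "smooth_fun A V (vf_app (coord_field A c i) f)"
  proof (rule smooth_fun_chartI[OF c])
    have "smooth_on (snd c ` V) (partial i (\<lambda>x. f (chart_inv c x)))"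
      using V c by (intro smooth_on_partial smooth_fun_rep') auto
    then show "smooth_on (snd c ` V) (\<lambda>x. vf_app (coord_field A c i) f (chart_inv c x))"
      by (rule smooth_on_cong[rotated 2]) (use V c smooth_fun_open in
          \<open>auto simp: vf_app_def coord_field_apply[OF smooth_nearI] subset_iff intro!: open_image_chart'\<close>)
  qed (use V smooth_fun_open in auto)
qed

lemma vector_field_add:
  assumes X: "vector_field A U X" and Y: "vector_field A U Y" shows "vector_field A U (vf_add X Y)"
  using assms unfolding vector_field_def
  by (auto simp: vf_add_def tangent_space_add vf_app_def tv_add_def[of _ _, THEN fun_cong] intro!: smooth_fun_add)

lemma vector_field_scale:
  assumes X: "vector_field A U X" and u: "smooth_fun A U u" shows "vector_field A U (vf_scale u X)"
  using assms unfolding vector_field_def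
  by (auto simp: vf_scale_def tangent_space_scale vf_app_def tv_scale_def[THEN fun_cong] smooth_fun_open
      intro!: smooth_fun_mult intro: smooth_fun_subset)

end

section \<open>The Hessian of a connection\<close>

text \<open>The second covariant derivative of a function. On the coordinate functions of a chart it
  gives minus the Christoffel symbols, and on \<open>exp (\<alpha> L)\<close> the equation that
  singles out the divergence.\<close>

definition hessian :: "'m connection \<Rightarrow> 'm vfield \<Rightarrow> 'm vfield \<Rightarrow> ('m \<Rightarrow> real) \<Rightarrow> 'm \<Rightarrow> real" where
  "hessian nabla X Y f p = X p (vf_app Y f) - nabla X Y p f"

definition vf_comb :: "'i set \<Rightarrow> ('i \<Rightarrow> 'm \<Rightarrow> real) \<Rightarrow> ('i \<Rightarrow> 'm vfield) \<Rightarrow> 'm vfield" where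
  "vf_comb I u E = (\<lambda>p f. \<Sum>i\<in>I. u i p * E i p f)"

lemma vf_comb_insert:
  "finite I \<Longrightarrow> i \<notin> I \<Longrightarrow> vf_comb (insert i I) u E = vf_add (vf_scale (u i) (E i)) (vf_comb I u E)"
  by (simp add: vf_comb_def vf_add_def vf_scale_def tv_add_def tv_scale_def fun_eq_iff)

text \<open>The connection laws speak of sums and multiples of fields, so the zero field enters as
  the multiple by 0 of an arbitrary field \<open>X\<close>.\<close>

lemma vf_comb_empty: "vf_comb {} u E = vf_scale (\<lambda>p. 0) X"
  by (simp add: vf_comb_def vf_scale_def tv_scale_def fun_eq_iff)

context manifold
begin

lemma vector_field_open: "vector_field A W X \<Longrightarrow> open W" and
  vector_field_subset_mfd: "vector_field A W X \<Longrightarrow> W \<subseteq> mfd A"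
  by (simp_all add: vector_field_def)

lemma vector_field_comb:
  assumes "finite I" "\<And>i. i \<in> I \<Longrightarrow> smooth_fun A W (u i)" "\<And>i. i \<in> I \<Longrightarrow> vector_field A W (E i)"
    and X: "vector_field A W X"
  shows "vector_field A W (vf_comb I u E)"
  using assms(1-3)
proof (induction I rule: finite_induct)
  case empty
  show ?case unfolding vf_comb_empty[of u E X]
    using X by (intro vector_field_scale smooth_fun_const vector_field_open vector_field_subset_mfd)
next
  case (insert i I)
  then show ?case by (simp add: vf_comb_insert vector_field_add vector_field_scale)
qed

lemma vf_app_smooth_near:
  "vector_field A W Y \<Longrightarrow> smooth_fun A W f \<Longrightarrow> p \<in> W \<Longrightarrow> smooth_near A p (vf_app Y f)"
  using vector_field_smooth smooth_nearI by blast

lemma nabla_linear: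
  assumes "affine_connection A nabla" "vector_field A W X" "vector_field A W Y" "vector_field A W Z"
    "smooth_fun A W u" "p \<in> W"
  shows nabla_add_left: "nabla (vf_add X Y) Z p = tv_add (nabla X Z p) (nabla Y Z p)"
    and nabla_scale_left: "nabla (vf_scale u X) Z p = tv_scale (u p) (nabla X Z p)"
    and nabla_add_right: "nabla X (vf_add Y Z) p = tv_add (nabla X Y p) (nabla X Z p)"
    and nabla_scale_right:
      "nabla X (vf_scale u Y) p = tv_add (tv_scale (X p u) (Y p)) (tv_scale (u p) (nabla X Y p))"
  using assms(1)[unfolded affine_connection_def, THEN conjunct2, THEN conjunct2, rule_format, of W X Y Z u p]
    assms(2-) by simp_all

lemma nabla_vector_field:
  "affine_connection A nabla \<Longrightarrow> vector_field A W X \<Longrightarrow> vector_field A W Y \<Longrightarrow> vector_field A W (nabla X Y)"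
  using affine_connection_def[THEN iffD1, THEN conjunct1, rule_format, of A nabla W X Y] by simp

lemma nabla_cong:
  assumes "affine_connection A nabla" "vector_field A W X" "vector_field A W X'"
    "vector_field A W Y" "vector_field A W Y'" "\<And>q. q \<in> W \<Longrightarrow> X q = X' q" "\<And>q. q \<in> W \<Longrightarrow> Y q = Y' q" "p \<in> W"
  shows "nabla X Y p = nabla X' Y' p"
  using assms(1)[unfolded affine_connection_def, THEN conjunct2, THEN conjunct1, rule_format, of W X X' Y Y' p]
    assms(2-) by simp

context
  fixes nabla W f p
  assumes nabla: "affine_connection A nabla" and f: "smooth_fun A W f" and p: "p \<in> W"
begin

lemma hessian_add_left:
  assumes X: "vector_field A W X" and Y: "vector_field A W Y" and Z: "vector_field A W Z"
  shows "hessian nabla (vf_add X Y) Z f p = hessian nabla X Z f p + hessian nabla Y Z f p"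
  using nabla_add_left[OF nabla X Y Z f p] by (simp add: hessian_def vf_add_def[of X Y] tv_add_def)

lemma hessian_scale_left:
  assumes X: "vector_field A W X" and Z: "vector_field A W Z" and u: "smooth_fun A W u"
  shows "hessian nabla (vf_scale u X) Z f p = u p * hessian nabla X Z f p"
  using nabla_scale_left[OF nabla X X Z u p]
  by (simp add: hessian_def vf_scale_def[of u X] tv_scale_def right_diff_distrib)

lemma hessian_add_right:
  assumes X: "vector_field A W X" and Y: "vector_field A W Y" and Z: "vector_field A W Z"
  shows "hessian nabla X (vf_add Y Z) f p = hessian nabla X Y f p + hessian nabla X Z f p"
proof -
  have "X p (\<lambda>q. vf_app Y f q + vf_app Z f q) = X p (vf_app Y f) + X p (vf_app Z f)"
    using vector_field_tangent[OF X p] vf_app_smooth_near[OF Y f p] vf_app_smooth_near[OF Z f p]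
    by (rule tangent_add)
  moreover have "vf_app (vf_add Y Z) f = (\<lambda>q. vf_app Y f q + vf_app Z f q)"
    by (simp add: vf_app_def vf_add_def tv_add_def)
  ultimately show ?thesis
    using nabla_add_right[OF nabla X Y Z f p] by (simp add: hessian_def tv_add_def)
qed

lemma hessian_scale_right:
  assumes X: "vector_field A W X" and Y: "vector_field A W Y" and u: "smooth_fun A W u"
  shows "hessian nabla X (vf_scale u Y) f p = u p * hessian nabla X Y f p"
proof -
  have "X p (\<lambda>q. u q * vf_app Y f q) = X p u * vf_app Y f p + u p * X p (vf_app Y f)"
    using vector_field_tangent[OF X p] smooth_nearI[OF u p] vf_app_smooth_near[OF Y f p]
    by (rule tangent_mult)
  moreover have "vf_app (vf_scale u Y) f = (\<lambda>q. u q * vf_app Y f q)"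
    by (simp add: vf_app_def vf_scale_def tv_scale_def)
  ultimately show ?thesis
    using nabla_scale_right[OF nabla X Y Y u p]
    by (simp add: hessian_def tv_add_def tv_scale_def right_diff_distrib vf_app_def)
qed

lemma hessian_comb_left:
  assumes Y: "vector_field A W Y" and "finite I" "\<And>i. i \<in> I \<Longrightarrow> smooth_fun A W (u i)"
    "\<And>i. i \<in> I \<Longrightarrow> vector_field A W (E i)"
  shows "hessian nabla (vf_comb I u E) Y f p = (\<Sum>i\<in>I. u i p * hessian nabla (E i) Y f p)"
  using assms(2-4)
proof (induction I rule: finite_induct)
  case empty
  show ?case unfolding vf_comb_empty[of u E Y]
    by (subst hessian_scale_left[OF Y Y])
      (auto intro: smooth_fun_const vector_field_open[OF Y] vector_field_subset_mfd[OF Y, THEN subsetD])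
next
  case (insert i I)
  have "vector_field A W (vf_comb I u E)" using insert by (intro vector_field_comb[OF _ _ _ Y]) auto
  then show ?case using insert Y
    by (simp add: vf_comb_insert hessian_add_left hessian_scale_left vector_field_scale)
qed

lemma hessian_comb_right:
  assumes X: "vector_field A W X" and "finite I" "\<And>i. i \<in> I \<Longrightarrow> smooth_fun A W (u i)"
    "\<And>i. i \<in> I \<Longrightarrow> vector_field A W (E i)"
  shows "hessian nabla X (vf_comb I u E) f p = (\<Sum>i\<in>I. u i p * hessian nabla X (E i) f p)"
  using assms(2-4)
proof (induction I rule: finite_induct)
  case empty
  show ?case unfolding vf_comb_empty[of u E X]
    by (subst hessian_scale_right[OF X X])
      (auto intro: smooth_fun_const vector_field_open[OF X] vector_field_subset_mfd[OF X, THEN subsetD])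
next
  case (insert i I)
  have "vector_field A W (vf_comb I u E)" using insert by (intro vector_field_comb[OF _ _ _ X]) auto
  then show ?case using insert X
    by (simp add: vf_comb_insert hessian_add_right hessian_scale_right vector_field_scale)
qed

lemma hessian_cong:
  assumes X: "vector_field A W X" "vector_field A W X'" and Y: "vector_field A W Y" "vector_field A W Y'"
    and eq: "\<And>q. q \<in> W \<Longrightarrow> X q = X' q" "\<And>q. q \<in> W \<Longrightarrow> Y q = Y' q"
  shows "hessian nabla X Y f p = hessian nabla X' Y' f p"
proof -
  have "X' p (vf_app Y f) = X' p (vf_app Y' f)"
    by (rule tangent_germ[OF vector_field_tangent[OF X(2) p] smooth_fun_open[OF f] p])
      (simp add: vf_app_def eq(2))
  then show ?thesis
    using nabla_cong[OF nabla X Y eq p] eq(1)[OF p] by (simp add: hessian_def)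
qed

text \<open>Tensoriality: the second derivatives of the components cancel in the Hessian.\<close>

lemma hessian_chart:
  assumes X: "vector_field A W X" and Y: "vector_field A W Y" and c: "c \<in> A" "W \<subseteq> fst c"
  shows "hessian nabla X Y f p = (\<Sum>i\<in>UNIV. \<Sum>j\<in>UNIV. X p (\<lambda>q. snd c q $ i) * Y p (\<lambda>q. snd c q $ j) *
    hessian nabla (coord_field A c i) (coord_field A c j) f p)"
proof -
  have oW: "open W" using vector_field_open[OF X] .
  define a where "a i = vf_app X (\<lambda>q. snd c q $ i)" for i
  define b where "b i = vf_app Y (\<lambda>q. snd c q $ i)" for i
  let ?e = "coord_field A c"
  have e: "vector_field A W (?e i)" for i
    by (rule vector_field_subset[OF coord_field_vector_field[OF c(1)] oW c(2)])
  have x: "smooth_fun A W (\<lambda>q. snd c q $ i)" for i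
    by (rule smooth_fun_subset[OF smooth_fun_coordinate[OF c(1)] oW c(2)])
  have a: "smooth_fun A W (a i)" and b: "smooth_fun A W (b i)" for i
    unfolding a_def b_def using vector_field_smooth X Y x by blast+
  have eq: "X q = vf_comb UNIV a ?e q" "Y q = vf_comb UNIV b ?e q" if "q \<in> W" for q
    using tangent_expand[OF vector_field_tangent[OF X that] c(1)] tangent_expand[OF vector_field_tangent[OF Y that] c(1)]
      that c(2) by (auto simp: vf_comb_def a_def b_def vf_app_def fun_eq_iff)
  have ca: "vector_field A W (vf_comb UNIV a ?e)" and cb: "vector_field A W (vf_comb UNIV b ?e)"
    using a b e by (auto intro!: vector_field_comb[OF _ _ _ X])
  \<comment> \<open>The coordinate expansions hold on \<open>W\<close> only; locality of the
    connection allows the fields to be replaced by them.\<close>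
  have "hessian nabla X Y f p = hessian nabla (vf_comb UNIV a ?e) (vf_comb UNIV b ?e) f p"
    by (rule hessian_cong[OF X ca Y cb eq])
  also have "\<dots> = (\<Sum>i\<in>UNIV. a i p * hessian nabla (?e i) (vf_comb UNIV b ?e) f p)"
    by (rule hessian_comb_left[OF cb]) (auto intro: a e)
  also have "\<dots> = (\<Sum>i\<in>UNIV. a i p * (\<Sum>j\<in>UNIV. b j p * hessian nabla (?e i) (?e j) f p))"
    by (intro sum.cong refl arg_cong2[where f="(*)"] hessian_comb_right[OF e]) (auto intro: b e)
  finally show ?thesis by (simp add: a_def b_def vf_app_def sum_distrib_left mult.assoc)
qed

end

lemma nabla_coord_tangent:
  "affine_connection A nabla \<Longrightarrow> c \<in> A \<Longrightarrow> p \<in> fst c \<Longrightarrow>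
    nabla (coord_field A c i) (coord_field A c j) p \<in> tangent_space A p"
  by (rule vector_field_tangent[OF nabla_vector_field[OF _ coord_field_vector_field coord_field_vector_field]])

lemma nabla_coord_expand:
  assumes "affine_connection A nabla" "c \<in> A" "p \<in> fst c"
  shows "nabla (coord_field A c i) (coord_field A c j) p f =
    (\<Sum>k\<in>UNIV. christoffel A nabla c i j k p * coord_field A c k p f)"
  unfolding christoffel_def by (rule tangent_expand[OF nabla_coord_tangent[OF assms] assms(2,3)])

lemma coord_field_coord_field_coordinate:
  assumes c: "c \<in> A" "p \<in> fst c"
  shows "coord_field A c i p (vf_app (coord_field A c j) (\<lambda>q. snd c q $ k)) = 0"
proof -
  have "coord_field A c i p (vf_app (coord_field A c j) (\<lambda>q. snd c q $ k)) =
    coord_field A c i p (\<lambda>q. if k = j then 1 else 0)"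
    by (rule tangent_germ[OF coord_field_tangent[OF c] chart_open[OF c(1)] c(2)])
      (simp add: vf_app_def coord_field_coordinate[OF c(1)])
  then show ?thesis using tangent_const[OF coord_field_tangent[OF c]] by simp
qed

text \<open>In its own chart a coordinate function has vanishing second partials, so only the
  connection term remains.\<close>

lemma hessian_coordinate:
  assumes "c \<in> A" "p \<in> fst c"
  shows "hessian nabla (coord_field A c i) (coord_field A c j) (\<lambda>q. snd c q $ k) p = - christoffel A nabla c i j k p"
  using coord_field_coord_field_coordinate[OF assms] by (simp add: hessian_def christoffel_def)

lemma christoffel_symmetric:
  assumes "torsion_free A nabla" "c \<in> A" "p \<in> fst c"
  shows "christoffel A nabla c i j k p = christoffel A nabla c j i k p"
proof -
  have "nabla (coord_field A c i) (coord_field A c j) p f - nabla (coord_field A c j) (coord_field A c i) p f =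
    lie_bracket A (coord_field A c i) (coord_field A c j) p f" for f
    using assms coord_field_vector_field unfolding torsion_free_def by blast
  from this[of "\<lambda>q. snd c q $ k"] show ?thesis
    using assms coord_field_coord_field_coordinate by (simp add: lie_bracket_def christoffel_def split: if_splits)
qed

lemma coord_field_second:
  assumes f: "smooth_fun A W f" and p: "p \<in> W" and c: "c \<in> A" "W \<subseteq> fst c"
  shows "coord_field A c i p (vf_app (coord_field A c j) f) =
    partial i (partial j (\<lambda>x. f (chart_inv c x))) (snd c p)"
proof -
  have W: "open W" by (rule smooth_fun_open[OF f])
  have "smooth_near A p (vf_app (coord_field A c j) f)"
    using vector_field_smooth[OF coord_field_vector_field[OF c(1)] f c(2)] p by (rule smooth_nearI)
  then have "coord_field A c i p (vf_app (coord_field A c j) f) =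
    partial i (\<lambda>x. vf_app (coord_field A c j) f (chart_inv c x)) (snd c p)"
    by (rule coord_field_apply)
  also have "\<dots> = partial i (partial j (\<lambda>x. f (chart_inv c x))) (snd c p)"
    by (rule partial_cong[OF open_image_chart'[OF c(1) W c(2)]])
      (use p c f in \<open>auto simp: vf_app_def coord_field_apply[OF smooth_nearI] subset_iff\<close>)
  finally show ?thesis .
qed

text \<open>The transformation law of Christoffel symbols: the Hessian of the \<open>k\<close>-th
  coordinate of \<open>c'\<close> is computed once directly in \<open>c\<close> and once by
  tensoriality from the frame of \<open>c'\<close>.\<close>

lemma christoffel_transform:
  assumes nabla: "affine_connection A nabla" and c: "c \<in> A" "p \<in> fst c" and c': "c' \<in> A" "p \<in> fst c'"
  defines "T \<equiv> \<lambda>x. snd c' (chart_inv c x)"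
  shows "partial a (partial b (\<lambda>x. T x $ k)) (snd c p) -
      (\<Sum>l\<in>UNIV. christoffel A nabla c a b l p * partial l (\<lambda>x. T x $ k) (snd c p)) =
    - (\<Sum>i\<in>UNIV. \<Sum>j\<in>UNIV. partial a (\<lambda>x. T x $ i) (snd c p) * partial b (\<lambda>x. T x $ j) (snd c p) *
        christoffel A nabla c' i j k p)"
proof -
  let ?W = "fst c \<inter> fst c'" and ?y = "\<lambda>k q. snd c' q $ k"
  have W: "open ?W" "p \<in> ?W" using c c' by (auto intro: open_Int chart_open)
  have y: "smooth_fun A ?W (?y k)" for k
    by (rule smooth_fun_subset[OF smooth_fun_coordinate[OF c'(1)] W(1)]) auto
  have e: "vector_field A ?W (coord_field A c a)" for a
    by (rule vector_field_subset[OF coord_field_vector_field[OF c(1)] W(1)]) auto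
  have d: "coord_field A c a p (?y i) = partial a (\<lambda>x. T x $ i) (snd c p)" for a i
    unfolding T_def using smooth_nearI[OF y W(2)] by (rule coord_field_apply)
  have "hessian nabla (coord_field A c a) (coord_field A c b) (?y k) p =
    (\<Sum>i\<in>UNIV. \<Sum>j\<in>UNIV. coord_field A c a p (?y i) * coord_field A c b p (?y j) *
      hessian nabla (coord_field A c' i) (coord_field A c' j) (?y k) p)"
    by (rule hessian_chart[OF nabla y W(2) e e c'(1)]) auto
  moreover have "hessian nabla (coord_field A c a) (coord_field A c b) (?y k) p =
    partial a (partial b (\<lambda>x. T x $ k)) (snd c p) -
      (\<Sum>l\<in>UNIV. christoffel A nabla c a b l p * partial l (\<lambda>x. T x $ k) (snd c p))"
    unfolding hessian_def nabla_coord_expand[OF nabla c] d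
    by (subst coord_field_second[OF y W(2) c(1)]) (auto simp: T_def)
  ultimately show ?thesis
    by (simp add: d hessian_coordinate[OF c'] sum_negf)
qed

end

section \<open>Geodesics\<close>

lemma sum_swap_pairs:
  "(\<Sum>i\<in>I. \<Sum>j\<in>J. \<Sum>a\<in>A. \<Sum>b\<in>B. f i j a b) = (\<Sum>a\<in>A. \<Sum>b\<in>B. \<Sum>i\<in>I. \<Sum>j\<in>J. f i j a b)"
proof -
  have "(\<Sum>i\<in>I. \<Sum>j\<in>J. \<Sum>a\<in>A. \<Sum>b\<in>B. f i j a b) = (\<Sum>i\<in>I. \<Sum>a\<in>A. \<Sum>j\<in>J. \<Sum>b\<in>B. f i j a b)"
    by (intro sum.cong refl sum.swap)
  also have "\<dots> = (\<Sum>a\<in>A. \<Sum>i\<in>I. \<Sum>j\<in>J. \<Sum>b\<in>B. f i j a b)" by (rule sum.swap)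
  also have "\<dots> = (\<Sum>a\<in>A. \<Sum>i\<in>I. \<Sum>b\<in>B. \<Sum>j\<in>J. f i j a b)"
    by (intro sum.cong refl sum.swap)
  also have "\<dots> = (\<Sum>a\<in>A. \<Sum>b\<in>B. \<Sum>i\<in>I. \<Sum>j\<in>J. f i j a b)"
    by (intro sum.cong refl sum.swap)
  finally show ?thesis .
qed

text \<open>For one new coordinate, \<open>Q\<close> and \<open>P\<close> stand for its first and
  second partials and \<open>B\<close> for the Jacobian of the coordinate change. The left side is
  then the second derivative of that coordinate along a curve with velocity \<open>v\<close> that
  solves the geodesic equation for \<open>G\<close>; the law \<open>tr\<close> rewrites it as the
  geodesic equation for \<open>G'\<close>.\<close>

lemma geodesic_equation_transform:
  fixes v :: "'d::finite \<Rightarrow> real"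
  assumes tr: "\<And>a b. P a b - (\<Sum>l\<in>UNIV. G a b l * Q l) = - (\<Sum>i\<in>UNIV. \<Sum>j\<in>UNIV. B a i * B b j * G' i j)"
  shows "(\<Sum>a\<in>UNIV. v a * (\<Sum>b\<in>UNIV. v b * P b a) + - (\<Sum>i\<in>UNIV. \<Sum>j\<in>UNIV. G i j a * v i * v j) * Q a) =
    - (\<Sum>i\<in>UNIV. \<Sum>j\<in>UNIV. G' i j * (\<Sum>a\<in>UNIV. v a * B a i) * (\<Sum>b\<in>UNIV. v b * B b j))"
proof -
  have 1: "(\<Sum>a\<in>UNIV. v a * (\<Sum>b\<in>UNIV. v b * P b a)) = (\<Sum>b\<in>UNIV. \<Sum>a\<in>UNIV. v b * v a * P b a)"
    by (subst sum.swap) (simp add: sum_distrib_left mult_ac)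
  have "(\<Sum>l\<in>UNIV. - (\<Sum>i\<in>UNIV. \<Sum>j\<in>UNIV. G i j l * v i * v j) * Q l) =
    - (\<Sum>l\<in>UNIV. \<Sum>i\<in>UNIV. \<Sum>j\<in>UNIV. G i j l * v i * v j * Q l)"
    by (simp add: sum_distrib_right sum_negf)
  also have "(\<Sum>l\<in>UNIV. \<Sum>i\<in>UNIV. \<Sum>j\<in>UNIV. G i j l * v i * v j * Q l) =
    (\<Sum>i\<in>UNIV. \<Sum>l\<in>UNIV. \<Sum>j\<in>UNIV. G i j l * v i * v j * Q l)" by (rule sum.swap)
  also have "\<dots> = (\<Sum>i\<in>UNIV. \<Sum>j\<in>UNIV. \<Sum>l\<in>UNIV. G i j l * v i * v j * Q l)"
    by (intro sum.cong refl sum.swap)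
  also have "\<dots> = (\<Sum>i\<in>UNIV. \<Sum>j\<in>UNIV. v i * v j * (\<Sum>l\<in>UNIV. G i j l * Q l))"
    by (simp add: sum_distrib_left mult_ac)
  finally have 2: "(\<Sum>l\<in>UNIV. - (\<Sum>i\<in>UNIV. \<Sum>j\<in>UNIV. G i j l * v i * v j) * Q l) =
    - (\<Sum>i\<in>UNIV. \<Sum>j\<in>UNIV. v i * v j * (\<Sum>l\<in>UNIV. G i j l * Q l))" .
  have "(\<Sum>i\<in>UNIV. \<Sum>j\<in>UNIV. G' i j * (\<Sum>a\<in>UNIV. v a * B a i) * (\<Sum>b\<in>UNIV. v b * B b j)) =
    (\<Sum>i\<in>UNIV. \<Sum>j\<in>UNIV. \<Sum>a\<in>UNIV. \<Sum>b\<in>UNIV. v a * v b * (B a i * B b j * G' i j))"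
    by (simp add: sum_distrib_left sum_product mult_ac)
  also have "\<dots> = (\<Sum>a\<in>UNIV. \<Sum>b\<in>UNIV. \<Sum>i\<in>UNIV. \<Sum>j\<in>UNIV. v a * v b * (B a i * B b j * G' i j))"
    by (rule sum_swap_pairs)
  also have "\<dots> = (\<Sum>a\<in>UNIV. \<Sum>b\<in>UNIV. v a * v b * (\<Sum>i\<in>UNIV. \<Sum>j\<in>UNIV. B a i * B b j * G' i j))"
    by (simp add: sum_distrib_left)
  also have "\<dots> = (\<Sum>a\<in>UNIV. \<Sum>b\<in>UNIV. v a * v b * (- (P a b - (\<Sum>l\<in>UNIV. G a b l * Q l))))"
    by (simp only: tr minus_minus)
  finally show ?thesis
    unfolding sum.distrib 1 2 by (simp add: sum_subtractf sum_negf right_diff_distrib)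
qed

context manifold
begin

text \<open>Solving the equation in \<open>c\<close> does not suffice, since \<open>geodesic\<close>
  demands it in every chart that the curve meets. In another chart, velocity and acceleration are
  computed by the chain rule and compared through \<open>christoffel_transform\<close>.\<close>

lemma geodesic_exists:
  assumes nabla: "affine_connection A nabla" and c: "c \<in> A" "p \<in> fst c"
  shows "\<exists>h>0. \<exists>\<gamma> v. geodesic A nabla {-h<..<h} \<gamma> \<and> \<gamma> ` {-h<..<h} \<subseteq> fst c \<and> v 0 = v0 \<and>
    (\<forall>t\<in>{-h<..<h}. ((\<lambda>t. snd c (\<gamma> t)) has_vector_derivative v t) (at t)) \<and>
    (v has_vector_derivative (\<chi> k. - (\<Sum>i\<in>UNIV. \<Sum>j\<in>UNIV. christoffel A nabla c i j k p * v0 $ i * v0 $ j))) (at 0)"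
proof -
  let ?Om = "snd c ` fst c"
  have Om: "open ?Om" by (rule chart_image_open[OF c(1)])
  define G where "G i j k x = christoffel A nabla c i j k (chart_inv c x)" for i j k x
  define F where "F x v = (\<chi> k. - (\<Sum>i\<in>UNIV. \<Sum>j\<in>UNIV. G i j k x * v $ i * v $ j))" for x v :: "real^'d"
  have G: "smooth_on ?Om (G i j k)" for i j k
    using smooth_fun_rep'[OF vector_field_smooth[OF nabla_vector_field[OF nabla coord_field_vector_field
            coord_field_vector_field] smooth_fun_coordinate] c(1)] c(1)
    unfolding G_def[abs_def] christoffel_def vf_app_def by blast
  have op: "open (?Om \<times> (UNIV :: (real^'d) set))" using Om by (simp add: open_Times)
  have "smooth_on (?Om \<times> UNIV) (\<lambda>z. F (fst z) (snd z))"
  proof (rule smooth_on_vecI[OF op])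
    fix k
    have f: "smooth_on (?Om \<times> UNIV) (\<lambda>z::(real^'d) \<times> (real^'d). G i j k (fst z))" for i j
      using smooth_on_compose[OF op smooth_on_bounded_linear[OF bounded_linear_fst] G[of i j k]] by auto
    have s: "smooth_on (?Om \<times> UNIV) (\<lambda>z::(real^'d) \<times> (real^'d). snd z $ i)" for i
      by (intro smooth_on_component[OF op] smooth_on_bounded_linear bounded_linear_snd)
    have "smooth_on (?Om \<times> UNIV) (\<lambda>z. - 1 * (\<Sum>i\<in>UNIV. \<Sum>j\<in>UNIV. G i j k (fst z) * snd z $ i * snd z $ j))"
      by (intro smooth_on_mult[OF op] smooth_on_sum[OF op] smooth_on_const f s)
    then show "smooth_on (?Om \<times> UNIV) (\<lambda>z. F (fst z) (snd z) $ k)" by (simp add: F_def)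
  qed
  from second_order_ode_existence[OF Om this, of "snd c p" v0] c(2)
  obtain h x v where h: "h > 0" "x 0 = snd c p" "v 0 = v0" and xv: "\<And>t. t \<in> {-h<..<h} \<Longrightarrow> x t \<in> ?Om"
    "\<And>t. t \<in> {-h<..<h} \<Longrightarrow> (x has_vector_derivative v t) (at t)"
    "\<And>t. t \<in> {-h<..<h} \<Longrightarrow> (v has_vector_derivative F (x t) (v t)) (at t)" by blast
  let ?I = "{-h<..<h}"
  define \<gamma> where "\<gamma> t = chart_inv c (x t)" for t
  have \<gamma>: "\<gamma> t \<in> fst c" "snd c (\<gamma> t) = x t" if "t \<in> ?I" for t
    using xv(1)[OF that] c(1) by (auto simp: \<gamma>_def)
  have xcont: "continuous_on ?I x"
    using xv(2) by (intro continuous_at_imp_continuous_on ballI) (blast intro: has_vector_derivative_continuous)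
  have "geodesic A nabla ?I \<gamma>"
    unfolding geodesic_def Let_def
  proof (intro conjI ballI impI)
    show "open ?I" "is_interval ?I" by (auto simp: is_interval_oo)
    show "continuous_on ?I \<gamma>" unfolding \<gamma>_def[abs_def]
      using chart_homeomorphism[OF c(1)] xv(1)
      by (intro continuous_on_compose2[OF _ xcont]) (auto simp: homeomorphism_def)
    show "\<gamma> ` ?I \<subseteq> mfd A" using \<gamma> chart_subset_mfd[OF c(1)] by auto
    fix c' t assume c': "c' \<in> A" and t: "t \<in> ?I" and t': "\<gamma> t \<in> fst c'"
    define T where "T x = snd c' (chart_inv c x)" for x
    let ?N = "snd c ` (fst c \<inter> fst c')"
    have N: "open ?N" using c c' by (intro open_image_chart chart_open)
    have T: "smooth_on ?N T" unfolding T_def[abs_def] using c c' smooth_on_transition by blast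
    have mem: "x s \<in> ?N \<longleftrightarrow> \<gamma> s \<in> fst c'" if "s \<in> ?I" for s
      using \<gamma>[OF that] c(1) by (auto simp: \<gamma>_def) (metis IntI image_eqI)
    \<comment> \<open>An open set of times around \<open>t\<close> at which the curve lies in both
      charts: differentiating the velocity at \<open>t\<close> needs its formula on a
      neighbourhood.\<close>
    define J where "J = ?I \<inter> x -` ?N"
    have J: "open J" "t \<in> J" "J \<subseteq> ?I"
      unfolding J_def using continuous_open_preimage[OF xcont _ N] t t' mem by auto
    have xN: "x s \<in> ?N" if "s \<in> J" for s using that by (simp add: J_def)
    let ?y = "\<lambda>s. snd c' (\<gamma> s)"
    have dy: "(?y has_vector_derivative frechet_derivative T (at (x s)) (v s)) (at s)" if "s \<in> J" for s
      using has_vector_derivative_compose_frechet[OF xv(2) smooth_on_has_derivative[OF T xN[OF that]]] that J(3)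
      unfolding T_def \<gamma>_def by blast
    show "?y differentiable (at t)"
      using dy[OF J(2)] by (auto simp: has_vector_derivative_def differentiable_def)
    define D where "D a = (\<lambda>x. frechet_derivative T (at x) (axis a 1))" for a
    have D: "smooth_on ?N (D a)" for a unfolding D_def by (rule smooth_on_frechet[OF T])
    have dT: "T differentiable at x" if "x \<in> ?N" for x by (rule smooth_on_differentiable[OF T that])
    have vd: "vector_derivative ?y (at s) = (\<Sum>a\<in>UNIV. v s $ a *\<^sub>R D a (x s))" if "s \<in> J" for s
      unfolding vector_derivative_at[OF dy[OF that]] D_def
      by (rule linear_axis_sum[OF linear_frechet_derivative[OF dT[OF xN[OF that]]]])
    have dva: "((\<lambda>s. v s $ a) has_field_derivative F (x t) (v t) $ a) (at t)" for a
      unfolding has_real_derivative_iff_has_vector_derivative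
      by (rule bounded_linear.has_vector_derivative[OF bounded_linear_vec_nth xv(3)[OF t]])
    \<comment> \<open>The acceleration in \<open>c'\<close>, from the product rule applied to the
      velocity \<open>\<Sum>a. v^a D_a(x)\<close>.\<close>
    define w where "w = (\<Sum>a\<in>UNIV. v t $ a *\<^sub>R frechet_derivative (D a) (at (x t)) (v t) + F (x t) (v t) $ a *\<^sub>R D a (x t))"
    have "((\<lambda>s. \<Sum>a\<in>UNIV. v s $ a *\<^sub>R D a (x s)) has_vector_derivative w) (at t)"
      unfolding w_def
      by (intro has_vector_derivative_sum has_vector_derivative_scaleR dva
          has_vector_derivative_compose_frechet[OF xv(2)[OF t] smooth_on_has_derivative[OF D xN[OF J(2)]]])
    then have "((\<lambda>s. vector_derivative ?y (at s)) has_vector_derivative w) (at t)"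
      by (rule has_vector_derivative_transform_within_open[OF _ J(1,2)]) (simp add: vd)
    moreover have "w = (\<chi> k. - (\<Sum>i\<in>UNIV. \<Sum>j\<in>UNIV. christoffel A nabla c' i j k (\<gamma> t) *
        vector_derivative ?y (at t) $ i * vector_derivative ?y (at t) $ j))" (is "w = ?r")
    proof (rule vec_eq_iff[THEN iffD2], rule allI)
      fix k
      have xt: "x t \<in> ?N" "snd c (\<gamma> t) = x t" using xN[OF J(2)] \<gamma>[OF t] by auto
      have Dk: "D a x $ i = partial a (\<lambda>x. T x $ i) x" if "x \<in> ?N" for a i x
        unfolding D_def partial_def by (rule frechet_derivative_component[OF dT[OF that]])
      have Dk2: "frechet_derivative (D a) (at (x t)) (v t) $ k =
        (\<Sum>b\<in>UNIV. v t $ b * partial b (partial a (\<lambda>x. T x $ k)) (x t))" for a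
      proof -
        have "frechet_derivative (D a) (at (x t)) (v t) $ k = frechet_derivative (\<lambda>x. D a x $ k) (at (x t)) (v t)"
          by (rule frechet_derivative_component[OF smooth_on_differentiable[OF D xt(1)]])
        also have "\<dots> = (\<Sum>b\<in>UNIV. v t $ b * partial b (\<lambda>x. D a x $ k) (x t))"
          by (rule frechet_derivative_partial[OF smooth_on_differentiable[OF smooth_on_component[OF N D] xt(1)]])
        also have "\<dots> = (\<Sum>b\<in>UNIV. v t $ b * partial b (partial a (\<lambda>x. T x $ k)) (x t))"
          by (intro sum.cong refl arg_cong2[where f="(*)"] partial_cong[OF N xt(1)] Dk)
        finally show ?thesis .
      qed
      have vk: "vector_derivative ?y (at t) $ i = (\<Sum>a\<in>UNIV. v t $ a * partial a (\<lambda>x. T x $ i) (x t))" for i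
        by (simp add: vd[OF J(2)] Dk[OF xt(1)])
      have "partial a (partial b (\<lambda>x. T x $ k)) (x t) - (\<Sum>l\<in>UNIV. G a b l (x t) * partial l (\<lambda>x. T x $ k) (x t)) =
        - (\<Sum>i\<in>UNIV. \<Sum>j\<in>UNIV. partial a (\<lambda>x. T x $ i) (x t) * partial b (\<lambda>x. T x $ j) (x t) *
          christoffel A nabla c' i j k (\<gamma> t))" for a b
        using christoffel_transform[OF nabla c(1) \<gamma>(1)[OF t] c' t', of a b k]
        unfolding xt(2) unfolding T_def G_def \<gamma>_def .
      from geodesic_equation_transform[of "\<lambda>a b. partial a (partial b (\<lambda>x. T x $ k)) (x t)" "\<lambda>a b l. G a b l (x t)"
          "\<lambda>l. partial l (\<lambda>x. T x $ k) (x t)" "\<lambda>a i. partial a (\<lambda>x. T x $ i) (x t)"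
          "\<lambda>i j. christoffel A nabla c' i j k (\<gamma> t)" "\<lambda>a. v t $ a", OF this]
      show "w $ k = ?r $ k"
        by (simp only: w_def vec_lambda_beta sum_component vector_add_component vector_scaleR_component
            real_scaleR_def Dk2 vk Dk[OF xt(1)] F_def)
    qed
    ultimately show "((\<lambda>s. vector_derivative ?y (at s)) has_vector_derivative ?r) (at t)" by simp
  qed
  moreover have "\<gamma> ` ?I \<subseteq> fst c" using \<gamma> by auto
  moreover have "((\<lambda>t. snd c (\<gamma> t)) has_vector_derivative v t) (at t)" if "t \<in> ?I" for t
    by (rule has_vector_derivative_transform_within_open[OF xv(2)[OF that], of ?I]) (use that \<gamma> in auto)
  moreover have "(v has_vector_derivative (\<chi> k. - (\<Sum>i\<in>UNIV. \<Sum>j\<in>UNIV. christoffel A nabla c i j k p * v0 $ i * v0 $ j))) (at 0)"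
    using xv(3)[of 0] h c by (simp add: F_def G_def)
  ultimately show ?thesis using h by blast
qed

text \<open>Every nonzero \<open>v0\<close> is the initial velocity of a geodesic through
  \<open>p\<close>. It is straight in the chart, so its acceleration is parallel to
  \<open>v0\<close>; by the geodesic equation the quadratic map given by the Christoffel symbols
  sends each \<open>v0\<close> to a multiple of itself.\<close>

lemma christoffel_if_straight:
  assumes nabla: "affine_connection A nabla" "torsion_free A nabla" and c: "c \<in> A" "p \<in> fst c"
    and straight: "geodesics_straight A nabla (fst c) (snd c)"
  shows "\<exists>\<tau>. \<forall>i j k. christoffel A nabla c i j k p = (if i = k then \<tau> j else 0) + (if j = k then \<tau> i else 0)"
proof -
  have "\<exists>r. \<forall>k. (\<Sum>i\<in>UNIV. \<Sum>j\<in>UNIV. christoffel A nabla c i j k p * v0 $ i * v0 $ j) = r * v0 $ k"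
    if v0: "v0 \<noteq> 0" for v0
  proof -
    obtain h \<gamma> v where h: "h > 0" "geodesic A nabla {-h<..<h} \<gamma>" "\<gamma> ` {-h<..<h} \<subseteq> fst c" "v 0 = v0"
      and v: "\<And>t. t \<in> {-h<..<h} \<Longrightarrow> ((\<lambda>t. snd c (\<gamma> t)) has_vector_derivative v t) (at t)"
      "(v has_vector_derivative (\<chi> k. - (\<Sum>i\<in>UNIV. \<Sum>j\<in>UNIV. christoffel A nabla c i j k p * v0 $ i * v0 $ j))) (at 0)"
      using geodesic_exists[OF nabla(1) c, of v0] by blast
    obtain a b \<sigma> where "\<And>t. t \<in> {-h<..<h} \<Longrightarrow> snd c (\<gamma> t) = a + \<sigma> t *\<^sub>R b"
      using straight h(2,3) unfolding geodesics_straight_def by meson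
    from acceleration_parallel_if_straight[OF h(1) this v] v0 h(4)
    obtain r where "(\<chi> k. - (\<Sum>i\<in>UNIV. \<Sum>j\<in>UNIV. christoffel A nabla c i j k p * v0 $ i * v0 $ j)) = r *\<^sub>R v0"
      by auto
    from arg_cong[OF this, of "\<lambda>x. x $ k" for k]
    have "(\<Sum>i\<in>UNIV. \<Sum>j\<in>UNIV. christoffel A nabla c i j k p * v0 $ i * v0 $ j) = (- r) * v0 $ k" for k
      by (simp add: minus_equation_iff[of "sum _ _"])
    then show ?thesis by (intro exI[of _ "-r"] allI)
  qed
  from christoffel_form_if_parallel[of "\<lambda>i j k. christoffel A nabla c i j k p", OF
      christoffel_symmetric[OF nabla(2) c] this]
  show ?thesis by (intro exI[of _ "\<lambda>i. christoffel A nabla c i i i p / 2"] allI)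
qed

end

section \<open>Metrics in charts\<close>

lemma partial_partial_cong:
  "open S \<Longrightarrow> x \<in> S \<Longrightarrow> (\<And>y. y \<in> S \<Longrightarrow> f y = g y) \<Longrightarrow> partial i (partial j f) x = partial i (partial j g) x"
  by (intro partial_cong[of S]) auto

context manifold
begin

context
  fixes g :: "'m metric" and p :: 'm
  assumes g: "riemannian_metric A g" and p: "p \<in> mfd A"
begin

lemma metric_laws:
  assumes "u \<in> tangent_space A p" "v \<in> tangent_space A p" "w \<in> tangent_space A p"
  shows metric_commute: "g p u v = g p v u"
    and metric_add_left: "g p (tv_add u v) w = g p u w + g p v w"
    and metric_scale_left: "g p (tv_scale r u) v = r * g p u v"
    and metric_pos: "u \<noteq> (\<lambda>f. 0) \<Longrightarrow> g p u u > 0"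
  using g[unfolded riemannian_metric_def, THEN conjunct1, rule_format, OF p assms, of r] by simp_all

text \<open>Membership in the tangent space is proved along with the formula because the laws of the
  metric hold only there; the empty sum enters as \<open>tv_scale 0 w\<close>.\<close>

lemma metric_sum_left:
  assumes "finite I" "\<And>i. i \<in> I \<Longrightarrow> X i \<in> tangent_space A p" and w: "w \<in> tangent_space A p"
  shows "(\<lambda>f. \<Sum>i\<in>I. a i * X i f) \<in> tangent_space A p \<and>
    g p (\<lambda>f. \<Sum>i\<in>I. a i * X i f) w = (\<Sum>i\<in>I. a i * g p (X i) w)"
  using assms(1,2)
proof (induction I rule: finite_induct)
  case empty
  have "(\<lambda>f. \<Sum>i\<in>{}. a i * X i f) = tv_scale 0 w" by (simp add: tv_scale_def)
  then show ?case using tangent_space_scale[OF w, of 0] metric_scale_left[OF w w w, of 0] by simp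
next
  case (insert i I)
  have eq: "(\<lambda>f. \<Sum>i\<in>insert i I. a i * X i f) = tv_add (tv_scale (a i) (X i)) (\<lambda>f. \<Sum>i\<in>I. a i * X i f)"
    using insert by (simp add: tv_add_def tv_scale_def)
  have t: "tv_scale (a i) (X i) \<in> tangent_space A p" "X i \<in> tangent_space A p"
    using insert tangent_space_scale by auto
  show ?case unfolding eq
    using insert t w tangent_space_add metric_add_left[OF t(1) _ w] metric_scale_left[OF t(2) w w] by simp
qed

lemma metric_chart_left:
  assumes V: "V \<in> tangent_space A p" and w: "w \<in> tangent_space A p" and c: "c \<in> A" "p \<in> fst c"
  shows "g p V w = (\<Sum>i\<in>UNIV. V (\<lambda>q. snd c q $ i) * g p (coord_field A c i p) w)"
proof -
  have "V = (\<lambda>f. \<Sum>i\<in>UNIV. V (\<lambda>q. snd c q $ i) * coord_field A c i p f)"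
    using tangent_expand[OF V c] by (rule ext)
  then have "g p V w = g p (\<lambda>f. \<Sum>i\<in>UNIV. V (\<lambda>q. snd c q $ i) * coord_field A c i p f) w"
    by (rule arg_cong)
  then show ?thesis
    using metric_sum_left[of UNIV "\<lambda>i. coord_field A c i p" w "\<lambda>i. V (\<lambda>q. snd c q $ i)"]
      coord_field_tangent[OF c] w by simp
qed

lemma metric_chart:
  assumes V: "V \<in> tangent_space A p" and Z: "Z \<in> tangent_space A p" and c: "c \<in> A" "p \<in> fst c"
  shows "g p V Z = (\<Sum>i\<in>UNIV. \<Sum>j\<in>UNIV. V (\<lambda>q. snd c q $ i) * Z (\<lambda>q. snd c q $ j) *
    g p (coord_field A c i p) (coord_field A c j p))"
proof -
  have e: "coord_field A c i p \<in> tangent_space A p" for i by (rule coord_field_tangent[OF c])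
  have "g p (coord_field A c i p) Z = (\<Sum>j\<in>UNIV. Z (\<lambda>q. snd c q $ j) * g p (coord_field A c i p) (coord_field A c j p))" for i
    using metric_chart_left[OF Z e[of i] c] metric_commute[OF e Z Z] metric_commute[OF e e e] by simp
  then show ?thesis
    using metric_chart_left[OF V Z c] by (simp add: sum_distrib_left mult.assoc)
qed

end

lemma smooth_fun_chart_comp:
  assumes c: "c \<in> A" and W: "open W" "W \<subseteq> fst c" and h: "smooth_on (snd c ` W) h"
  shows "smooth_fun A W (\<lambda>q. h (snd c q))"
  by (rule smooth_fun_chartI[OF c W], rule smooth_on_cong[OF open_image_chart'[OF c W] _ h])
    (use c W in auto)

lemma coord_field_chart_comp:
  assumes c: "c \<in> A" and W: "open W" "W \<subseteq> fst c" and h: "smooth_on (snd c ` W) h" and p: "p \<in> W"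
  shows "coord_field A c a p (\<lambda>q. h (snd c q)) = partial a h (snd c p)"
    and "coord_field A c a p (vf_app (coord_field A c b) (\<lambda>q. h (snd c q))) = partial a (partial b h) (snd c p)"
proof -
  have f: "smooth_fun A W (\<lambda>q. h (snd c q))" by (rule smooth_fun_chart_comp[OF c W h])
  have S: "open (snd c ` W)" "snd c p \<in> snd c ` W" using p by (auto intro: open_image_chart'[OF c W])
  have eq: "h (snd c (chart_inv c x)) = h x" if "x \<in> snd c ` W" for x
    using that c W by auto
  show "coord_field A c a p (\<lambda>q. h (snd c q)) = partial a h (snd c p)"
    unfolding coord_field_apply[OF smooth_nearI[OF f p]] by (rule partial_cong[OF S eq])
  show "coord_field A c a p (vf_app (coord_field A c b) (\<lambda>q. h (snd c q))) = partial a (partial b h) (snd c p)"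
    unfolding coord_field_second[OF f p c W(2)] by (rule partial_partial_cong[OF S eq])
qed

lemma hessian_linear_combination:
  assumes nabla: "affine_connection A nabla" and X: "vector_field A W X" and Y: "vector_field A W Y"
    and f: "smooth_fun A W f" and h: "smooth_fun A W h" and p: "p \<in> W"
  shows "hessian nabla X Y (\<lambda>q. k * f q + l * h q) p = k * hessian nabla X Y f p + l * hessian nabla X Y h p"
proof -
  have W: "open W" "W \<subseteq> mfd A" using X vector_field_open vector_field_subset_mfd by blast+
  have lin: "V (\<lambda>q. k * f q + l * h q) = k * V f + l * V h"
    if V: "V \<in> tangent_space A q" and f: "smooth_fun A W f" and h: "smooth_fun A W h" and q: "q \<in> W" for V q f h
  proof -
    have s: "smooth_near A q (\<lambda>q. r)" "smooth_near A q f" "smooth_near A q h" for r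
      using W q f h by (auto intro!: smooth_nearI[of W] smooth_fun_const)
    then show ?thesis
      by (simp add: tangent_add[OF V] tangent_mult[OF V] smooth_near_mult tangent_const[OF V])
  qed
  have "X p (vf_app Y (\<lambda>q. k * f q + l * h q)) = X p (\<lambda>q. k * vf_app Y f q + l * vf_app Y h q)"
    by (rule tangent_germ[OF vector_field_tangent[OF X p] W(1) p])
      (simp add: vf_app_def lin[OF vector_field_tangent[OF Y] f h])
  also have "\<dots> = k * X p (vf_app Y f) + l * X p (vf_app Y h)"
    by (rule lin[OF vector_field_tangent[OF X p] vector_field_smooth[OF Y f order_refl] vector_field_smooth[OF Y h order_refl] p])
  finally show ?thesis
    using lin[OF vector_field_tangent[OF nabla_vector_field[OF nabla X Y] p] f h p]
    by (simp add: hessian_def right_diff_distrib)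
qed

end

section \<open>Derivatives of the potentials\<close>

context
  fixes n :: "real^'d" and \<alpha> :: real
begin

lemma inner_has_derivative: "((\<lambda>x. x \<bullet> w) has_derivative (\<lambda>v. v \<bullet> w)) (at (x :: real^'d))"
  by (intro bounded_linear_imp_has_derivative bounded_linear_inner_left)

lemma open_affine_pos: "open {x. 1 + \<alpha> * (x \<bullet> n) > 0}"
  by (intro open_Collect_less continuous_intros)

lemma smooth_on_inner_left: "smooth_on S (\<lambda>x::real^'d. x \<bullet> w)"
  by (rule smooth_on_bounded_linear[OF bounded_linear_inner_left])

lemma smooth_on_affine: "open S \<Longrightarrow> smooth_on S (\<lambda>x. 1 + \<alpha> * (x \<bullet> n))"
  by (intro smooth_on_add smooth_on_mult smooth_on_const smooth_on_inner_left)

lemma smooth_on_quotient: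
  "open S \<Longrightarrow> (\<And>x. x \<in> S \<Longrightarrow> 1 + \<alpha> * (x \<bullet> n) > 0) \<Longrightarrow> smooth_on S (\<lambda>x. (x \<bullet> w) / (1 + \<alpha> * (x \<bullet> n)))"
  by (intro smooth_on_divide smooth_on_affine smooth_on_inner_left)

lemma partial_quotient:
  assumes "1 + \<alpha> * (x \<bullet> n) > 0"
  shows "partial a (\<lambda>x. (x \<bullet> w) / (1 + \<alpha> * (x \<bullet> n))) x =
    w $ a / (1 + \<alpha> * (x \<bullet> n)) - \<alpha> * (x \<bullet> w) * n $ a / (1 + \<alpha> * (x \<bullet> n))\<^sup>2"
proof -
  define P where "P = 1 + \<alpha> * (x \<bullet> n)"
  have P: "P \<noteq> 0" "1 + \<alpha> * (x \<bullet> n) = P" using assms by (auto simp: P_def)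
  have "((\<lambda>x. (x \<bullet> w) / (1 + \<alpha> * (x \<bullet> n))) has_derivative (\<lambda>v. (v \<bullet> w) / P -
      \<alpha> * (x \<bullet> w) * (v \<bullet> n) / P\<^sup>2)) (at x)"
    using P(1)
    by (auto intro!: derivative_eq_intros inner_has_derivative simp: fun_eq_iff P(2) field_simps power2_eq_square)
  from partialI[OF this] show ?thesis by (simp add: inner_axis' P(2))
qed

text \<open>With \<open>u = (x \<bullet> w) / P\<close> and
  \<open>P = 1 + \<alpha> (x \<bullet> n)\<close>, the function \<open>P u\<close> is linear, and
  the vanishing of its second partials is this identity. In other words, \<open>u\<close> has zero
  Hessian for Christoffel symbols of the form forced by straight geodesics, with 1-form
  \<open>- \<alpha> n / P\<close>.\<close>

lemma partial_partial_quotient: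
  assumes "1 + \<alpha> * (x \<bullet> n) > 0"
  shows "partial a (partial b (\<lambda>x. (x \<bullet> w) / (1 + \<alpha> * (x \<bullet> n)))) x =
    - \<alpha> * (n $ b / (1 + \<alpha> * (x \<bullet> n))) * partial a (\<lambda>x. (x \<bullet> w) / (1 + \<alpha> * (x \<bullet> n))) x
    - \<alpha> * (n $ a / (1 + \<alpha> * (x \<bullet> n))) * partial b (\<lambda>x. (x \<bullet> w) / (1 + \<alpha> * (x \<bullet> n))) x"
proof -
  \<comment> \<open>Working with the reciprocal keeps all derivatives polynomial in
    \<open>I\<close>.\<close>
  define I where "I x = 1 / (1 + \<alpha> * (x \<bullet> n))" for x
  let ?F = "\<lambda>x. w $ b * I x - \<alpha> * (x \<bullet> w) * n $ b * (I x * I x)"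
  have F: "w $ b / (1 + \<alpha> * (y \<bullet> n)) - \<alpha> * (y \<bullet> w) * n $ b / (1 + \<alpha> * (y \<bullet> n))\<^sup>2 =
    w $ b * I y - \<alpha> * (y \<bullet> w) * n $ b * (I y * I y)" for y b
    by (simp add: I_def power2_eq_square)
  have I: "(I has_derivative (\<lambda>v. - \<alpha> * (v \<bullet> n) * (I x * I x))) (at x)"
    unfolding I_def[abs_def] using assms
    by (auto intro!: derivative_eq_intros inner_has_derivative simp: fun_eq_iff)
  have "partial a (partial b (\<lambda>x. (x \<bullet> w) / (1 + \<alpha> * (x \<bullet> n)))) x = partial a ?F x"
    by (rule partial_cong[OF open_affine_pos]) (use assms in \<open>auto simp: partial_quotient F\<close>)
  also have "(?F has_derivative (\<lambda>v. w $ b * (- \<alpha> * (v \<bullet> n) * (I x * I x)) - (\<alpha> * (v \<bullet> w) * n $ b * (I x * I x) +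
      \<alpha> * (x \<bullet> w) * n $ b * (2 * I x * (- \<alpha> * (v \<bullet> n) * (I x * I x)))))) (at x)"
    by (auto intro!: derivative_eq_intros inner_has_derivative I simp: fun_eq_iff algebra_simps)
  then have "partial a ?F x = w $ b * (- \<alpha> * n $ a * (I x * I x)) - (\<alpha> * w $ a * n $ b * (I x * I x) +
      \<alpha> * (x \<bullet> w) * n $ b * (2 * I x * (- \<alpha> * n $ a * (I x * I x))))"
    using partialI[of ?F _ x a] by (simp add: inner_axis')
  finally show ?thesis
    unfolding partial_quotient[OF assms] F by (simp add: I_def[of x] divide_inverse algebra_simps)
qed

context
  fixes S :: "(real^'d) set" and \<phi> :: "real^'d \<Rightarrow> real"
  assumes S: "open S" and \<phi>: "smooth_on S \<phi>"
begin

lemma smooth_on_affine_exp: "smooth_on S (\<lambda>x. (1 + \<alpha> * (x \<bullet> n)) * exp (- \<alpha> * \<phi> x))"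
  by (intro smooth_on_mult smooth_on_affine smooth_on_exp smooth_on_const \<phi> S)

lemma partial_affine_exp:
  assumes x: "x \<in> S"
  shows "partial b (\<lambda>x. (1 + \<alpha> * (x \<bullet> n)) * exp (- \<alpha> * \<phi> x)) x =
    \<alpha> * n $ b * exp (- \<alpha> * \<phi> x) - \<alpha> * partial b \<phi> x * ((1 + \<alpha> * (x \<bullet> n)) * exp (- \<alpha> * \<phi> x))"
proof -
  have "((\<lambda>x. (1 + \<alpha> * (x \<bullet> n)) * exp (- \<alpha> * \<phi> x)) has_derivative
    (\<lambda>v. \<alpha> * (v \<bullet> n) * exp (- \<alpha> * \<phi> x) -
      \<alpha> * frechet_derivative \<phi> (at x) v * ((1 + \<alpha> * (x \<bullet> n)) * exp (- \<alpha> * \<phi> x)))) (at x)"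
    by (auto intro!: derivative_eq_intros inner_has_derivative smooth_on_has_derivative[OF \<phi> x]
        simp: fun_eq_iff algebra_simps)
  from partialI[OF this] show ?thesis by (simp add: inner_axis' partial_def)
qed

text \<open>\<open>h * exp (\<alpha> \<phi>)\<close> is affine, and the vanishing of its second
  partials amounts to this identity. The left side is the Hessian for the 1-form
  \<open>- \<alpha> d\<phi>\<close>, and in a dual system the bracket on the right is
  \<open>\<epsilon> g\<close>.\<close>

lemma partial_partial_affine_exp:
  assumes x: "x \<in> S"
  defines "h \<equiv> \<lambda>x. (1 + \<alpha> * (x \<bullet> n)) * exp (- \<alpha> * \<phi> x)"
  shows "partial a (partial b h) x + \<alpha> * partial b \<phi> x * partial a h x + \<alpha> * partial a \<phi> x * partial b h x =
    \<alpha> * (- partial a (partial b \<phi>) x - \<alpha> * partial a \<phi> x * partial b \<phi> x) * h x"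
proof -
  let ?F = "\<lambda>x. \<alpha> * n $ b * exp (- \<alpha> * \<phi> x) - \<alpha> * partial b \<phi> x * h x"
  have h: "smooth_on S h" unfolding h_def by (rule smooth_on_affine_exp)
  have "partial a (partial b h) x = partial a ?F x"
    by (rule partial_cong[OF S x]) (unfold h_def, rule partial_affine_exp)
  also have "(?F has_derivative (\<lambda>v. \<alpha> * n $ b * (- \<alpha> * frechet_derivative \<phi> (at x) v * exp (- \<alpha> * \<phi> x)) -
     (\<alpha> * frechet_derivative (partial b \<phi>) (at x) v * h x + \<alpha> * partial b \<phi> x * frechet_derivative h (at x) v))) (at x)"
    by (auto intro!: derivative_eq_intros smooth_on_has_derivative[OF \<phi> x]
        smooth_on_has_derivative[OF smooth_on_partial[OF \<phi>] x] smooth_on_has_derivative[OF h x]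
        simp: fun_eq_iff algebra_simps)
  then have "partial a ?F x = \<alpha> * n $ b * (- \<alpha> * partial a \<phi> x * exp (- \<alpha> * \<phi> x)) -
     (\<alpha> * partial a (partial b \<phi>) x * h x + \<alpha> * partial b \<phi> x * partial a h x)"
    using partialI[of ?F _ x a] by (simp add: partial_def[of a])
  finally have *: "partial a (partial b h) x = \<alpha> * n $ b * (- \<alpha> * partial a \<phi> x * exp (- \<alpha> * \<phi> x)) -
     (\<alpha> * partial a (partial b \<phi>) x * h x + \<alpha> * partial b \<phi> x * partial a h x)" .
  have "partial b h x = \<alpha> * n $ b * exp (- \<alpha> * \<phi> x) - \<alpha> * partial b \<phi> x * h x"
    unfolding h_def by (rule partial_affine_exp[OF x])
  then have e: "\<alpha> * n $ b * exp (- \<alpha> * \<phi> x) = partial b h x + \<alpha> * partial b \<phi> x * h x" by simp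
  have "\<alpha> * n $ b * (- \<alpha> * partial a \<phi> x * exp (- \<alpha> * \<phi> x)) =
    - \<alpha> * partial a \<phi> x * (partial b h x + \<alpha> * partial b \<phi> x * h x)"
    unfolding e[symmetric] by simp
  then show ?thesis unfolding * by (simp add: algebra_simps)
qed

text \<open>Multiplication by \<open>exp (\<alpha> \<phi>)\<close> turns the linear second order equation into \<open>Hess = 0\<close>.\<close>

lemma partial_partial_mult_exp:
  assumes x: "x \<in> S" and f: "smooth_on S f"
    and eq: "partial a (partial b f) x + \<alpha> * partial b \<phi> x * partial a f x + \<alpha> * partial a \<phi> x * partial b f x =
      \<alpha> * (- partial a (partial b \<phi>) x - \<alpha> * partial a \<phi> x * partial b \<phi> x) * f x"
  shows "partial a (partial b (\<lambda>x. f x * exp (\<alpha> * \<phi> x))) x = 0"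
proof -
  let ?u = "\<lambda>x. exp (\<alpha> * \<phi> x)"
  let ?F = "\<lambda>x. (partial b f x + \<alpha> * partial b \<phi> x * f x) * ?u x"
  have "partial b (\<lambda>x. f x * ?u x) y = ?F y" if y: "y \<in> S" for y
  proof -
    have "((\<lambda>x. f x * ?u x) has_derivative (\<lambda>v. (frechet_derivative f (at y) v +
        \<alpha> * frechet_derivative \<phi> (at y) v * f y) * ?u y)) (at y)"
      by (auto intro!: derivative_eq_intros smooth_on_has_derivative[OF \<phi> y] smooth_on_has_derivative[OF f y]
          simp: fun_eq_iff algebra_simps)
    from partialI[OF this] show ?thesis by (simp add: partial_def)
  qed
  then have "partial a (partial b (\<lambda>x. f x * ?u x)) x = partial a ?F x"
    by (intro partial_cong[OF S x])
  also have "(?F has_derivative (\<lambda>v. (frechet_derivative (partial b f) (at x) v +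
      (\<alpha> * frechet_derivative (partial b \<phi>) (at x) v * f x + \<alpha> * partial b \<phi> x * frechet_derivative f (at x) v) +
      (partial b f x + \<alpha> * partial b \<phi> x * f x) * (\<alpha> * frechet_derivative \<phi> (at x) v)) * ?u x)) (at x)"
    by (auto intro!: derivative_eq_intros smooth_on_has_derivative[OF \<phi> x] smooth_on_has_derivative[OF f x]
        smooth_on_has_derivative[OF smooth_on_partial[OF \<phi>] x] smooth_on_has_derivative[OF smooth_on_partial[OF f] x]
        simp: fun_eq_iff algebra_simps)
  then have "partial a ?F x = (partial a (partial b f) x +
      (\<alpha> * partial a (partial b \<phi>) x * f x + \<alpha> * partial b \<phi> x * partial a f x) +
      (partial b f x + \<alpha> * partial b \<phi> x * f x) * (\<alpha> * partial a \<phi> x)) * ?u x"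
    using partialI[of ?F _ x a] by (simp add: partial_def[of a])
  also have "partial a (partial b f) x +
      (\<alpha> * partial a (partial b \<phi>) x * f x + \<alpha> * partial b \<phi> x * partial a f x) +
      (partial b f x + \<alpha> * partial b \<phi> x * f x) * (\<alpha> * partial a \<phi> x) = 0"
    using eq by (simp add: algebra_simps)
  finally show ?thesis by simp
qed

end

end

section \<open>Dual coordinate systems\<close>

text \<open>The sign \<open>\<epsilon>\<close> is \<open>1\<close> for negative and \<open>-1\<close> for positive curvature. The assumption \<open>grad\<close> says
  that the divergence is critical on the diagonal in its first argument.\<close>

locale dual_system = manifold A
  for A :: "('m::{t2_space,second_countable_topology}, 'd::finite) chart set" +
  fixes g :: "'m metric" and nabla nabla' :: "'m connection" and \<alpha> \<epsilon> :: real
    and U :: "'m set" and \<xi> \<eta> :: "'m \<Rightarrow> real^'d" and \<phi> \<psi> :: "real^'d \<Rightarrow> real"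
  assumes alpha: "\<alpha> > 0" and eps: "\<epsilon> * \<epsilon> = 1" and dim: "CARD('d) \<ge> 2"
    and stat: "statistical_manifold A g nabla nabla'"
    and adapted: "adapted_coordinates A nabla nabla' \<alpha> U \<xi> \<eta> \<phi> \<psi>"
    and metric_xi: "p \<in> U \<Longrightarrow> g p (coord_field A (U, \<xi>) i p) (coord_field A (U, \<xi>) j p) =
      \<epsilon> * (- partial i (partial j \<phi>) (\<xi> p) - \<alpha> * partial i \<phi> (\<xi> p) * partial j \<phi> (\<xi> p))"
    and grad: "p \<in> U \<Longrightarrow> \<eta> p $ i = (1 + \<alpha> * (\<xi> p \<bullet> \<eta> p)) * partial i \<phi> (\<xi> p)"
begin

abbreviation E :: "'d \<Rightarrow> 'm vfield" where "E \<equiv> coord_field A (U, \<xi>)"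

lemma riemannian: "riemannian_metric A g"
  and nabla: "affine_connection A nabla" "torsion_free A nabla"
  and nabla': "affine_connection A nabla'" "torsion_free A nabla'"
  using stat by (auto simp: statistical_manifold_def)

lemma duality:
  assumes "vector_field A W X" "vector_field A W Y" "vector_field A W Z" "p \<in> W"
  shows "Z p (\<lambda>q. g q (X q) (Y q)) = g p (nabla Z X p) (Y p) + g p (X p) (nabla' Z Y p)"
proof -
  have "\<forall>U X Y Z. vector_field A U X \<and> vector_field A U Y \<and> vector_field A U Z \<longrightarrow>
        (\<forall>p\<in>U. Z p (\<lambda>q. g q (X q) (Y q)) = g p (nabla Z X p) (Y p) + g p (X p) (nabla' Z Y p))"
    using stat unfolding statistical_manifold_def by (elim conjE)
  from this[rule_format, of W X Y Z p] show ?thesis using assms by simp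
qed

lemma xi: "(U, \<xi>) \<in> A" and eta: "(U, \<eta>) \<in> A" and phi: "smooth_on (\<xi> ` U) \<phi>" and psi: "smooth_on (\<eta> ` U) \<psi>"
  and straight: "geodesics_straight A nabla U \<xi>"
  using adapted by (auto simp: adapted_coordinates_def)

lemma pos: "p \<in> U \<Longrightarrow> 1 + \<alpha> * (\<xi> p \<bullet> \<eta> p) > 0"
  and fenchel: "p \<in> U \<Longrightarrow> \<phi> (\<xi> p) + \<psi> (\<eta> p) = 1 / \<alpha> * ln (1 + \<alpha> * (\<xi> p \<bullet> \<eta> p))"
  using adapted by (auto simp: adapted_coordinates_def)

lemma open_U: "open U" and open_xi: "open (\<xi> ` U)" and U_subset: "U \<subseteq> mfd A"
  using chart_open[OF xi] chart_image_open[OF xi] chart_subset_mfd[OF xi] by auto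

lemma E_vector_field: "vector_field A U (E i)"
  using coord_field_vector_field[OF xi] by simp

lemma E_tangent: "p \<in> U \<Longrightarrow> E i p \<in> tangent_space A p"
  using coord_field_tangent[OF xi] by simp

text \<open>Torsion-freeness of \<open>nabla'\<close> in the form that removes it from the Codazzi
  equation.\<close>

lemma nabla'_E_commute: assumes p: "p \<in> U" shows "nabla' (E i) (E j) p = nabla' (E j) (E i) p"
proof
  fix f
  show "nabla' (E i) (E j) p f = nabla' (E j) (E i) p f"
    using p by (simp add: nabla_coord_expand[OF nabla'(1) xi] christoffel_symmetric[OF nabla'(2) xi, of p i j])
qed

lemma metric_E_derivative:
  assumes p: "p \<in> U"
  shows "E k p (\<lambda>q. g q (E i q) (E j q)) = \<epsilon> * (- partial k (partial i (partial j \<phi>)) (\<xi> p)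
    - \<alpha> * (partial k (partial i \<phi>) (\<xi> p) * partial j \<phi> (\<xi> p) + partial i \<phi> (\<xi> p) * partial k (partial j \<phi>) (\<xi> p)))"
proof -
  let ?h = "\<lambda>x. \<epsilon> * (- partial i (partial j \<phi>) x - \<alpha> * partial i \<phi> x * partial j \<phi> x)"
  have s: "smooth_on (\<xi> ` U) (partial i \<phi>)" "smooth_on (\<xi> ` U) (partial i (partial j \<phi>))" for i j
    by (intro smooth_on_partial phi)+
  have "smooth_on (\<xi> ` U) (\<lambda>x. \<epsilon> * (-1 * partial i (partial j \<phi>) x - \<alpha> * partial i \<phi> x * partial j \<phi> x))"
    by (intro smooth_on_mult smooth_on_diff smooth_on_const s open_xi)
  then have h: "smooth_on (snd (U, \<xi>) ` U) ?h" by simp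
  have "E k p (\<lambda>q. g q (E i q) (E j q)) = E k p (\<lambda>q. ?h (snd (U, \<xi>) q))"
    by (rule tangent_germ[OF E_tangent[OF p] open_U p]) (simp add: metric_xi)
  also have "\<dots> = partial k ?h (\<xi> p)"
    using coord_field_chart_comp(1)[OF xi open_U _ h p] by simp
  also have "(?h has_derivative (\<lambda>v. \<epsilon> * (- frechet_derivative (partial i (partial j \<phi>)) (at (\<xi> p)) v
    - \<alpha> * (frechet_derivative (partial i \<phi>) (at (\<xi> p)) v * partial j \<phi> (\<xi> p) +
      partial i \<phi> (\<xi> p) * frechet_derivative (partial j \<phi>) (at (\<xi> p)) v)))) (at (\<xi> p))"
    using p by (auto intro!: derivative_eq_intros smooth_on_has_derivative[OF s(1)] smooth_on_has_derivative[OF s(2)]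
        simp: fun_eq_iff algebra_simps)
  then have "partial k ?h (\<xi> p) = \<epsilon> * (- partial k (partial i (partial j \<phi>)) (\<xi> p)
    - \<alpha> * (partial k (partial i \<phi>) (\<xi> p) * partial j \<phi> (\<xi> p) + partial i \<phi> (\<xi> p) * partial k (partial j \<phi>) (\<xi> p)))"
    using partialI[of ?h _ "\<xi> p" k] by (simp add: partial_def[of k])
  finally show ?thesis .
qed

text \<open>Since \<open>\<nabla>\<close> is determined up to a 1-form \<open>\<tau>\<close> by its geodesics, the Codazzi equation (the part of duality
  that survives antisymmetrisation) compared with the same equation for \<open>- \<alpha> d\<phi>\<close> pins down \<open>\<tau>\<close>.\<close>

lemma christoffel_xi:
  assumes p: "p \<in> U"
  shows "christoffel A nabla (U, \<xi>) i j k p = (if i = k then - \<alpha> * partial j \<phi> (\<xi> p) else 0) +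
    (if j = k then - \<alpha> * partial i \<phi> (\<xi> p) else 0)"
proof -
  note pm = subsetD[OF U_subset p]
  define G where "G i j = g p (E i p) (E j p)" for i j
  have "\<exists>\<tau>. \<forall>i j k. christoffel A nabla (U, \<xi>) i j k p = (if i = k then \<tau> j else 0) + (if j = k then \<tau> i else 0)"
    using christoffel_if_straight[OF nabla xi] p straight by simp
  then obtain \<tau> where \<tau>': "\<forall>i j k. christoffel A nabla (U, \<xi>) i j k p =
      (if i = k then \<tau> j else 0) + (if j = k then \<tau> i else 0)" by (elim exE)
  note \<tau> = \<tau>'[rule_format]
  have nE: "nabla (E k) (E i) p = tv_add (tv_scale (\<tau> i) (E k p)) (tv_scale (\<tau> k) (E i p))" for k i
  proof
    fix f
    show "nabla (E k) (E i) p f = tv_add (tv_scale (\<tau> i) (E k p)) (tv_scale (\<tau> k) (E i p)) f"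
      using p by (simp add: nabla_coord_expand[OF nabla(1) xi] \<tau> tv_add_def tv_scale_def distrib_right
          sum.distrib if_distrib[of "\<lambda>x. x * _"] cong: if_cong)
  qed
  have t: "E i p \<in> tangent_space A p" "tv_scale r (E i p) \<in> tangent_space A p" for i r
    using E_tangent[OF p] tangent_space_scale by blast+
  have gn: "g p (nabla (E k) (E i) p) (E j p) = \<tau> i * G k j + \<tau> k * G i j" for k i j
    unfolding nE G_def
    by (simp add: metric_add_left[OF riemannian pm t(2) t(2) t(1)] metric_scale_left[OF riemannian pm t(1) t(1) t(1)])
  have Gs: "G i j = G j i" for i j unfolding G_def by (rule metric_commute[OF riemannian pm t(1) t(1) t(1)])
  \<comment> \<open>Duality antisymmetrised in \<open>k\<close> and \<open>j\<close>: the
    \<open>nabla'\<close> terms cancel by torsion-freeness, the terms with \<open>\<tau> i\<close>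
    by symmetry of \<open>G\<close>.\<close>
  have cod: "E k p (\<lambda>q. g q (E i q) (E j q)) - E j p (\<lambda>q. g q (E i q) (E k q)) = \<tau> k * G i j - \<tau> j * G i k" for i j k
    unfolding duality[OF E_vector_field E_vector_field E_vector_field p] gn nabla'_E_commute[OF p, of k j]
    using Gs[of k j] by simp
  have sym: "partial k (partial i (partial j \<phi>)) (\<xi> p) = partial j (partial i (partial k \<phi>)) (\<xi> p)" for i j k
  proof -
    have x: "\<xi> p \<in> \<xi> ` U" using p by blast
    have c: "partial k (partial i (partial j \<phi>)) (\<xi> p) = partial k (partial j (partial i \<phi>)) (\<xi> p)" for i j k
      by (rule partial_cong[OF open_xi x partial_symmetric[OF open_xi phi]])
    show ?thesis
      unfolding c[of k i j] c[of j i k] by (rule partial_symmetric[OF open_xi smooth_on_partial[OF phi] x])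
  qed
  define w where "w = (\<chi> k. \<tau> k + \<alpha> * partial k \<phi> (\<xi> p))"
  have Gx: "G i j = \<epsilon> * (- partial i (partial j \<phi>) (\<xi> p) - \<alpha> * partial i \<phi> (\<xi> p) * partial j \<phi> (\<xi> p))" for i j
    unfolding G_def by (rule metric_xi[OF p])
  have ps: "partial k (partial j \<phi>) (\<xi> p) = partial j (partial k \<phi>) (\<xi> p)" for j k
    using p by (intro partial_symmetric[OF open_xi phi]) auto
  \<comment> \<open>Differentiating the expression of \<open>g\<close> in \<open>\<phi>\<close>, the
    third derivatives cancel by symmetry, and what remains is the same equation with
    \<open>- \<alpha> d\<phi>\<close> in place of \<open>\<tau>\<close>.\<close>
  have "\<tau> k * G i j - \<tau> j * G i k = - \<alpha> * partial k \<phi> (\<xi> p) * G i j + \<alpha> * partial j \<phi> (\<xi> p) * G i k" for i j k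
    using cod[of k i j] unfolding metric_E_derivative[OF p] sym[of k i j] ps[of k j] ps[of k i] ps[of j i] Gx
    by (simp add: algebra_simps)
  then have wG: "w $ k * G i j = w $ j * G i k" for i j k
    by (simp add: w_def algebra_simps)
  have "w = 0"
  proof -
    \<comment> \<open>Dimension at least 2 provides \<open>v\<close>. Contracting \<open>wG\<close>
      with \<open>v\<close> in \<open>i\<close> and \<open>j\<close> gives
      \<open>w_k g(V, V) = (w \<bullet> v) g(V, E_k) = 0\<close>, so definiteness of
      \<open>g\<close> yields \<open>w = 0\<close>.\<close>
    obtain v where v: "v \<noteq> 0" "orthogonal w v"
      using orthogonal_to_vector_exists[of w] dim by auto
    define V where "V = tangent_vec A (U, \<xi>) p v"
    have V: "V \<in> tangent_space A p" using tangent_space_chart[OF xi] p by (auto simp: V_def)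
    have Vc: "V (\<lambda>q. \<xi> q $ i) = v $ i" for i
      using tangent_vec_coordinate[OF xi, of p v i] p by (simp add: V_def)
    obtain i where "v $ i \<noteq> 0" using v by (auto simp: vec_eq_iff)
    then have "V \<noteq> (\<lambda>f. 0)" using Vc[of i] by auto
    then have VV: "g p V V > 0" by (rule metric_pos[OF riemannian pm V V V])
    have gV: "g p V V = (\<Sum>i\<in>UNIV. \<Sum>j\<in>UNIV. v $ i * v $ j * G i j)"
      using metric_chart[OF riemannian pm V V xi] p by (simp add: Vc G_def)
    have "w $ k = 0" for k
    proof -
      have "w $ k * g p V V = (\<Sum>i\<in>UNIV. \<Sum>j\<in>UNIV. v $ i * v $ j * (w $ k * G i j))"
        by (simp add: gV sum_distrib_left mult_ac)
      also have "\<dots> = (\<Sum>i\<in>UNIV. (\<Sum>j\<in>UNIV. w $ j * v $ j) * (v $ i * G i k))"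
        by (simp only: wG[of k _ _]) (simp add: sum_distrib_right sum_distrib_left mult_ac)
      also have "(\<Sum>j\<in>UNIV. w $ j * v $ j) = 0" using v(2) by (simp add: orthogonal_def inner_vec_def)
      finally show ?thesis using VV by simp
    qed
    then show ?thesis by (simp add: vec_eq_iff)
  qed
  then have "\<tau> k = - \<alpha> * partial k \<phi> (\<xi> p)" for k
    by (auto simp: w_def vec_eq_iff eq_neg_iff_add_eq_0)
  then show ?thesis by (simp add: \<tau>)
qed

lemma hessian_xi:
  assumes W: "open W" "W \<subseteq> U" and h: "smooth_on (\<xi> ` W) h" and p: "p \<in> W"
  shows "hessian nabla (E a) (E b) (\<lambda>q. h (\<xi> q)) p = partial a (partial b h) (\<xi> p) +
    \<alpha> * partial b \<phi> (\<xi> p) * partial a h (\<xi> p) + \<alpha> * partial a \<phi> (\<xi> p) * partial b h (\<xi> p)"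
proof -
  have pU: "p \<in> U" using p W by auto
  have "nabla (E a) (E b) p (\<lambda>q. h (\<xi> q)) =
    - \<alpha> * partial b \<phi> (\<xi> p) * E a p (\<lambda>q. h (\<xi> q)) - \<alpha> * partial a \<phi> (\<xi> p) * E b p (\<lambda>q. h (\<xi> q))"
    using pU by (simp add: nabla_coord_expand[OF nabla(1) xi] christoffel_xi distrib_right
          sum.distrib if_distrib[of "\<lambda>x. x * _"] sum_negf cong: if_cong)
  then show ?thesis
    using coord_field_chart_comp[OF xi W(1) _ _ p, of h] W h by (simp add: hessian_def)
qed

text \<open>Reduces statements in an arbitrary chart, as \<open>induces\<close> requires them, to
  the chart \<open>\<xi>\<close> in which the Christoffel symbols are known.\<close>

lemma hessian_transform:
  assumes c: "c \<in> A" and f: "smooth_fun A W f" and W: "W \<subseteq> U" and p: "p \<in> W" "p \<in> fst c"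
  shows "hessian nabla (coord_field A c i) (coord_field A c j) f p =
    (\<Sum>a\<in>UNIV. \<Sum>b\<in>UNIV. coord_field A c i p (\<lambda>q. \<xi> q $ a) * coord_field A c j p (\<lambda>q. \<xi> q $ b) * hessian nabla (E a) (E b) f p)"
proof -
  have o: "open (W \<inter> fst c)" using smooth_fun_open[OF f] chart_open[OF c] by (rule open_Int)
  have f': "smooth_fun A (W \<inter> fst c) f" by (rule smooth_fun_subset[OF f o]) auto
  have e: "vector_field A (W \<inter> fst c) (coord_field A c i)" for i
    by (rule vector_field_subset[OF coord_field_vector_field[OF c] o]) auto
  show ?thesis
    using hessian_chart[OF nabla(1) f' _ e e xi] W p by auto
qed

text \<open>\<open>solution n\<close> with \<open>n = \<eta> p\<close> is \<open>exp (\<alpha> L(\<cdot>, p))\<close> up to a constant factor. It solves a linear second order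
  equation that only involves \<open>g\<close> and \<open>\<nabla>\<close>.\<close>

definition solution :: "real^'d \<Rightarrow> 'm \<Rightarrow> real" where
  "solution n q = (1 + \<alpha> * (\<xi> q \<bullet> n)) * exp (- \<alpha> * \<phi> (\<xi> q))"

lemma solution_smooth: "smooth_fun A U (solution n)"
  unfolding solution_def[abs_def]
  using smooth_fun_chart_comp[OF xi open_U _ , of "\<lambda>x. (1 + \<alpha> * (x \<bullet> n)) * exp (- \<alpha> * \<phi> x)"]
    smooth_on_affine_exp[OF open_xi phi] by simp

text \<open>In \<open>\<xi>\<close> this is \<open>partial_partial_affine_exp\<close>, whose bracket
  equals \<open>\<epsilon> * g\<close> because \<open>\<epsilon> * \<epsilon> = 1\<close>. The
  arbitrary chart \<open>c\<close> lets the solution of one dual system be examined in the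
  coordinates of another.\<close>

lemma hessian_solution:
  assumes c: "c \<in> A" and p: "p \<in> U" "p \<in> fst c"
  shows "hessian nabla (coord_field A c i) (coord_field A c j) (solution n) p =
    \<alpha> * \<epsilon> * g p (coord_field A c i p) (coord_field A c j p) * solution n p"
proof -
  have *: "hessian nabla (E a) (E b) (solution n) p = \<alpha> * \<epsilon> * g p (E a p) (E b p) * solution n p" for a b
  proof -
    have "hessian nabla (E a) (E b) (solution n) p =
      \<alpha> * (- partial a (partial b \<phi>) (\<xi> p) - \<alpha> * partial a \<phi> (\<xi> p) * partial b \<phi> (\<xi> p)) * solution n p"
      unfolding solution_def[abs_def]
      by (subst hessian_xi[OF open_U order_refl smooth_on_affine_exp[OF open_xi phi] p(1)])
        (rule partial_partial_affine_exp[OF open_xi phi], use p in auto)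
    also have "\<dots> = \<alpha> * (\<epsilon> * \<epsilon>) * (- partial a (partial b \<phi>) (\<xi> p) - \<alpha> * partial a \<phi> (\<xi> p) * partial b \<phi> (\<xi> p)) * solution n p"
      by (simp add: eps)
    finally show ?thesis by (simp add: metric_xi[OF p(1)] mult_ac)
  qed
  have e: "coord_field A c i p \<in> tangent_space A p" for i by (rule coord_field_tangent[OF c p(2)])
  show ?thesis
    unfolding hessian_transform[OF c solution_smooth order_refl p] *
      metric_chart[OF riemannian subsetD[OF U_subset p(1)] e e xi, unfolded fst_conv snd_conv, OF p(1)]
    by (simp add: sum_distrib_left sum_distrib_right mult_ac)
qed

lemma tangent_xi:
  assumes V: "V \<in> tangent_space A p" and W: "open W" "W \<subseteq> U" and h: "smooth_on (\<xi> ` W) h" and p: "p \<in> W"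
  shows "V (\<lambda>q. h (\<xi> q)) = (\<Sum>a\<in>UNIV. V (\<lambda>q. \<xi> q $ a) * partial a h (\<xi> p))"
  using tangent_expand[OF V xi, of "\<lambda>q. h (\<xi> q)"] coord_field_chart_comp(1)[OF xi W(1) _ _ p, of h] W h p
  by auto

text \<open>By \<open>grad\<close>, the derivative \<open>\<alpha> \<eta>_p\<close> of the affine
  factor balances that of the exponential. This is the initial condition
  \<open>df(p) = 0\<close>.\<close>

lemma tangent_solution:
  assumes V: "V \<in> tangent_space A p" and p: "p \<in> U"
  shows "V (solution (\<eta> p)) = 0"
proof -
  have "partial a (\<lambda>x. (1 + \<alpha> * (x \<bullet> \<eta> p)) * exp (- \<alpha> * \<phi> x)) (\<xi> p) = 0" for a
    using partial_affine_exp[OF open_xi phi, of "\<xi> p" a \<alpha> "\<eta> p"] p grad[OF p, of a]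
    by (simp add: algebra_simps)
  then show ?thesis
    unfolding solution_def[abs_def]
    using tangent_xi[OF V open_U order_refl smooth_on_affine_exp[OF open_xi phi] p] by simp
qed

lemma exp_L_div_plus:
  assumes "1 + \<alpha> * (\<xi> q \<bullet> \<eta> p) > 0"
  shows "exp (\<alpha> * L_div_plus \<alpha> \<xi> \<eta> \<phi> \<psi> q p) = exp (- \<alpha> * \<psi> (\<eta> p)) * solution (\<eta> p) q"
proof -
  have "\<alpha> * L_div_plus \<alpha> \<xi> \<eta> \<phi> \<psi> q p = ln (1 + \<alpha> * (\<xi> q \<bullet> \<eta> p)) + (- \<alpha> * \<phi> (\<xi> q)) + (- \<alpha> * \<psi> (\<eta> p))"
    using alpha by (simp add: L_div_plus_def algebra_simps)
  then show ?thesis unfolding solution_def using assms by (simp only: exp_add exp_ln mult_ac)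
qed

lemma L_div_plus_diagonal: "p \<in> U \<Longrightarrow> L_div_plus \<alpha> \<xi> \<eta> \<phi> \<psi> p p = 0"
  using fenchel[of p] by (simp add: L_div_plus_def)

text \<open>In the coordinates \<open>\<xi>\<close> the function
  \<open>f * exp (\<alpha> \<phi>)\<close> has vanishing second partials, so on a convex set it is
  determined by its value and derivative at one point. The set need not be centred at
  \<open>p\<close>, hence one ball will serve all \<open>p\<close> in it.\<close>

lemma vanishes_if_hessian_eq:
  assumes f: "smooth_fun A W f" and W: "W \<subseteq> U"
    and eq: "\<And>q a b. q \<in> W \<Longrightarrow> hessian nabla (E a) (E b) f q = \<alpha> * \<epsilon> * g q (E a q) (E b q) * f q"
    and B: "open B" "convex B" "B \<subseteq> \<xi> ` W" and p: "p \<in> W" "\<xi> p \<in> B"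
    and f0: "f p = 0" and f1: "\<And>V. V \<in> tangent_space A p \<Longrightarrow> V f = 0"
    and q: "q \<in> W" "\<xi> q \<in> B"
  shows "f q = 0"
proof -
  have oW: "open W" by (rule smooth_fun_open[OF f])
  define F where "F x = f (chart_inv (U, \<xi>) x)" for x
  have F: "smooth_on (\<xi> ` W) F" using smooth_fun_rep'[OF f xi] W by (simp add: F_def[abs_def])
  have oxW: "open (\<xi> ` W)" using open_image_chart'[OF xi oW] W by simp
  have Fxi: "F (\<xi> q) = f q" if "q \<in> U" for q
    using chart_inv_chart[OF xi, of q] that by (simp add: F_def)
  have h: "hessian nabla (E a) (E b) f q = partial a (partial b F) (\<xi> q) +
    \<alpha> * partial b \<phi> (\<xi> q) * partial a F (\<xi> q) + \<alpha> * partial a \<phi> (\<xi> q) * partial b F (\<xi> q)" if q: "q \<in> W" for a b q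
  proof -
    have "E a q f = partial a F (\<xi> q)" for a
      using coord_field_apply[OF smooth_nearI[OF f q], of "(U, \<xi>)" a] by (simp add: F_def[abs_def])
    moreover have "E a q (vf_app (E b) f) = partial a (partial b F) (\<xi> q)"
      using coord_field_second[OF f q xi, of a b] W by (simp add: F_def[abs_def])
    moreover have "nabla (E a) (E b) q f = - \<alpha> * partial b \<phi> (\<xi> q) * E a q f - \<alpha> * partial a \<phi> (\<xi> q) * E b q f"
      using q W by (auto simp add: nabla_coord_expand[OF nabla(1) xi] christoffel_xi distrib_right
          sum.distrib if_distrib[of "\<lambda>x. x * _"] sum_negf subset_iff cong: if_cong)
    ultimately show ?thesis by (simp add: hessian_def)
  qed
  have phiW: "smooth_on (\<xi> ` W) \<phi>" by (rule smooth_on_subset[OF phi]) (use W in auto)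
  let ?w = "\<lambda>x. F x * exp (\<alpha> * \<phi> x)"
  have hess: "partial a (partial b ?w) x = 0" if x: "x \<in> B" for a b x
  proof -
    obtain q where q: "q \<in> W" "x = \<xi> q" using B x by auto
    have "\<alpha> * \<epsilon> * g q (E a q) (E b q) = \<alpha> * (\<epsilon> * \<epsilon>) * (- partial a (partial b \<phi>) x - \<alpha> * partial a \<phi> x * partial b \<phi> x)"
      using q W metric_xi[of q a b] by auto
    then have "hessian nabla (E a) (E b) f q = \<alpha> * (- partial a (partial b \<phi>) x - \<alpha> * partial a \<phi> x * partial b \<phi> x) * F x"
      using eq[OF q(1), of a b] q W Fxi[of q] by (auto simp: eps)
    then show ?thesis
      using h[OF q(1), of a b] q
      by (intro partial_partial_mult_exp[OF oxW phiW _ F]) auto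
  qed
  have w: "smooth_on B ?w"
    by (rule smooth_on_subset[OF _ B(3)]) (intro smooth_on_mult smooth_on_exp smooth_on_const oxW F phiW)
  have pU: "p \<in> U" using p W by auto
  have "partial a F (\<xi> p) = 0" for a
    using coord_field_apply[OF smooth_nearI[OF f p(1)], of "(U, \<xi>)" a] f1[OF E_tangent[OF pU]]
    by (simp add: F_def[abs_def])
  \<comment> \<open>The other term of the product rule, containing \<open>d\<phi>\<close>, vanishes
    because \<open>f p = 0\<close>.\<close>
  moreover have "partial a ?w (\<xi> p) = partial a F (\<xi> p) * exp (\<alpha> * \<phi> (\<xi> p))" for a
  proof -
    have x: "\<xi> p \<in> \<xi> ` W" using p by auto
    have "(?w has_derivative (\<lambda>v. frechet_derivative F (at (\<xi> p)) v * exp (\<alpha> * \<phi> (\<xi> p)))) (at (\<xi> p))"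
      by (auto intro!: derivative_eq_intros smooth_on_has_derivative[OF F x] smooth_on_has_derivative[OF phiW x]
          simp: fun_eq_iff Fxi[OF pU] f0)
    from partialI[OF this] show ?thesis by (simp add: partial_def)
  qed
  ultimately have "partial a ?w (\<xi> p) = 0" for a by simp
  from zero_if_hessian_zero[OF B(1,2) w p(2) _ this hess q(2)]
  have "?w (\<xi> q) = 0" using Fxi[OF pU] f0 by simp
  then show ?thesis using Fxi[of q] q W by auto
qed

end

section \<open>The canonical divergence\<close>

lemma partial_affine:
  assumes "F differentiable (at x)"
  shows "partial i (\<lambda>x. r * (F x - s)) x = r * partial i F x"
proof -
  have "((\<lambda>x. r * (F x - s)) has_derivative (\<lambda>v. r * frechet_derivative F (at x) v)) (at x)"
    by (auto intro!: derivative_eq_intros frechet_derivative_worksI assms)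
  from partialI[OF this] show ?thesis by (simp add: partial_def)
qed

context manifold
begin

lemma tangent_sum:
  assumes "finite I" "\<And>i. i \<in> I \<Longrightarrow> smooth_near A p (f i)" and V: "V \<in> tangent_space A p"
  shows "smooth_near A p (\<lambda>q. \<Sum>i\<in>I. f i q) \<and> V (\<lambda>q. \<Sum>i\<in>I. f i q) = (\<Sum>i\<in>I. V (f i))"
  using assms(1,2)
proof (induction I rule: finite_induct)
  case empty
  obtain c where c: "c \<in> A" "p \<in> fst c" using tangent_ex_chart[OF V] by blast
  then have "smooth_fun A (fst c) (\<lambda>q. 0)" by (intro smooth_fun_const chart_open chart_subset_mfd)
  then show ?case using tangent_const[OF V] smooth_nearI c by simp
next
  case (insert i I)
  then show ?case using tangent_add[OF V, of "f i" "\<lambda>q. \<Sum>i\<in>I. f i q"]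
      smooth_near_add[of p "f i" "\<lambda>q. \<Sum>i\<in>I. f i q"] by simp
qed

lemma chart_continuous: "c \<in> A \<Longrightarrow> continuous_on (fst c) (snd c)"
  using chart_homeomorphism by (auto simp: homeomorphism_def)

lemma smooth_near_coordinate: "c \<in> A \<Longrightarrow> p \<in> fst c \<Longrightarrow> smooth_near A p (\<lambda>q. snd c q $ i)"
  using smooth_nearI[OF smooth_fun_coordinate] .

lemma open_chart_preimage:
  assumes "c \<in> A" "open W" "W \<subseteq> fst c" "open B" shows "open {q \<in> W. snd c q \<in> B}"
proof -
  have "{q \<in> W. snd c q \<in> B} = W \<inter> snd c -` B" by auto
  then show ?thesis
    using continuous_open_preimage[OF continuous_on_subset[OF chart_continuous[OF assms(1)] assms(3)] assms(2,4)] by simp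
qed

section \<open>Exchange of the two coordinate systems and criticality on the diagonal\<close>

lemma statistical_manifold_swap:
  assumes stat: "statistical_manifold A g nabla nabla'"
  shows "statistical_manifold A g nabla' nabla"
proof -
  have g: "riemannian_metric A g" using stat by (simp add: statistical_manifold_def)
  have dual: "\<forall>U X Y Z. vector_field A U X \<and> vector_field A U Y \<and> vector_field A U Z \<longrightarrow>
        (\<forall>p\<in>U. Z p (\<lambda>q. g q (X q) (Y q)) = g p (nabla Z X p) (Y p) + g p (X p) (nabla' Z Y p))"
    and n: "affine_connection A nabla" "affine_connection A nabla'"
    using stat unfolding statistical_manifold_def by auto
  have "Z p (\<lambda>q. g q (X q) (Y q)) = g p (nabla' Z X p) (Y p) + g p (X p) (nabla Z Y p)"
    if X: "vector_field A W X" and Y: "vector_field A W Y" and Z: "vector_field A W Z" and p: "p \<in> W" for W X Y Z p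
  proof -
    have t: "q \<in> mfd A" "X q \<in> tangent_space A q" "Y q \<in> tangent_space A q" if "q \<in> W" for q
      using that X Y vector_field_tangent vector_field_subset_mfd by blast+
    have n': "nabla Z Y p \<in> tangent_space A p" "nabla' Z X p \<in> tangent_space A p"
      by (rule vector_field_tangent[OF nabla_vector_field[OF n(1) Z Y] p],
          rule vector_field_tangent[OF nabla_vector_field[OF n(2) Z X] p])
    have "Z p (\<lambda>q. g q (X q) (Y q)) = Z p (\<lambda>q. g q (Y q) (X q))"
      by (rule tangent_germ[OF vector_field_tangent[OF Z p] vector_field_open[OF Z] p])
        (use t metric_commute[OF g] in blast)
    also have "\<dots> = g p (nabla Z Y p) (X p) + g p (Y p) (nabla' Z X p)"
      using dual[rule_format, of W Y X Z p] X Y Z p by simp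
    finally show ?thesis
      using metric_commute[OF g t(1)[OF p] n'(1) t(2)[OF p] t(2)[OF p]]
        metric_commute[OF g t(1)[OF p] n'(2) t(3)[OF p] t(3)[OF p]] by simp
  qed
  then show ?thesis using stat unfolding statistical_manifold_def by auto
qed

lemma adapted_coordinates_swap:
  "adapted_coordinates A nabla nabla' \<alpha> U \<xi> \<eta> \<phi> \<psi> \<Longrightarrow> adapted_coordinates A nabla' nabla \<alpha> U \<eta> \<xi> \<psi> \<phi>"
  unfolding adapted_coordinates_def by (simp add: inner_commute add.commute)

text \<open>For fixed \<open>p\<close>, the function \<open>q \<mapsto> \<epsilon> L[q : p]\<close>
  vanishes at \<open>q = p\<close> by the Fenchel identity and is nonnegative nearby. So it has a
  local minimum there, and the claim is the vanishing of its derivative.\<close>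

lemma grad_if_nonneg:
  assumes adapted: "adapted_coordinates A nabla nabla' \<alpha> U \<xi> \<eta> \<phi> \<psi>" and \<alpha>: "\<alpha> > 0" and \<epsilon>: "\<epsilon> \<noteq> 0"
    and nonneg: "nonneg_near_diagonal U (\<lambda>q p. \<epsilon> * L_div_plus \<alpha> \<xi> \<eta> \<phi> \<psi> q p)" and p: "p \<in> U"
  shows "\<eta> p $ i = (1 + \<alpha> * (\<xi> p \<bullet> \<eta> p)) * partial i \<phi> (\<xi> p)"
proof -
  have xi: "(U, \<xi>) \<in> A" and phi: "smooth_on (\<xi> ` U) \<phi>" and P: "1 + \<alpha> * (\<xi> p \<bullet> \<eta> p) > 0"
    and fen: "\<phi> (\<xi> p) + \<psi> (\<eta> p) = 1 / \<alpha> * ln (1 + \<alpha> * (\<xi> p \<bullet> \<eta> p))"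
    using adapted p by (auto simp: adapted_coordinates_def)
  let ?P = "1 + \<alpha> * (\<xi> p \<bullet> \<eta> p)"
  define k where "k x = \<epsilon> * (1 / \<alpha> * ln (1 + \<alpha> * (x \<bullet> \<eta> p)) - \<phi> x - \<psi> (\<eta> p))" for x
  have x: "\<xi> p \<in> \<xi> ` U" using p by auto
  have dk: "(k has_derivative (\<lambda>v. \<epsilon> * ((v \<bullet> \<eta> p) / ?P - frechet_derivative \<phi> (at (\<xi> p)) v))) (at (\<xi> p))"
    unfolding k_def[abs_def] using P \<alpha>
    by (auto intro!: derivative_eq_intros inner_has_derivative smooth_on_has_derivative[OF phi x] simp: fun_eq_iff divide_inverse)
  have "eventually (\<lambda>q. \<epsilon> * L_div_plus \<alpha> \<xi> \<eta> \<phi> \<psi> q p \<ge> 0) (nhds p)"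
    using nonneg p by (simp add: nonneg_near_diagonal_def)
  then obtain S where S: "open S" "p \<in> S" "\<And>q. q \<in> S \<Longrightarrow> \<epsilon> * L_div_plus \<alpha> \<xi> \<eta> \<phi> \<psi> q p \<ge> 0"
    unfolding eventually_nhds by (elim exE conjE) simp
  have "k (\<xi> p) = 0" using fen by (simp add: k_def)
  moreover have "k y \<ge> 0" if "y \<in> \<xi> ` (U \<inter> S)" for y
    using that S(3) by (auto simp: k_def L_div_plus_def)
  moreover have "eventually (\<lambda>y. y \<in> \<xi> ` (U \<inter> S)) (at (\<xi> p))"
    using open_image_chart[OF xi S(1)] S(2) p by (intro eventually_at_in_open') auto
  ultimately have "eventually (\<lambda>y. k (\<xi> p) \<le> k y) (at (\<xi> p))"
    by (auto elim!: eventually_mono)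
  from has_derivative_local_min[OF dk this]
  have "\<epsilon> * ((axis i 1 \<bullet> \<eta> p) / ?P - frechet_derivative \<phi> (at (\<xi> p)) (axis i 1)) = 0" by meson
  then have "\<eta> p $ i / ?P = partial i \<phi> (\<xi> p)" using \<epsilon> by (simp add: partial_def inner_axis')
  then show ?thesis using P by (simp add: field_simps)
qed

text \<open>By the Fenchel identity \<open>L\<close> is constant along the diagonal. The part of its
  derivative that comes from the first argument vanishes by \<open>grad\<close>, hence so does the
  part from the second.\<close>

lemma grad_swap:
  assumes adapted: "adapted_coordinates A nabla nabla' \<alpha> U \<xi> \<eta> \<phi> \<psi>" and \<alpha>: "\<alpha> > 0" and p: "p \<in> U"
    and grad: "\<And>i. \<eta> p $ i = (1 + \<alpha> * (\<xi> p \<bullet> \<eta> p)) * partial i \<phi> (\<xi> p)"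
  shows "\<xi> p $ i = (1 + \<alpha> * (\<eta> p \<bullet> \<xi> p)) * partial i \<psi> (\<eta> p)"
proof -
  have xi: "(U, \<xi>) \<in> A" and eta: "(U, \<eta>) \<in> A" and phi: "smooth_on (\<xi> ` U) \<phi>" and psi: "smooth_on (\<eta> ` U) \<psi>"
    and P: "1 + \<alpha> * (\<xi> p \<bullet> \<eta> p) > 0"
    and fen: "\<And>q. q \<in> U \<Longrightarrow> \<phi> (\<xi> q) + \<psi> (\<eta> q) = 1 / \<alpha> * ln (1 + \<alpha> * (\<xi> q \<bullet> \<eta> q))"
    using adapted p by (auto simp: adapted_coordinates_def)
  let ?P = "1 + \<alpha> * (\<xi> p \<bullet> \<eta> p)"
  define R where "R y = \<xi> (chart_inv (U, \<eta>) y)" for y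
  have R: "smooth_on (\<eta> ` U) R" using smooth_on_transition[OF eta xi] by (simp add: R_def[abs_def])
  have Re: "R (\<eta> q) = \<xi> q" if "q \<in> U" for q using chart_inv_chart[OF eta, of q] that by (simp add: R_def)
  have y: "\<eta> p \<in> \<eta> ` U" and x: "\<xi> p \<in> \<xi> ` U" using p by auto
  have oe: "open (\<eta> ` U)" using chart_image_open[OF eta] by simp
  let ?R' = "frechet_derivative R (at (\<eta> p))" and ?\<phi>' = "frechet_derivative \<phi> (at (\<xi> p))"
    and ?\<psi>' = "frechet_derivative \<psi> (at (\<eta> p))"
  have Rd: "(R has_derivative ?R') (at (\<eta> p))" by (rule smooth_on_has_derivative[OF R y])
  have "((\<lambda>y. \<phi> (R y)) has_derivative (\<lambda>v. ?\<phi>' (?R' v))) (at (\<eta> p))"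
    by (rule has_derivative_compose[OF Rd]) (simp add: Re[OF p] smooth_on_has_derivative[OF phi x])
  then have 1: "((\<lambda>y. \<phi> (R y) + \<psi> y) has_derivative (\<lambda>v. ?\<phi>' (?R' v) + ?\<psi>' v)) (at (\<eta> p))"
    by (intro has_derivative_add smooth_on_has_derivative[OF psi y])
  have "((\<lambda>y. 1 / \<alpha> * ln (1 + \<alpha> * (R y \<bullet> y))) has_derivative (\<lambda>v. (?R' v \<bullet> \<eta> p + \<xi> p \<bullet> v) / ?P)) (at (\<eta> p))"
    using P \<alpha> by (auto intro!: derivative_eq_intros Rd simp: Re[OF p] fun_eq_iff inner_commute add.commute divide_inverse)
  then have "((\<lambda>y. \<phi> (R y) + \<psi> y) has_derivative (\<lambda>v. (?R' v \<bullet> \<eta> p + \<xi> p \<bullet> v) / ?P)) (at (\<eta> p))"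
    by (rule has_derivative_transform_within_open[OF _ oe y]) (use fen Re in auto)
  from has_derivative_unique[OF 1 this]
  have eq: "?\<phi>' (?R' v) + ?\<psi>' v = (?R' v \<bullet> \<eta> p + \<xi> p \<bullet> v) / ?P" for v by meson
  \<comment> \<open>For \<open>u = ?R' v\<close> this cancels the terms of \<open>eq\<close> caused
    by the motion of \<open>\<xi>\<close>, leaving the derivative of \<open>\<psi>\<close>.\<close>
  have "?\<phi>' u = (u \<bullet> \<eta> p) / ?P" for u
  proof -
    have "u \<bullet> \<eta> p = (\<Sum>i\<in>UNIV. u $ i * \<eta> p $ i)" by (simp add: inner_vec_def)
    also have "\<dots> = (\<Sum>i\<in>UNIV. ?P * (u $ i * partial i \<phi> (\<xi> p)))"
      by (rule sum.cong[OF refl]) (simp only: grad mult.left_commute)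
    finally have "u \<bullet> \<eta> p = ?P * (\<Sum>i\<in>UNIV. u $ i * partial i \<phi> (\<xi> p))"
      by (simp only: sum_distrib_left)
    then show ?thesis
      using P frechet_derivative_partial[OF smooth_on_differentiable[OF phi x], of u] by simp
  qed
  then have "?\<psi>' (axis i 1) = (\<xi> p \<bullet> axis i 1) / ?P" using eq[of "axis i 1"] by (simp add: add_divide_distrib)
  then show ?thesis using P by (simp add: partial_def inner_axis inner_commute[of "\<eta> p"])
qed

end

context dual_system
begin

section \<open>Derivatives of the divergence in its second argument\<close>

lemma xi_continuous: "continuous_on U \<xi>" and eta_continuous: "continuous_on U \<eta>"
  using chart_continuous[OF xi] chart_continuous[OF eta] by auto

definition quotient_domain :: "real^'d \<Rightarrow> 'm set" where
  "quotient_domain n = {q \<in> U. 1 + \<alpha> * (\<xi> q \<bullet> n) > 0}"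

text \<open>With \<open>n = \<eta> p\<close> and \<open>w\<close> the
  \<open>\<eta>\<close>-components of a tangent vector at \<open>p\<close>, this is the derivative
  of the logarithmic term of \<open>L[q : p]\<close> in \<open>p\<close> along that vector, as a
  function of \<open>q\<close>.\<close>

definition quotient :: "real^'d \<Rightarrow> real^'d \<Rightarrow> 'm \<Rightarrow> real" where
  "quotient n w q = (\<xi> q \<bullet> w) / (1 + \<alpha> * (\<xi> q \<bullet> n))"

lemma quotient_domain: "open (quotient_domain n)" "quotient_domain n \<subseteq> U"
  "p \<in> U \<Longrightarrow> p \<in> quotient_domain (\<eta> p)"
  using open_chart_preimage[OF xi open_U _ open_affine_pos[of \<alpha> n]] pos
  by (auto simp: quotient_domain_def)

lemma smooth_on_quotient_xi:
  "smooth_on (\<xi> ` quotient_domain n) (\<lambda>x. (x \<bullet> w) / (1 + \<alpha> * (x \<bullet> n)))"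
  using open_image_chart'[OF xi quotient_domain(1)] quotient_domain(2)
  by (intro smooth_on_quotient) (auto simp: quotient_domain_def)

lemma smooth_fun_quotient: "smooth_fun A (quotient_domain n) (quotient n w)"
  unfolding quotient_def[abs_def]
  using smooth_fun_chart_comp[OF xi quotient_domain(1), of n] quotient_domain(2) smooth_on_quotient_xi[of n w] by simp

lemma tangent_quotient:
  assumes V: "V \<in> tangent_space A p" and p: "p \<in> U"
  defines "P \<equiv> 1 + \<alpha> * (\<xi> p \<bullet> \<eta> p)"
  shows "V (quotient (\<eta> p) w) = (\<Sum>a\<in>UNIV. V (\<lambda>q. \<xi> q $ a) * (w $ a / P - \<alpha> * (\<xi> p \<bullet> w) * \<eta> p $ a / P\<^sup>2))"
  unfolding quotient_def[abs_def] P_def partial_quotient[OF pos[OF p], symmetric]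
  by (rule tangent_xi[OF V quotient_domain(1,2) smooth_on_quotient_xi quotient_domain(3)[OF p]])

text \<open>At the base point \<open>grad\<close> gives \<open>d\<phi> = \<eta> / P\<close>, so
  there the Christoffel symbols of \<open>nabla\<close> agree with those for which
  \<open>partial_partial_quotient\<close> says that the Hessian is zero.\<close>

lemma hessian_quotient:
  assumes p: "p \<in> U" "p \<in> fst c" and c: "c \<in> A"
  shows "hessian nabla (coord_field A c i) (coord_field A c j) (quotient (\<eta> p) w) p = 0"
proof -
  have "partial a \<phi> (\<xi> p) = \<eta> p $ a / (1 + \<alpha> * (\<xi> p \<bullet> \<eta> p))" for a
    using grad[OF p(1), of a] pos[OF p(1)] by simp
  then have "hessian nabla (E a) (E b) (quotient (\<eta> p) w) p = 0" for a b
    unfolding quotient_def[abs_def]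
    by (subst hessian_xi[OF quotient_domain(1,2) smooth_on_quotient_xi quotient_domain(3)[OF p(1)]])
      (simp add: partial_partial_quotient[OF pos[OF p(1)]])
  then show ?thesis
    using hessian_transform[OF c smooth_fun_quotient quotient_domain(2) quotient_domain(3)[OF p(1)] p(2)] by simp
qed

text \<open>Differentiating \<open>\<eta> = P d\<phi>\<close> along \<open>Z\<close> expresses the
  second derivatives of \<open>\<phi>\<close>, and with them \<open>g\<close>, through the
  \<open>\<eta>\<close>-components of \<open>Z\<close>. The right side is minus the mixed derivative
  of \<open>\<epsilon> L\<close>.\<close>

lemma metric_eq_quotient:
  assumes V: "V \<in> tangent_space A p" and Z: "Z \<in> tangent_space A p" and p: "p \<in> U"
  shows "g p V Z = - \<epsilon> * V (quotient (\<eta> p) (\<chi> a. Z (\<lambda>q. \<eta> q $ a)))"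
proof -
  define P where "P = 1 + \<alpha> * (\<xi> p \<bullet> \<eta> p)"
  define z where "z = (\<chi> a. Z (\<lambda>q. \<eta> q $ a))"
  define \<zeta> where "\<zeta> = (\<chi> a. Z (\<lambda>q. \<xi> q $ a))"
  have P: "P > 0" using pos[OF p] by (simp add: P_def)
  have gr: "partial a \<phi> (\<xi> p) = \<eta> p $ a / P" for a
    using grad[OF p, of a] P by (simp add: P_def)
  have sx: "smooth_near A p (\<lambda>q. \<xi> q $ a)" and se: "smooth_near A p (\<lambda>q. \<eta> q $ a)" for a
    using smooth_near_coordinate[OF xi] smooth_near_coordinate[OF eta] p by auto
  have sc: "smooth_near A p (\<lambda>q. r)" for r
    using smooth_nearI[OF smooth_fun_const[OF open_U U_subset] p] .
  have sP: "smooth_near A p (\<lambda>q. \<Sum>c\<in>UNIV. \<xi> q $ c * \<eta> q $ c)"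
    and ZP: "Z (\<lambda>q. \<Sum>c\<in>UNIV. \<xi> q $ c * \<eta> q $ c) = \<zeta> \<bullet> \<eta> p + \<xi> p \<bullet> z"
    using tangent_sum[OF finite _ Z, of UNIV "\<lambda>c q. \<xi> q $ c * \<eta> q $ c"] smooth_near_mult[OF sx se]
    by (simp_all add: tangent_mult[OF Z sx se] z_def \<zeta>_def inner_vec_def sum.distrib)
  have sphi: "smooth_on (\<xi> ` U) (partial a \<phi>)" for a by (rule smooth_on_partial[OF phi])
  \<comment> \<open>The identity \<open>grad\<close> differentiated along \<open>Z\<close>; both
    \<open>\<xi>\<close> and \<open>\<eta>\<close> vary in the factor \<open>P\<close>.\<close>
  have zeq: "z $ a = \<alpha> * (\<zeta> \<bullet> \<eta> p + \<xi> p \<bullet> z) * (\<eta> p $ a / P) + P * (\<Sum>b\<in>UNIV. \<zeta> $ b * partial a (partial b \<phi>) (\<xi> p))" for a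
  proof -
    have sf: "smooth_near A p (\<lambda>q. partial a \<phi> (\<xi> q))"
      using smooth_nearI[OF smooth_fun_chart_comp[OF xi open_U _ , of "partial a \<phi>"] p] sphi by simp
    have "z $ a = Z (\<lambda>q. (1 + \<alpha> * (\<Sum>c\<in>UNIV. \<xi> q $ c * \<eta> q $ c)) * partial a \<phi> (\<xi> q))"
      unfolding z_def vec_lambda_beta
      by (rule tangent_germ[OF Z open_U p]) (simp add: grad[of _ a] inner_vec_def)
    also have "\<dots> = \<alpha> * (\<zeta> \<bullet> \<eta> p + \<xi> p \<bullet> z) * partial a \<phi> (\<xi> p) + P * Z (\<lambda>q. partial a \<phi> (\<xi> q))"
      by (subst tangent_mult[OF Z smooth_near_add[OF sc smooth_near_mult[OF sc sP]] sf],
          subst tangent_add[OF Z sc smooth_near_mult[OF sc sP]], subst tangent_mult[OF Z sc sP])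
        (simp add: tangent_const[OF Z] ZP P_def inner_vec_def)
    also have "Z (\<lambda>q. partial a \<phi> (\<xi> q)) = (\<Sum>b\<in>UNIV. \<zeta> $ b * partial b (partial a \<phi>) (\<xi> p))"
      using tangent_xi[OF Z open_U order_refl sphi p] by (simp add: \<zeta>_def)
    also have "\<dots> = (\<Sum>b\<in>UNIV. \<zeta> $ b * partial a (partial b \<phi>) (\<xi> p))"
      using p by (intro sum.cong refl arg_cong2[where f="(*)"] partial_symmetric[OF open_xi phi]) auto
    finally show ?thesis by (simp add: gr)
  qed
  \<comment> \<open>The part \<open>\<zeta> \<bullet> \<eta>\<close> of the derivative of
    \<open>P\<close> cancels the product of first derivatives in the metric, and what is left is the
    gradient of the quotient.\<close>
  have "(\<Sum>b\<in>UNIV. \<zeta> $ b * g p (E a p) (E b p)) = - \<epsilon> * (z $ a / P - \<alpha> * (\<xi> p \<bullet> z) * \<eta> p $ a / P\<^sup>2)" for a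
  proof -
    have "(\<Sum>b\<in>UNIV. \<zeta> $ b * g p (E a p) (E b p)) =
      \<epsilon> * (- (\<Sum>b\<in>UNIV. \<zeta> $ b * partial a (partial b \<phi>) (\<xi> p)) - \<alpha> * (\<eta> p $ a / P) * (\<zeta> \<bullet> \<eta> p / P))"
      by (simp add: metric_xi[OF p] gr inner_vec_def sum_distrib_left sum_subtractf sum_negf
          right_diff_distrib sum_divide_distrib mult_ac)
    also have "(\<Sum>b\<in>UNIV. \<zeta> $ b * partial a (partial b \<phi>) (\<xi> p)) = (z $ a - \<alpha> * (\<zeta> \<bullet> \<eta> p + \<xi> p \<bullet> z) * (\<eta> p $ a / P)) / P"
      using zeq[of a] P by (simp add: field_simps)
    finally show ?thesis by (simp add: divide_inverse power2_eq_square algebra_simps)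
  qed
  moreover have "g p V Z = (\<Sum>a\<in>UNIV. V (\<lambda>q. \<xi> q $ a) * (\<Sum>b\<in>UNIV. \<zeta> $ b * g p (E a p) (E b p)))"
    using metric_chart[OF riemannian subsetD[OF U_subset p] V Z xi] p
    by (simp add: \<zeta>_def sum_distrib_left mult.assoc)
  ultimately show ?thesis
    unfolding z_def[symmetric] tangent_quotient[OF V p, folded P_def] by (simp add: sum_distrib_left mult_ac)
qed

text \<open>Besides the quotient there is only a term from \<open>\<psi>\<close> that does not
  depend on \<open>q\<close>; it disappears under every further derivative in
  \<open>q\<close>.\<close>

lemma partial_second_argument:
  assumes c: "c \<in> A" and p: "p \<in> U" "p \<in> fst c" and q: "q \<in> quotient_domain (\<eta> p)"
  shows "partial k (\<lambda>y. \<epsilon> * L_div_plus \<alpha> \<xi> \<eta> \<phi> \<psi> q (chart_inv c y)) (snd c p) =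
    \<epsilon> * (quotient (\<eta> p) (\<chi> a. coord_field A c k p (\<lambda>q. \<eta> q $ a)) q -
      partial k (\<lambda>y. \<psi> (\<eta> (chart_inv c y))) (snd c p))"
proof -
  define T where "T y = \<eta> (chart_inv c y)" for y
  define x where "x = snd c p"
  define s where "s = \<xi> q"
  let ?O = "snd c ` (fst c \<inter> U)"
  have T: "smooth_on ?O T" using smooth_on_transition[OF c eta] by (simp add: T_def[abs_def])
  have x: "x \<in> ?O" using p by (auto simp: x_def)
  have Tx: "T x = \<eta> p" using c p by (simp add: T_def x_def)
  have oO: "open ?O" by (rule open_image_chart[OF c open_U])
  have Td: "(T has_derivative frechet_derivative T (at x)) (at x)" by (rule smooth_on_has_derivative[OF T x])
  have P: "1 + \<alpha> * (s \<bullet> \<eta> p) > 0" using q by (simp add: quotient_domain_def s_def)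
  have "smooth_on ?O (\<lambda>y. \<psi> (T y))"
    by (rule smooth_on_compose[OF oO T psi]) (use c in \<open>auto simp: T_def\<close>)
  then have pd: "((\<lambda>y. \<psi> (T y)) has_derivative frechet_derivative (\<lambda>y. \<psi> (T y)) (at x)) (at x)"
    by (rule smooth_on_has_derivative[OF _ x])
  have "((\<lambda>y. \<epsilon> * (1 / \<alpha> * ln (1 + \<alpha> * (s \<bullet> T y)) - \<phi> s - \<psi> (T y))) has_derivative
    (\<lambda>v. \<epsilon> * ((s \<bullet> frechet_derivative T (at x) v) / (1 + \<alpha> * (s \<bullet> \<eta> p)) - frechet_derivative (\<lambda>y. \<psi> (T y)) (at x) v))) (at x)"
    using P alpha by (auto intro!: derivative_eq_intros Td pd simp: Tx fun_eq_iff divide_inverse)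
  from partialI[OF this]
  have "partial k (\<lambda>y. \<epsilon> * (1 / \<alpha> * ln (1 + \<alpha> * (s \<bullet> T y)) - \<phi> s - \<psi> (T y))) x =
    \<epsilon> * ((s \<bullet> frechet_derivative T (at x) (axis k 1)) / (1 + \<alpha> * (s \<bullet> \<eta> p)) - partial k (\<lambda>y. \<psi> (T y)) x)"
    by (simp add: partial_def)
  moreover have "frechet_derivative T (at x) (axis k 1) = (\<chi> a. coord_field A c k p (\<lambda>q. \<eta> q $ a))"
  proof (rule vec_eq_iff[THEN iffD2], rule allI)
    fix a
    have "frechet_derivative T (at x) (axis k 1) $ a = partial k (\<lambda>y. T y $ a) x"
      unfolding partial_def by (rule frechet_derivative_component[OF smooth_on_differentiable[OF T x]])
    also have "\<dots> = coord_field A c k p (\<lambda>q. \<eta> q $ a)"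
      using coord_field_apply[OF smooth_near_coordinate[OF eta, of p a], of c k] p by (simp add: T_def x_def)
    finally show "frechet_derivative T (at x) (axis k 1) $ a = (\<chi> a. coord_field A c k p (\<lambda>q. \<eta> q $ a)) $ a" by simp
  qed
  ultimately show ?thesis by (simp add: L_div_plus_def quotient_def s_def T_def x_def)
qed

text \<open>The derivative of \<open>D\<close> in \<open>y\<close> along direction \<open>k\<close>
  is \<open>\<epsilon> * f k\<close> up to a constant, so the metric comes from
  \<open>metric_eq_quotient\<close>. Since the Hessian of \<open>f k\<close> vanishes at
  \<open>p\<close>, its second coordinate derivatives there are the derivatives of
  \<open>f k\<close> along the covariant derivatives of the coordinate fields, and
  \<open>metric_eq_quotient\<close> applies again.\<close>

lemma induces_primal:
  assumes c: "c \<in> A" and p: "p \<in> U" "p \<in> fst c"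
  defines "D \<equiv> \<lambda>x y. \<epsilon> * L_div_plus \<alpha> \<xi> \<eta> \<phi> \<psi> (chart_inv c x) (chart_inv c y)"
  shows "g p (coord_field A c i p) (coord_field A c j p) =
      - partial i (\<lambda>x. partial j (\<lambda>y. D x y) (snd c p)) (snd c p)" (is ?metric)
    and "g p (nabla (coord_field A c i) (coord_field A c j) p) (coord_field A c k p) =
      - partial i (\<lambda>x. partial j (\<lambda>x. partial k (\<lambda>y. D x y) (snd c p)) x) (snd c p)" (is ?nabla)
proof -
  define f where "f k = quotient (\<eta> p) (\<chi> a. coord_field A c k p (\<lambda>q. \<eta> q $ a))" for k
  define s where "s k = partial k (\<lambda>y. \<psi> (\<eta> (chart_inv c y))) (snd c p)" for k
  let ?W = "fst c \<inter> quotient_domain (\<eta> p)"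
  let ?N = "snd c ` ?W"
  have W: "open ?W" "p \<in> ?W" using p quotient_domain chart_open[OF c] by (auto intro: open_Int)
  have N: "open ?N" "snd c p \<in> ?N" using open_image_chart'[OF c W(1)] W(2) by auto
  have f: "smooth_fun A ?W (f k)" for k
    unfolding f_def by (rule smooth_fun_subset[OF smooth_fun_quotient W(1)]) auto
  let ?F = "\<lambda>k x. f k (chart_inv c x)"
  have F: "smooth_on ?N (?F k)" for k by (rule smooth_fun_rep'[OF f c]) auto
  have D: "partial k (\<lambda>y. D x y) (snd c p) = \<epsilon> * (?F k x - s k)" if "x \<in> ?N" for x k
    unfolding D_def f_def s_def by (rule partial_second_argument[OF c p]) (use that c in auto)
  \<comment> \<open>The form with \<open>- 0\<close> lets \<open>partial_affine\<close> apply once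
    more below.\<close>
  have D1: "partial j (\<lambda>x. partial k (\<lambda>y. D x y) (snd c p)) x = \<epsilon> * (partial j (?F k) x - 0)" if x: "x \<in> ?N" for x j k
  proof -
    have "partial j (\<lambda>x. partial k (\<lambda>y. D x y) (snd c p)) x = partial j (\<lambda>x. \<epsilon> * (?F k x - s k)) x"
      by (rule partial_cong[OF N(1) x D])
    then show ?thesis by (simp add: partial_affine[OF smooth_on_differentiable[OF F x]])
  qed
  have e: "coord_field A c i p \<in> tangent_space A p" for i by (rule coord_field_tangent[OF c p(2)])
  have "g p (coord_field A c i p) (coord_field A c j p) = - \<epsilon> * coord_field A c i p (f j)"
    unfolding f_def by (rule metric_eq_quotient[OF e e p(1)])
  also have "coord_field A c i p (f j) = partial i (?F j) (snd c p)"
    by (rule coord_field_apply[OF smooth_nearI[OF f W(2)]])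
  finally show ?metric unfolding D1[OF N(2)] by simp
  have "partial i (\<lambda>x. partial j (\<lambda>x. partial k (\<lambda>y. D x y) (snd c p)) x) (snd c p) =
    partial i (\<lambda>x. \<epsilon> * (partial j (?F k) x - 0)) (snd c p)"
    by (rule partial_cong[OF N D1])
  also have "\<dots> = \<epsilon> * partial i (partial j (?F k)) (snd c p)"
    by (rule partial_affine[OF smooth_on_differentiable[OF smooth_on_partial[OF F] N(2)]])
  also have "partial i (partial j (?F k)) (snd c p) = coord_field A c i p (vf_app (coord_field A c j) (f k))"
    by (rule coord_field_second[OF f W(2) c, symmetric]) auto
  also have "\<dots> = nabla (coord_field A c i) (coord_field A c j) p (f k)"
    using hessian_quotient[OF p c] by (simp add: hessian_def f_def)
  finally show ?nabla
    using metric_eq_quotient[OF nabla_coord_tangent[OF nabla(1) c p(2)] e p(1)] by (simp add: f_def)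
qed

lemma smooth_near_diagonal:
  assumes c: "c \<in> A" and p: "p \<in> U" "p \<in> fst c"
  shows "\<exists>W. open W \<and> (snd c p, snd c p) \<in> W \<and>
    smooth_on W (\<lambda>(x, y). \<epsilon> * L_div_plus \<alpha> \<xi> \<eta> \<phi> \<psi> (chart_inv c x) (chart_inv c y))"
proof -
  define S where "S x = \<xi> (chart_inv c x)" for x
  define T where "T x = \<eta> (chart_inv c x)" for x
  let ?O = "snd c ` (fst c \<inter> U)"
  have oO: "open ?O" by (rule open_image_chart[OF c open_U])
  have S: "smooth_on ?O S" using smooth_on_transition[OF c xi] by (simp add: S_def[abs_def])
  have T: "smooth_on ?O T" using smooth_on_transition[OF c eta] by (simp add: T_def[abs_def])
  have oOO: "open (?O \<times> ?O)" using oO by (simp add: open_Times)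
  have S2: "smooth_on (?O \<times> ?O) (\<lambda>z. S (fst z))"
    using smooth_on_compose[OF oOO smooth_on_bounded_linear[OF bounded_linear_fst] S] by auto
  have T2: "smooth_on (?O \<times> ?O) (\<lambda>z. T (snd z))"
    using smooth_on_compose[OF oOO smooth_on_bounded_linear[OF bounded_linear_snd] T] by auto
  have Q: "smooth_on (?O \<times> ?O) (\<lambda>z. 1 + \<alpha> * (S (fst z) \<bullet> T (snd z)))"
    by (intro smooth_on_add smooth_on_mult smooth_on_inner smooth_on_const S2 T2 oOO)
  define W where "W = (?O \<times> ?O) \<inter> (\<lambda>z. 1 + \<alpha> * (S (fst z) \<bullet> T (snd z))) -` {0<..}"
  have W: "open W" unfolding W_def
    by (rule continuous_open_preimage[OF smooth_on_continuous[OF Q] oOO]) simp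
  have "(snd c p, snd c p) \<in> W" using c p pos[OF p(1)] by (auto simp: W_def S_def T_def)
  moreover have "smooth_on W (\<lambda>z. \<epsilon> * (1 / \<alpha> * ln (1 + \<alpha> * (S (fst z) \<bullet> T (snd z))) - \<phi> (S (fst z)) - \<psi> (T (snd z))))"
  proof (intro smooth_on_mult smooth_on_diff smooth_on_const smooth_on_ln W)
    show "smooth_on W (\<lambda>z. 1 + \<alpha> * (S (fst z) \<bullet> T (snd z)))"
      by (rule smooth_on_subset[OF Q]) (auto simp: W_def)
    have "smooth_on (?O \<times> ?O) (\<lambda>z. \<phi> (S (fst z)))"
      using c by (intro smooth_on_compose[OF oOO S2 phi]) (auto simp: S_def)
    then show "smooth_on W (\<lambda>z. \<phi> (S (fst z)))" by (rule smooth_on_subset) (auto simp: W_def)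
    have "smooth_on (?O \<times> ?O) (\<lambda>z. \<psi> (T (snd z)))"
      using c by (intro smooth_on_compose[OF oOO T2 psi]) (auto simp: T_def)
    then show "smooth_on W (\<lambda>z. \<psi> (T (snd z)))" by (rule smooth_on_subset) (auto simp: W_def)
  qed (auto simp: W_def)
  ultimately show ?thesis using W
    by (intro exI[of _ W]) (simp add: case_prod_unfold L_div_plus_def S_def T_def)
qed

text \<open>The counterparts of \<open>metric_xi\<close> and \<open>grad\<close> are the hypothesis
  and \<open>grad_swap\<close>; the other assumptions are symmetric under the exchange. Results
  about \<open>nabla\<close> thereby become results about \<open>nabla'\<close>.\<close>

lemma dual_system_swap:
  assumes metric_eta: "\<And>p i j. p \<in> U \<Longrightarrow> g p (coord_field A (U, \<eta>) i p) (coord_field A (U, \<eta>) j p) =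
      \<epsilon> * (- partial i (partial j \<psi>) (\<eta> p) - \<alpha> * partial i \<psi> (\<eta> p) * partial j \<psi> (\<eta> p))"
  shows "dual_system A g nabla' nabla \<alpha> \<epsilon> U \<eta> \<xi> \<psi> \<phi>"
proof unfold_locales
  show "\<xi> p $ i = (1 + \<alpha> * (\<eta> p \<bullet> \<xi> p)) * partial i \<psi> (\<eta> p)" if "p \<in> U" for p i
    using grad_swap[OF adapted alpha that] grad[OF that] by blast
qed (use alpha eps dim statistical_manifold_swap[OF stat] adapted_coordinates_swap[OF adapted] metric_eta in auto)

lemma L_div_plus_swap: "L_div_plus \<alpha> \<eta> \<xi> \<psi> \<phi> q p = L_div_plus \<alpha> \<xi> \<eta> \<phi> \<psi> p q"
  by (simp add: L_div_plus_def inner_commute)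

lemma induces_if_metric_eta:
  assumes metric_eta: "\<And>p i j. p \<in> U \<Longrightarrow> g p (coord_field A (U, \<eta>) i p) (coord_field A (U, \<eta>) j p) =
      \<epsilon> * (- partial i (partial j \<psi>) (\<eta> p) - \<alpha> * partial i \<psi> (\<eta> p) * partial j \<psi> (\<eta> p))"
  shows "induces A U (\<lambda>q p. \<epsilon> * L_div_plus \<alpha> \<xi> \<eta> \<phi> \<psi> q p) g nabla nabla'"
proof -
  interpret dual: dual_system A g nabla' nabla \<alpha> \<epsilon> U \<eta> \<xi> \<psi> \<phi> using metric_eta by (rule dual_system_swap)
  show ?thesis
    unfolding induces_def Let_def
  proof (intro ballI conjI allI)
    fix c p i j k assume c: "c \<in> A" and "p \<in> U \<inter> fst c"
    then have p: "p \<in> U" "p \<in> fst c" by auto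
    show "\<exists>W. open W \<and> (snd c p, snd c p) \<in> W \<and>
      smooth_on W (\<lambda>(x, y). \<epsilon> * L_div_plus \<alpha> \<xi> \<eta> \<phi> \<psi> (chart_inv c x) (chart_inv c y))"
      by (rule smooth_near_diagonal[OF c p])
    show "g p (coord_field A c i p) (coord_field A c j p) = - partial i (\<lambda>x. partial j
      (\<lambda>y. \<epsilon> * L_div_plus \<alpha> \<xi> \<eta> \<phi> \<psi> (chart_inv c x) (chart_inv c y)) (snd c p)) (snd c p)"
      by (rule induces_primal[OF c p])
    show "g p (nabla (coord_field A c i) (coord_field A c j) p) (coord_field A c k p) = - partial i (\<lambda>x. partial j (\<lambda>x. partial k
      (\<lambda>y. \<epsilon> * L_div_plus \<alpha> \<xi> \<eta> \<phi> \<psi> (chart_inv c x) (chart_inv c y)) (snd c p)) x) (snd c p)"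
      by (rule induces_primal[OF c p])
    show "g p (nabla' (coord_field A c i) (coord_field A c j) p) (coord_field A c k p) = - partial i (\<lambda>y. partial j (\<lambda>y. partial k
      (\<lambda>x. \<epsilon> * L_div_plus \<alpha> \<xi> \<eta> \<phi> \<psi> (chart_inv c x) (chart_inv c y)) (snd c p)) y) (snd c p)"
      \<comment> \<open>The exchange transposes the arguments of the divergence, which matches the
        roles of the two variables in the identity for \<open>nabla'\<close>.\<close>
      using dual.induces_primal(2)[OF c p, of i j k] unfolding L_div_plus_swap .
  qed
qed

end

text \<open>For fixed \<open>p\<close>, the functions \<open>exp (\<alpha> L[\<cdot> : p])\<close>
  of the two systems solve the same linear equation with value 1 and derivative 0 at
  \<open>p\<close>. The neighbourhood must be fixed before \<open>p\<close>, as it has to serve all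
  \<open>p\<close> in it.\<close>

lemma L_div_plus_unique:
  assumes D1: "dual_system A g nabla nabla' \<alpha> \<epsilon> U1 \<xi>1 \<eta>1 \<phi>1 \<psi>1"
    and D2: "dual_system A g nabla nabla' \<alpha> \<epsilon> U2 \<xi>2 \<eta>2 \<phi>2 \<psi>2" and p0: "p0 \<in> U1 \<inter> U2"
  shows "\<exists>V. open V \<and> p0 \<in> V \<and> V \<subseteq> U1 \<inter> U2 \<and>
    (\<forall>q\<in>V. \<forall>p\<in>V. 1 + \<alpha> * (\<xi>1 q \<bullet> \<eta>1 p) > 0 \<and> 1 + \<alpha> * (\<xi>2 q \<bullet> \<eta>2 p) > 0 \<and>
      L_div_plus \<alpha> \<xi>1 \<eta>1 \<phi>1 \<psi>1 q p = L_div_plus \<alpha> \<xi>2 \<eta>2 \<phi>2 \<psi>2 q p)"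
proof -
  interpret S1: dual_system A g nabla nabla' \<alpha> \<epsilon> U1 \<xi>1 \<eta>1 \<phi>1 \<psi>1 by (rule D1)
  interpret S2: dual_system A g nabla nabla' \<alpha> \<epsilon> U2 \<xi>2 \<eta>2 \<phi>2 \<psi>2 by (rule D2)
  let ?W = "U1 \<inter> U2"
  have oW: "open ?W" using S1.open_U S2.open_U by blast
  have cont: "continuous_on (?W \<times> ?W) (\<lambda>z. 1 + \<alpha> * (\<xi> (fst z) \<bullet> \<eta> (snd z)))"
    if "continuous_on ?W \<xi>" "continuous_on ?W \<eta>" for \<xi> \<eta> :: "'a \<Rightarrow> real^'b"
    by (intro continuous_intros continuous_on_compose2[OF that(1)] continuous_on_compose2[OF that(2)]) auto
  \<comment> \<open>The pairs for which both logarithms have positive arguments; around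
    \<open>(p0, p0)\<close> this open set contains a square \<open>V0 \<times> V0\<close>.\<close>
  define Q where "Q = ((?W \<times> ?W) \<inter> (\<lambda>z. 1 + \<alpha> * (\<xi>1 (fst z) \<bullet> \<eta>1 (snd z))) -` {0<..}) \<inter>
    ((?W \<times> ?W) \<inter> (\<lambda>z. 1 + \<alpha> * (\<xi>2 (fst z) \<bullet> \<eta>2 (snd z))) -` {0<..})"
  have oWW: "open (?W \<times> ?W)" using oW by (intro open_Times)
  have "open Q" unfolding Q_def
    using S1.xi_continuous S1.eta_continuous S2.xi_continuous S2.eta_continuous
    by (intro open_Int[OF continuous_open_preimage[OF cont oWW] continuous_open_preimage[OF cont oWW]])
      (auto intro: continuous_on_subset)
  moreover have "(p0, p0) \<in> Q" using p0 S1.pos S2.pos by (auto simp: Q_def)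
  ultimately obtain X Y where XY: "open X" "open Y" "p0 \<in> X" "p0 \<in> Y" "X \<times> Y \<subseteq> Q"
    by (rule open_prod_elim) auto
  define V0 where "V0 = X \<inter> Y"
  have V0: "open V0" "p0 \<in> V0" "V0 \<times> V0 \<subseteq> Q" "V0 \<subseteq> ?W" using XY by (auto simp: V0_def Q_def)
  have "open (\<xi>1 ` V0)" using S1.open_image_chart'[OF S1.xi V0(1)] V0(4) by simp
  \<comment> \<open>A ball in the first coordinates supplies the convexity needed for uniqueness;
    \<open>V\<close> is its preimage, so that \<open>q\<close> and \<open>p\<close> both lie in
    it.\<close>
  then obtain r where r: "r > 0" "ball (\<xi>1 p0) r \<subseteq> \<xi>1 ` V0" using V0(2) open_contains_ball by blast
  define V where "V = {q \<in> V0. \<xi>1 q \<in> ball (\<xi>1 p0) r}"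
  have V: "open V" "p0 \<in> V" "V \<subseteq> V0"
    using S1.open_chart_preimage[OF S1.xi V0(1), of "ball (\<xi>1 p0) r"] V0 r by (auto simp: V_def)
  have L: "L_div_plus \<alpha> \<xi>1 \<eta>1 \<phi>1 \<psi>1 q p = L_div_plus \<alpha> \<xi>2 \<eta>2 \<phi>2 \<psi>2 q p"
    if q: "q \<in> V" and p: "p \<in> V" for q p
  proof -
    have qV: "q \<in> V0" "\<xi>1 q \<in> ball (\<xi>1 p0) r" and pV: "p \<in> V0" "\<xi>1 p \<in> ball (\<xi>1 p0) r"
      using q p by (auto simp: V_def)
    have pU: "p \<in> U1" "p \<in> U2" using pV V0 by auto
    have pos: "1 + \<alpha> * (\<xi>1 q' \<bullet> \<eta>1 p) > 0" "1 + \<alpha> * (\<xi>2 q' \<bullet> \<eta>2 p) > 0" if "q' \<in> V0" for q'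
    proof -
      have "(q', p) \<in> Q" using that pV(1) V0(3) by blast
      then show "1 + \<alpha> * (\<xi>1 q' \<bullet> \<eta>1 p) > 0" "1 + \<alpha> * (\<xi>2 q' \<bullet> \<eta>2 p) > 0" by (simp_all add: Q_def)
    qed
    let ?k1 = "exp (- \<alpha> * \<psi>1 (\<eta>1 p))" and ?k2 = "- exp (- \<alpha> * \<psi>2 (\<eta>2 p))"
    let ?f1 = "S1.solution (\<eta>1 p)" and ?f2 = "S2.solution (\<eta>2 p)"
    define d where "d q = ?k1 * ?f1 q + ?k2 * ?f2 q" for q
    have dL: "d q' = exp (\<alpha> * L_div_plus \<alpha> \<xi>1 \<eta>1 \<phi>1 \<psi>1 q' p) - exp (\<alpha> * L_div_plus \<alpha> \<xi>2 \<eta>2 \<phi>2 \<psi>2 q' p)"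
      if "q' \<in> V0" for q'
      using S1.exp_L_div_plus[OF pos(1)[OF that]] S2.exp_L_div_plus[OF pos(2)[OF that]] by (simp add: d_def)
    have f: "smooth_fun A V0 ?f1" "smooth_fun A V0 ?f2"
      using S1.smooth_fun_subset[OF S1.solution_smooth V0(1)] S1.smooth_fun_subset[OF S2.solution_smooth V0(1)] V0(4)
      by auto
    have sc: "smooth_fun A V0 (\<lambda>q. k)" for k
      using V0 S1.U_subset by (intro S1.smooth_fun_const) auto
    have sd: "smooth_fun A V0 d" unfolding d_def[abs_def]
      by (intro S1.smooth_fun_add S1.smooth_fun_mult sc f)
    have "d q = 0"
    proof (rule S1.vanishes_if_hessian_eq[OF sd _ _ open_ball convex_ball r(2) pV _ _ qV])
      show "V0 \<subseteq> U1" using V0 by auto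
      show "d p = 0" using dL[OF pV(1)] S1.L_div_plus_diagonal[OF pU(1)] S2.L_div_plus_diagonal[OF pU(2)] by simp
      show "Z d = 0" if Z: "Z \<in> tangent_space A p" for Z
      proof -
        have n: "smooth_near A p h" if "smooth_fun A V0 h" for h using S1.smooth_nearI[OF that pV(1)] .
        show ?thesis unfolding d_def[abs_def]
          unfolding S1.tangent_add[OF Z S1.smooth_near_mult[OF n[OF sc] n[OF f(1)]] S1.smooth_near_mult[OF n[OF sc] n[OF f(2)]]]
            S1.tangent_mult[OF Z n[OF sc] n[OF f(1)]] S1.tangent_mult[OF Z n[OF sc] n[OF f(2)]]
          by (simp add: S1.tangent_const[OF Z] S1.tangent_solution[OF Z pU(1)] S2.tangent_solution[OF Z pU(2)])
      qed
      fix q' a b assume q': "q' \<in> V0"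
      have qU: "q' \<in> U1" "q' \<in> U2" using q' V0 by auto
      have e: "vector_field A V0 (S1.E i)" for i
        by (rule S1.vector_field_subset[OF S1.E_vector_field V0(1)]) (use V0 in auto)
      have "hessian nabla (S1.E a) (S1.E b) d q' =
        ?k1 * hessian nabla (S1.E a) (S1.E b) ?f1 q' + ?k2 * hessian nabla (S1.E a) (S1.E b) ?f2 q'"
        unfolding d_def[abs_def] by (rule S1.hessian_linear_combination[OF S1.nabla(1) e e f q'])
      \<comment> \<open>Both solutions are examined in the frame of the first system, where they
        satisfy the same equation, so their linear combination \<open>d\<close> does too.\<close>
      also have "\<dots> = \<alpha> * \<epsilon> * g q' (S1.E a q') (S1.E b q') * d q'"
        using S1.hessian_solution[OF S1.xi qU(1)] S2.hessian_solution[OF S1.xi qU(2)] qU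
        by (simp add: d_def algebra_simps)
      finally show "hessian nabla (S1.E a) (S1.E b) d q' = \<alpha> * \<epsilon> * g q' (S1.E a q') (S1.E b q') * d q'" .
    qed
    then show ?thesis using dL[OF qV(1)] S1.alpha by simp
  qed
  have P: "1 + \<alpha> * (\<xi>1 q \<bullet> \<eta>1 p) > 0 \<and> 1 + \<alpha> * (\<xi>2 q \<bullet> \<eta>2 p) > 0" if "q \<in> V" "p \<in> V" for q p
  proof -
    have "(q, p) \<in> Q" using that V(3) V0(3) by blast
    then show ?thesis by (simp add: Q_def)
  qed
  show ?thesis
    by (intro exI[of _ V] conjI ballI V(1,2) L P[THEN conjunct1] P[THEN conjunct2] subset_trans[OF V(3) V0(4)])
qed

text \<open>The factor \<open>- 1\<close> is the value of \<open>\<epsilon>\<close> for positive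
  curvature.\<close>

lemma L_div_minus_eq: "L_div_minus \<alpha> \<xi> \<eta> \<phi> \<psi> = (\<lambda>q p. - 1 * L_div_plus \<alpha> \<xi> \<eta> \<phi> \<psi> q p)"
  by (simp add: L_div_minus_def L_div_plus_def fun_eq_iff)

lemma dual_systemI:
  assumes "\<alpha> > 0" "\<epsilon> * \<epsilon> = 1" "CARD('d) \<ge> 2" "statistical_manifold A g nabla nabla'"
    and "adapted_coordinates A nabla nabla' \<alpha> U \<xi> (\<eta> :: 'm::{t2_space,second_countable_topology} \<Rightarrow> real^'d::finite) \<phi> \<psi>"
    and "nonneg_near_diagonal U (\<lambda>q p. \<epsilon> * L_div_plus \<alpha> \<xi> \<eta> \<phi> \<psi> q p)"
    and "\<And>p i j. p \<in> U \<Longrightarrow> g p (coord_field A (U, \<xi>) i p) (coord_field A (U, \<xi>) j p) =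
      \<epsilon> * (- partial i (partial j \<phi>) (\<xi> p) - \<alpha> * partial i \<phi> (\<xi> p) * partial j \<phi> (\<xi> p))"
  shows "dual_system A g nabla nabla' \<alpha> \<epsilon> U \<xi> \<eta> \<phi> \<psi>"
proof -
  interpret manifold A using assms(4) by unfold_locales (simp add: statistical_manifold_def)
  have "\<epsilon> \<noteq> 0" using assms(2) by auto
  from grad_if_nonneg[OF assms(5,1) this assms(6)] show ?thesis
    using assms by unfold_locales auto
qed

theorem theorem19:
  fixes A :: "('m::{t2_space,second_countable_topology}, 'd::finite) chart set"
    and g :: "'m metric" and nabla nabla' :: "'m connection" and \<alpha> :: real
  assumes "\<alpha> > 0" and "CARD('d) \<ge> 2"
    and "statistical_manifold A g nabla nabla'"
    and "projectively_flat A nabla" and "projectively_flat A nabla'"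
  shows
    "(constant_curvature A g nabla (- \<alpha>) \<and> constant_curvature A g nabla' (- \<alpha>) \<longrightarrow>
       (\<forall>p0 U1 \<xi>1 \<eta>1 \<phi>1 \<psi>1 U2 \<xi>2 \<eta>2 \<phi>2 \<psi>2.
          p0 \<in> U1 \<inter> U2 \<and>
          dual_system_neg A g nabla nabla' \<alpha> U1 \<xi>1 \<eta>1 \<phi>1 \<psi>1 \<and>
          nonneg_near_diagonal U1 (L_div_plus \<alpha> \<xi>1 \<eta>1 \<phi>1 \<psi>1) \<and>
          dual_system_neg A g nabla nabla' \<alpha> U2 \<xi>2 \<eta>2 \<phi>2 \<psi>2 \<and>
          nonneg_near_diagonal U2 (L_div_plus \<alpha> \<xi>2 \<eta>2 \<phi>2 \<psi>2) \<longrightarrow>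
          (\<exists>V. open V \<and> p0 \<in> V \<and> V \<subseteq> U1 \<inter> U2 \<and>
             (\<forall>q\<in>V. \<forall>p\<in>V. 1 + \<alpha> * (\<xi>1 q \<bullet> \<eta>1 p) > 0 \<and> 1 + \<alpha> * (\<xi>2 q \<bullet> \<eta>2 p) > 0 \<and>
                L_div_plus \<alpha> \<xi>1 \<eta>1 \<phi>1 \<psi>1 q p = L_div_plus \<alpha> \<xi>2 \<eta>2 \<phi>2 \<psi>2 q p))) \<and>
       (\<forall>U \<xi> \<eta> \<phi> \<psi>.
          dual_system_neg A g nabla nabla' \<alpha> U \<xi> \<eta> \<phi> \<psi> \<and>
          nonneg_near_diagonal U (L_div_plus \<alpha> \<xi> \<eta> \<phi> \<psi>) \<longrightarrow>
          induces A U (L_div_plus \<alpha> \<xi> \<eta> \<phi> \<psi>) g nabla nabla'))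
     \<and>
     (constant_curvature A g nabla \<alpha> \<and> constant_curvature A g nabla' \<alpha> \<longrightarrow>
       (\<forall>p0 U1 \<xi>1 \<eta>1 \<phi>1 \<psi>1 U2 \<xi>2 \<eta>2 \<phi>2 \<psi>2.
          p0 \<in> U1 \<inter> U2 \<and>
          dual_system_pos A g nabla nabla' \<alpha> U1 \<xi>1 \<eta>1 \<phi>1 \<psi>1 \<and>
          nonneg_near_diagonal U1 (L_div_minus \<alpha> \<xi>1 \<eta>1 \<phi>1 \<psi>1) \<and>
          dual_system_pos A g nabla nabla' \<alpha> U2 \<xi>2 \<eta>2 \<phi>2 \<psi>2 \<and>
          nonneg_near_diagonal U2 (L_div_minus \<alpha> \<xi>2 \<eta>2 \<phi>2 \<psi>2) \<longrightarrow>
          (\<exists>V. open V \<and> p0 \<in> V \<and> V \<subseteq> U1 \<inter> U2 \<and>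
             (\<forall>q\<in>V. \<forall>p\<in>V. 1 + \<alpha> * (\<xi>1 q \<bullet> \<eta>1 p) > 0 \<and> 1 + \<alpha> * (\<xi>2 q \<bullet> \<eta>2 p) > 0 \<and>
                L_div_minus \<alpha> \<xi>1 \<eta>1 \<phi>1 \<psi>1 q p = L_div_minus \<alpha> \<xi>2 \<eta>2 \<phi>2 \<psi>2 q p))) \<and>
       (\<forall>U \<xi> \<eta> \<phi> \<psi>.
          dual_system_pos A g nabla nabla' \<alpha> U \<xi> \<eta> \<phi> \<psi> \<and>
          nonneg_near_diagonal U (L_div_minus \<alpha> \<xi> \<eta> \<phi> \<psi>) \<longrightarrow>
          induces A U (L_div_minus \<alpha> \<xi> \<eta> \<phi> \<psi>) g nabla nabla'))"
proof -
  have neg: "dual_system A g nabla nabla' \<alpha> 1 U \<xi> \<eta> \<phi> \<psi>"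
    if "dual_system_neg A g nabla nabla' \<alpha> U \<xi> \<eta> \<phi> \<psi>" "nonneg_near_diagonal U (L_div_plus \<alpha> \<xi> \<eta> \<phi> \<psi>)" for U \<xi> \<eta> \<phi> \<psi>
    using that assms
    by (intro dual_systemI) (simp_all add: dual_system_neg_def metric_from_potential_neg_def)
  have pos: "dual_system A g nabla nabla' \<alpha> (- 1) U \<xi> \<eta> \<phi> \<psi>"
    if "dual_system_pos A g nabla nabla' \<alpha> U \<xi> \<eta> \<phi> \<psi>" "nonneg_near_diagonal U (L_div_minus \<alpha> \<xi> \<eta> \<phi> \<psi>)" for U \<xi> \<eta> \<phi> \<psi>
    using that assms
    by (intro dual_systemI) (simp_all add: dual_system_pos_def metric_from_potential_pos_def L_div_minus_eq)
  have "induces A U (L_div_plus \<alpha> \<xi> \<eta> \<phi> \<psi>) g nabla nabla'"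
    if "dual_system_neg A g nabla nabla' \<alpha> U \<xi> \<eta> \<phi> \<psi>" "nonneg_near_diagonal U (L_div_plus \<alpha> \<xi> \<eta> \<phi> \<psi>)" for U \<xi> \<eta> \<phi> \<psi>
    using dual_system.induces_if_metric_eta[OF neg[OF that]] that(1)
    by (simp add: dual_system_neg_def metric_from_potential_neg_def)
  moreover have "induces A U (L_div_minus \<alpha> \<xi> \<eta> \<phi> \<psi>) g nabla nabla'"
    if "dual_system_pos A g nabla nabla' \<alpha> U \<xi> \<eta> \<phi> \<psi>" "nonneg_near_diagonal U (L_div_minus \<alpha> \<xi> \<eta> \<phi> \<psi>)" for U \<xi> \<eta> \<phi> \<psi>
    using dual_system.induces_if_metric_eta[OF pos[OF that]] that(1)
    by (simp add: dual_system_pos_def metric_from_potential_pos_def L_div_minus_eq)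
  moreover note L_div_plus_unique[OF neg neg] L_div_plus_unique[OF pos pos]
  ultimately show ?thesis by (simp add: L_div_minus_eq)
qed

end
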